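(* Let $k$ be an algebraically closed field and let $\Lambda$ be a finite-dimensional $k$-algebra which is non-distributive. Then there are $\Lambda$-modules $M(n)$, $R(n)$, $W(n)$ and non-invertible homomorphisms $$W(1) \leftarrow R(2) \leftarrow M(2) \to R(3) \to W(3) \leftarrow R(4) \leftarrow M(4) \to R(5) \to W(5) \leftarrow \cdots$$ that is, for every integer $n\ge 1$, non-invertible homomorphisms $$W(2n-1) \leftarrow R(2n) \leftarrow M(2n) \to R(2n+1) \to W(2n+1),$$ such that the arrows pointing to the left, $R(2n)\to W(2n-1)$ and $M(2n)\to R(2n)$, are couniform projections, the arrows pointing to the right, $M(2n)\to R(2n+1)$ and $R(2n+1)\to W(2n+1)$, are uniform inclusions, and such that $W(1)$ is a uniform module.
   Context: Modules are finite-dimensional left $\Lambda$-modules. A finite-dimensional algebra is called non-distributive if its lattice of two-sided ideals (with sum and intersection) is not distributive. An inclusion of modules $M'\subseteq M$ is called uniform if every submodule $U$ with $M'\subseteq U\subseteq M$ is indecomposable; an injective homomorphism is a uniform inclusion if the inclusion of its image is uniform. A module $M$ is uniform if it is non-zero and every inclusion $M'\subseteq M$ with $M'\ne 0$ is uniform (equivalently, $M\neq 0$ and any two non-zero submodules of $M$ intersect non-trivially). If $X$ is a submodule of $M$, the canonical map $M\to M/X$ is called a couniform projection if all the modules $M/X'$ with $X'$ a submodule of $X$ are indecomposable; a surjective homomorphism with kernel $X$ is a couniform projection if $M\to M/X$ is one. *)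

theory Defs
  imports "HOL-Algebra.Algebra"
begin

section \<open>Finite-dimensional algebras and left modules\<close>

text \<open>The library's locale \<^locale>\<open>module\<close> requires a commutative ring of scalars, and
  \<^locale>\<open>algebra\<close> requires a commutative algebra.  The next two locales have the same axioms
  without commutativity.  As in the library, the ring structure on the carrier of an algebra and
  the scalar multiplication live in one record of type \<^type>\<open>module_ext\<close>; for a module the
  fields \<^const>\<open>monoid.mult\<close> and \<^const>\<open>one\<close> of that record carry no information.\<close>

locale left_module = R?: ring R + M?: abelian_group M
  for R :: "('a, 'r) ring_scheme" (structure) and M :: "('a, 'm, 's) module_scheme" (structure) +
  assumes smult_closed:
      "\<lbrakk>a \<in> carrier R; x \<in> carrier M\<rbrakk> \<Longrightarrow> a \<odot>\<^bsub>M\<^esub> x \<in> carrier M"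
    and smult_l_distr:
      "\<lbrakk>a \<in> carrier R; b \<in> carrier R; x \<in> carrier M\<rbrakk> \<Longrightarrow>
        (a \<oplus>\<^bsub>R\<^esub> b) \<odot>\<^bsub>M\<^esub> x = a \<odot>\<^bsub>M\<^esub> x \<oplus>\<^bsub>M\<^esub> b \<odot>\<^bsub>M\<^esub> x"
    and smult_r_distr:
      "\<lbrakk>a \<in> carrier R; x \<in> carrier M; y \<in> carrier M\<rbrakk> \<Longrightarrow>
        a \<odot>\<^bsub>M\<^esub> (x \<oplus>\<^bsub>M\<^esub> y) = a \<odot>\<^bsub>M\<^esub> x \<oplus>\<^bsub>M\<^esub> a \<odot>\<^bsub>M\<^esub> y"
    and smult_assoc1:
      "\<lbrakk>a \<in> carrier R; b \<in> carrier R; x \<in> carrier M\<rbrakk> \<Longrightarrow>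
        (a \<otimes>\<^bsub>R\<^esub> b) \<odot>\<^bsub>M\<^esub> x = a \<odot>\<^bsub>M\<^esub> (b \<odot>\<^bsub>M\<^esub> x)"
    and smult_one: "x \<in> carrier M \<Longrightarrow> \<one>\<^bsub>R\<^esub> \<odot>\<^bsub>M\<^esub> x = x"

locale assoc_algebra = K?: field K + module K A + A?: ring A
  for K :: "('k, 'r) ring_scheme" (structure) and A :: "('k, 'a, 's) module_scheme" (structure) +
  assumes smult_mult_left:
      "\<lbrakk>c \<in> carrier K; x \<in> carrier A; y \<in> carrier A\<rbrakk> \<Longrightarrow>
        (c \<odot>\<^bsub>A\<^esub> x) \<otimes>\<^bsub>A\<^esub> y = c \<odot>\<^bsub>A\<^esub> (x \<otimes>\<^bsub>A\<^esub> y)"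
    and smult_mult_right:
      "\<lbrakk>c \<in> carrier K; x \<in> carrier A; y \<in> carrier A\<rbrakk> \<Longrightarrow>
        x \<otimes>\<^bsub>A\<^esub> (c \<odot>\<^bsub>A\<^esub> y) = c \<odot>\<^bsub>A\<^esub> (x \<otimes>\<^bsub>A\<^esub> y)"

definition finite_dim :: "('k, 'r) ring_scheme \<Rightarrow> ('k, 'v, 's) module_scheme \<Rightarrow> bool" where
  "finite_dim K V \<longleftrightarrow>
    (\<exists>B. finite B \<and> B \<subseteq> carrier V \<and>
      (\<forall>v \<in> carrier V. \<exists>c \<in> B \<rightarrow> carrier K. v = (\<Oplus>\<^bsub>V\<^esub>b\<in>B. c b \<odot>\<^bsub>V\<^esub> b)))"

text \<open>The vector space over the ground field underlying a module over an algebra: a scalar \<open>c\<close>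
  acts as the element \<open>c \<cdot> 1\<close> of the algebra.\<close>

definition underlying_space ::
    "('k, 'a, 's) module_scheme \<Rightarrow> ('a, 'm, 't) module_scheme \<Rightarrow> ('k, 'm) module" where
  "underlying_space A M =
    \<lparr>carrier = carrier M, monoid.mult = monoid.mult M, one = one M,
     ring.zero = ring.zero M, ring.add = ring.add M, smult = (\<lambda>c m. (c \<odot>\<^bsub>A\<^esub> \<one>\<^bsub>A\<^esub>) \<odot>\<^bsub>M\<^esub> m)\<rparr>"

text \<open>A module of dimension \<open>d\<close> is isomorphic to one whose carrier consists of the \<open>d\<close>-tuples over the
  ground field, extended to functions on \<^typ>\<open>nat\<close>.  Existence statements about finite-dimensional
  modules therefore lose nothing by taking carriers inside the type \<^typ>\<open>nat \<Rightarrow> 'k\<close>.\<close>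

definition fd_left_module ::
    "('k, 'r) ring_scheme \<Rightarrow> ('k, 'a, 's) module_scheme \<Rightarrow> ('a, 'm, 't) module_scheme \<Rightarrow> bool" where
  "fd_left_module K A M \<longleftrightarrow> left_module A M \<and> finite_dim K (underlying_space A M)"

text \<open>Two-sided ideals, ordered by inclusion, form a lattice with meet \<open>\<inter>\<close> and join \<open><+>\<close>.\<close>

definition distributive_ideal_lattice :: "('a, 'r) ring_scheme \<Rightarrow> bool" where
  "distributive_ideal_lattice A \<longleftrightarrow>
    (\<forall>I J L. ideal I A \<and> ideal J A \<and> ideal L A \<longrightarrow>
      I \<inter> (J <+>\<^bsub>A\<^esub> L) = (I \<inter> J) <+>\<^bsub>A\<^esub> (I \<inter> L))"


section \<open>Homomorphisms, quotients, indecomposability\<close>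

definition left_module_hom ::
    "('a, 'r) ring_scheme \<Rightarrow> ('a, 'm, 's) module_scheme \<Rightarrow> ('a, 'n, 't) module_scheme \<Rightarrow> ('m \<Rightarrow> 'n) set" where
  "left_module_hom R M N =
    {f \<in> carrier M \<rightarrow> carrier N.
      (\<forall>x \<in> carrier M. \<forall>y \<in> carrier M. f (x \<oplus>\<^bsub>M\<^esub> y) = f x \<oplus>\<^bsub>N\<^esub> f y) \<and>
      (\<forall>a \<in> carrier R. \<forall>x \<in> carrier M. f (a \<odot>\<^bsub>M\<^esub> x) = a \<odot>\<^bsub>N\<^esub> f x)}"

definition invertible_hom ::
    "('a, 'r) ring_scheme \<Rightarrow> ('a, 'm, 's) module_scheme \<Rightarrow> ('a, 'n, 't) module_scheme \<Rightarrow> ('m \<Rightarrow> 'n) \<Rightarrow> bool" where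
  "invertible_hom R M N f \<longleftrightarrow>
    f \<in> left_module_hom R M N \<and>
    (\<exists>g \<in> left_module_hom R N M.
      (\<forall>x \<in> carrier M. g (f x) = x) \<and> (\<forall>y \<in> carrier N. f (g y) = y))"

text \<open>The analogue of \<^const>\<open>FactRing\<close> for modules; \<^const>\<open>monoid.mult\<close> and \<^const>\<open>one\<close> are irrelevant.\<close>

definition quotient_module ::
    "('a, 'm, 's) module_scheme \<Rightarrow> 'm set \<Rightarrow> ('a, 'm set) module" where
  "quotient_module M N =
    \<lparr>carrier = a_rcosets\<^bsub>M\<^esub> N, monoid.mult = undefined, one = undefined,
     ring.zero = N, ring.add = set_add M, smult = (\<lambda>a C. \<Union>m\<in>C. N +>\<^bsub>M\<^esub> (a \<odot>\<^bsub>M\<^esub> m))\<rparr>"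

text \<open>The zero module is not indecomposable.\<close>

definition indecomposable_module ::
    "('a, 'r) ring_scheme \<Rightarrow> ('a, 'm, 's) module_scheme \<Rightarrow> bool" where
  "indecomposable_module R M \<longleftrightarrow>
    carrier M \<noteq> {\<zero>\<^bsub>M\<^esub>} \<and>
    (\<forall>U V. submodule U R M \<and> submodule V R M \<and>
        U <+>\<^bsub>M\<^esub> V = carrier M \<and> U \<inter> V = {\<zero>\<^bsub>M\<^esub>} \<longrightarrow>
      U = {\<zero>\<^bsub>M\<^esub>} \<or> V = {\<zero>\<^bsub>M\<^esub>})"


section \<open>Uniform inclusions and couniform projections\<close>

definition uniform_submodule ::
    "('a, 'r) ring_scheme \<Rightarrow> 'm set \<Rightarrow> ('a, 'm, 's) module_scheme \<Rightarrow> bool" where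
  "uniform_submodule R M' M \<longleftrightarrow>
    submodule M' R M \<and>
    (\<forall>U. submodule U R M \<and> M' \<subseteq> U \<longrightarrow> indecomposable_module R (M\<lparr>carrier := U\<rparr>))"

definition uniform_inclusion ::
    "('a, 'r) ring_scheme \<Rightarrow> ('a, 'm, 's) module_scheme \<Rightarrow> ('a, 'n, 't) module_scheme \<Rightarrow> ('m \<Rightarrow> 'n) \<Rightarrow> bool" where
  "uniform_inclusion R M N f \<longleftrightarrow>
    f \<in> left_module_hom R M N \<and> inj_on f (carrier M) \<and>
    uniform_submodule R (f ` carrier M) N"

definition uniform_module :: "('a, 'r) ring_scheme \<Rightarrow> ('a, 'm, 's) module_scheme \<Rightarrow> bool" where
  "uniform_module R M \<longleftrightarrow>
    carrier M \<noteq> {\<zero>\<^bsub>M\<^esub>} \<and>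
    (\<forall>M'. submodule M' R M \<and> M' \<noteq> {\<zero>\<^bsub>M\<^esub>} \<longrightarrow> uniform_submodule R M' M)"

definition couniform_quotient ::
    "('a, 'r) ring_scheme \<Rightarrow> ('a, 'm, 's) module_scheme \<Rightarrow> 'm set \<Rightarrow> bool" where
  "couniform_quotient R M N \<longleftrightarrow>
    submodule N R M \<and>
    (\<forall>N'. submodule N' R M \<and> N' \<subseteq> N \<longrightarrow> indecomposable_module R (quotient_module M N'))"

definition couniform_projection ::
    "('a, 'r) ring_scheme \<Rightarrow> ('a, 'm, 's) module_scheme \<Rightarrow> ('a, 'n, 't) module_scheme \<Rightarrow> ('m \<Rightarrow> 'n) \<Rightarrow> bool" where
  "couniform_projection R M N f \<longleftrightarrow>
    f \<in> left_module_hom R M N \<and> f ` carrier M = carrier N \<and>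
    couniform_quotient R M (a_kernel M N f)"

end

theory Submission
  imports Defs
begin

text \<open>
  Non-distributivity yields ideals \<open>B\<close>, \<open>C\<close>, \<open>E\<close>, each contained in the sum of the other two, whose
  pairwise intersections are the same ideal \<open>D\<close>; then \<open>b - c \<in> E\<close> identifies \<open>B / D\<close> with \<open>C / D\<close>.  For a
  left ideal \<open>P = \<Lambda>e\<close> that is minimal with \<open>BP \<not>\<subseteq> D\<close>, the module \<open>P\<close> is local, and acting with \<open>B\<close> and
  \<open>C\<close> sends its top into two independent copies of a simple module, so \<open>B\<close> and \<open>C\<close> play the role of
  the two arrows of the Kronecker quiver.  All modules of the accordion are subquotients of powers
  of \<open>P\<close>, with generators \<open>w(a), \<dots>, w(b)\<close> subject to \<open>c w(i) = b w(i+1)\<close> for \<open>b\<close>, \<open>c\<close> that correspond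
  to each other, so that \<open>W\<close>, \<open>R\<close>, \<open>M\<close> restrict to preinjective, regular and preprojective Kronecker
  modules.

  Starting with a uniform module \<open>W(1)\<close> on two generators, \<open>M(2n)\<close> is the submodule of
  \<open>W(2n-1) \<oplus> W(1) \<oplus> W(1)\<close> generated by the \<open>w(i)\<close>, with its first and last generator corrected by a
  generator of \<open>W(1)\<close>; and \<open>W(2n+1)\<close> is a quotient of \<open>M(2n) \<oplus> P \<oplus> P\<close> in which \<open>M(2n)\<close> is essential.
  Hence tops are generated by the \<open>w(i)\<close> and socles by \<open>B\<close> and \<open>C\<close>, and a decomposition of any
  module in between induces one of the underlying Kronecker module, which has to be trivial.
  Projections of a decomposition are idempotent, so Schur's lemma is needed only in the form that
  a simple section cannot meet both summands.
\<close>

section \<open>Submodules\<close>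

text \<open>The obstacle is that the algebra is arbitrary: the radical of P may carry composition
  factors about which nothing is known, so relations between the generators alone do not determine
  the modules. Only the part of the socle that \<open>B\<close> and \<open>C\<close> produce is
  under control. The relation modules of the W are therefore chosen maximal with a prescribed trace
  on a known submodule, which makes that submodule essential in the quotient. R(2n) and M(2n) leave
  no such freedom, since their relations must lie inside those of W(2n-1); the direct sums with
  copies of W(1) are there because they keep the socle known. All modules are written as U/Z inside
  one module of sequences indexed by integers. Every arrow is then induced by an inclusion, and only
  conditions on a lattice of submodules have to be checked. One turn of the accordion lengthens the
  window of generators by one at both ends: two socle coordinates restored at the ends give the
  couniform projections, two new generators give the uniform inclusions, and the longer window again
  has preinjective shape, so the turn can be repeated.\<close>

lemma set_add_mem: "x \<in> I <+>\<^bsub>A\<^esub> J \<longleftrightarrow> (\<exists>i\<in>I. \<exists>j\<in>J. x = i \<oplus>\<^bsub>A\<^esub> j)"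
  by (auto simp: set_add_def')

context left_module
begin

lemma smult_r_zero: "a \<in> carrier R \<Longrightarrow> a \<odot>\<^bsub>M\<^esub> \<zero>\<^bsub>M\<^esub> = \<zero>\<^bsub>M\<^esub>"
  by (metis M.add.r_cancel_one' M.r_zero M.zero_closed smult_closed smult_r_distr)

lemma smult_l_zero: "x \<in> carrier M \<Longrightarrow> \<zero>\<^bsub>R\<^esub> \<odot>\<^bsub>M\<^esub> x = \<zero>\<^bsub>M\<^esub>"
  by (metis M.add.r_cancel_one' R.r_zero R.zero_closed smult_closed smult_l_distr)

lemma smult_r_neg:
  assumes "a \<in> carrier R" "x \<in> carrier M"
  shows "a \<odot>\<^bsub>M\<^esub> (\<ominus>\<^bsub>M\<^esub> x) = \<ominus>\<^bsub>M\<^esub> (a \<odot>\<^bsub>M\<^esub> x)"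
  by (metis M.a_inv_closed M.add.inv_equality M.l_neg assms smult_closed smult_r_distr smult_r_zero)

lemma smult_l_neg:
  assumes "a \<in> carrier R" "x \<in> carrier M"
  shows "(\<ominus>\<^bsub>R\<^esub> a) \<odot>\<^bsub>M\<^esub> x = \<ominus>\<^bsub>M\<^esub> (a \<odot>\<^bsub>M\<^esub> x)"
  by (metis M.add.inv_equality R.a_inv_closed R.l_neg assms smult_closed smult_l_distr smult_l_zero)

text \<open>Every later \<open>algebra\<close> call on module elements rests on these rules. Scalars
  enter those identities only linearly, so no law about products of scalars is listed.\<close>

lemmas left_module_simprules
  [algebra left_module "ring.zero M" "ring.add M" "a_inv M" "a_minus M"] =
  M.a_closed M.zero_closed M.a_inv_closed M.minus_closed smult_closed
  M.a_assoc M.l_zero M.l_neg M.a_comm M.minus_eq M.r_zero M.r_neg M.r_neg2 M.r_neg1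
  M.minus_add M.minus_minus M.add.inv_one M.a_lcomm
  smult_r_distr smult_r_zero smult_r_neg

lemma submodI:
  assumes "N \<subseteq> carrier M" "\<zero>\<^bsub>M\<^esub> \<in> N"
    and "\<And>x y. x \<in> N \<Longrightarrow> y \<in> N \<Longrightarrow> x \<oplus>\<^bsub>M\<^esub> y \<in> N"
    and "\<And>a x. a \<in> carrier R \<Longrightarrow> x \<in> N \<Longrightarrow> a \<odot>\<^bsub>M\<^esub> x \<in> N"
  shows "submodule N R M"
proof (intro submodule.intro subgroup.intro submodule_axioms.intro)
  fix x assume x: "x \<in> N"
  then have "\<ominus>\<^bsub>M\<^esub> x = (\<ominus>\<^bsub>R\<^esub> \<one>\<^bsub>R\<^esub>) \<odot>\<^bsub>M\<^esub> x"
    using assms(1) by (subst smult_l_neg) (auto simp: smult_one)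
  with x assms(4) have "\<ominus>\<^bsub>M\<^esub> x \<in> N" by simp
  then show "inv\<^bsub>add_monoid M\<^esub> x \<in> N" by (simp add: a_inv_def)
qed (use assms in auto)

lemma submodD:
  assumes "submodule N R M"
  shows "N \<subseteq> carrier M" "\<zero>\<^bsub>M\<^esub> \<in> N"
    and "x \<in> N \<Longrightarrow> x \<in> carrier M"
    and "x \<in> N \<Longrightarrow> y \<in> N \<Longrightarrow> x \<oplus>\<^bsub>M\<^esub> y \<in> N"
    and "x \<in> N \<Longrightarrow> \<ominus>\<^bsub>M\<^esub> x \<in> N"
    and "x \<in> N \<Longrightarrow> y \<in> N \<Longrightarrow> x \<ominus>\<^bsub>M\<^esub> y \<in> N"
    and "a \<in> carrier R \<Longrightarrow> x \<in> N \<Longrightarrow> a \<odot>\<^bsub>M\<^esub> x \<in> N"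
proof -
  interpret submodule N R M by fact
  show *: "N \<subseteq> carrier M" "\<zero>\<^bsub>M\<^esub> \<in> N" using subset one_closed by auto
  show "x \<in> N \<Longrightarrow> x \<in> carrier M" using * by auto
  show **: "x \<in> N \<Longrightarrow> y \<in> N \<Longrightarrow> x \<oplus>\<^bsub>M\<^esub> y \<in> N" for x y using m_closed by simp
  show ***: "x \<in> N \<Longrightarrow> \<ominus>\<^bsub>M\<^esub> x \<in> N" for x using m_inv_closed by (simp add: a_inv_def)
  show "x \<in> N \<Longrightarrow> y \<in> N \<Longrightarrow> x \<ominus>\<^bsub>M\<^esub> y \<in> N" using ** *** by (simp add: a_minus_def)
  show "a \<in> carrier R \<Longrightarrow> x \<in> N \<Longrightarrow> a \<odot>\<^bsub>M\<^esub> x \<in> N" by (rule smult_closed)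
qed

lemma submod_cancel_left:
  assumes "submodule N R M" "x \<in> N" "y \<in> carrier M" "x \<oplus>\<^bsub>M\<^esub> y \<in> N"
  shows "y \<in> N"
proof -
  have "y = (x \<oplus>\<^bsub>M\<^esub> y) \<ominus>\<^bsub>M\<^esub> x"
    using submodD(3)[OF assms(1,2)] assms(3) by algebra
  then show ?thesis using submodD(6)[OF assms(1)] assms by metis
qed

lemma submod_diff_cancel:
  assumes "submodule N R M" "y \<in> N" "x \<in> carrier M" "x \<ominus>\<^bsub>M\<^esub> y \<in> N"
  shows "x \<in> N"
proof -
  have "x = (x \<ominus>\<^bsub>M\<^esub> y) \<oplus>\<^bsub>M\<^esub> y"
    using submodD(3)[OF assms(1,2)] assms(3) by algebra
  then show ?thesis using submodD(4)[OF assms(1)] assms by metis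
qed

lemma submod_Int:
  "submodule N R M \<Longrightarrow> submodule N' R M \<Longrightarrow> submodule (N \<inter> N') R M"
  by (rule submodI) (auto dest: submodD)

lemma submod_carrier: "submodule (carrier M) R M"
  by (rule submodI) (auto intro: smult_closed)

lemmas mem_set_add = set_add_mem[where A = M]

lemma set_add_comm:
  assumes "N \<subseteq> carrier M" "N' \<subseteq> carrier M"
  shows "N <+>\<^bsub>M\<^esub> N' = N' <+>\<^bsub>M\<^esub> N"
proof -
  have *: "x \<oplus>\<^bsub>M\<^esub> y = y \<oplus>\<^bsub>M\<^esub> x" if "x \<in> N" "y \<in> N'" for x y
    using that assms by (intro M.a_comm) auto
  show ?thesis unfolding set_eq_iff mem_set_add by (metis *)
qed

lemma set_add_mono: "N \<subseteq> B \<Longrightarrow> N' \<subseteq> B' \<Longrightarrow> N <+>\<^bsub>M\<^esub> N' \<subseteq> B <+>\<^bsub>M\<^esub> B'"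
  unfolding subset_iff mem_set_add by blast

lemma submod_add:
  assumes N: "submodule N R M" and N': "submodule N' R M"
  shows "submodule (N <+>\<^bsub>M\<^esub> N') R M"
proof (rule submodI)
  note D = submodD[OF N] and D' = submodD[OF N']
  show "N <+>\<^bsub>M\<^esub> N' \<subseteq> carrier M"
    using D(1) D'(1) by (force simp: mem_set_add)
  show "\<zero>\<^bsub>M\<^esub> \<in> N <+>\<^bsub>M\<^esub> N'"
    using D(2) D'(2) by (force simp: mem_set_add)
next
  note D = submodD[OF N] and D' = submodD[OF N']
  fix x y assume "x \<in> N <+>\<^bsub>M\<^esub> N'" "y \<in> N <+>\<^bsub>M\<^esub> N'"
  then obtain a b c d where *: "a \<in> N" "b \<in> N'" "c \<in> N" "d \<in> N'" "x = a \<oplus>\<^bsub>M\<^esub> b" "y = c \<oplus>\<^bsub>M\<^esub> d"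
    by (auto simp: mem_set_add)
  then have "x \<oplus>\<^bsub>M\<^esub> y = (a \<oplus>\<^bsub>M\<^esub> c) \<oplus>\<^bsub>M\<^esub> (b \<oplus>\<^bsub>M\<^esub> d)"
    using D(3) D'(3) by (simp add: M.a_ac)
  then show "x \<oplus>\<^bsub>M\<^esub> y \<in> N <+>\<^bsub>M\<^esub> N'"
    using * D(4) D'(4) unfolding mem_set_add by blast
next
  note D = submodD[OF N] and D' = submodD[OF N']
  fix a x assume "a \<in> carrier R" "x \<in> N <+>\<^bsub>M\<^esub> N'"
  then show "a \<odot>\<^bsub>M\<^esub> x \<in> N <+>\<^bsub>M\<^esub> N'"
    using D(3,7) D'(3,7) unfolding mem_set_add by (metis smult_r_distr)
qed

lemma submod_add_upper1:
  assumes "submodule N R M" "submodule N' R M" shows "N \<subseteq> N <+>\<^bsub>M\<^esub> N'"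
proof
  fix x assume "x \<in> N"
  then have "x = x \<oplus>\<^bsub>M\<^esub> \<zero>\<^bsub>M\<^esub>" using submodD[OF assms(1)] by simp
  then show "x \<in> N <+>\<^bsub>M\<^esub> N'" using \<open>x \<in> N\<close> submodD(2)[OF assms(2)] unfolding mem_set_add by blast
qed

lemma submod_add_upper2:
  assumes "submodule N R M" "submodule N' R M" shows "N' \<subseteq> N <+>\<^bsub>M\<^esub> N'"
proof
  fix x assume "x \<in> N'"
  then have "x = \<zero>\<^bsub>M\<^esub> \<oplus>\<^bsub>M\<^esub> x" using submodD[OF assms(2)] by simp
  then show "x \<in> N <+>\<^bsub>M\<^esub> N'" using \<open>x \<in> N'\<close> submodD(2)[OF assms(1)] unfolding mem_set_add by blast
qed

lemma submod_add_least:
  assumes "submodule B R M" "N \<subseteq> B" "N' \<subseteq> B" shows "N <+>\<^bsub>M\<^esub> N' \<subseteq> B"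
  using assms(2,3) submodD(4)[OF assms(1)] unfolding subset_iff mem_set_add by blast

text \<open>This is the substitute for Schur's lemma. The difference of \<open>b'\<close> and
  \<open>a b\<close> lies in \<open>K\<close> and splits as \<open>k1 + k2\<close>; moving terms
  gives \<open>b' - k2 = k1 + a b\<close>, an element of both summands and hence of
  \<open>K\<close>. The real work in each application is \<open>split\<close>: the decomposition has
  to respect \<open>K\<close>.\<close>

lemma simple_section_split:
  assumes V1: "submodule V1 R M" and V2: "submodule V2 R M" and K: "submodule K R M"
    and N: "N \<subseteq> carrier M"
    and sub: "V1 \<inter> V2 \<subseteq> K"
    and split: "\<And>k. k \<in> K \<Longrightarrow> \<exists>k1\<in>V1. \<exists>k2\<in>V2 \<inter> K. k = k1 \<oplus>\<^bsub>M\<^esub> k2"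
    and simple: "\<And>b b'. b \<in> N - K \<Longrightarrow> b' \<in> N \<Longrightarrow> \<exists>a\<in>carrier R. b' \<ominus>\<^bsub>M\<^esub> a \<odot>\<^bsub>M\<^esub> b \<in> K"
  shows "N \<inter> V1 \<subseteq> K \<or> N \<inter> V2 \<subseteq> K"
proof (rule ccontr)
  assume "\<not> ?thesis"
  then obtain b b' where b: "b \<in> N" "b \<in> V1" "b \<notin> K" and b': "b' \<in> N" "b' \<in> V2" "b' \<notin> K"
    by auto
  then obtain a where a: "a \<in> carrier R" "b' \<ominus>\<^bsub>M\<^esub> a \<odot>\<^bsub>M\<^esub> b \<in> K" using simple by blast
  then obtain k1 k2 where k: "k1 \<in> V1" "k2 \<in> V2" "k2 \<in> K" "b' \<ominus>\<^bsub>M\<^esub> a \<odot>\<^bsub>M\<^esub> b = k1 \<oplus>\<^bsub>M\<^esub> k2"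
    using split by blast
  have ab: "a \<odot>\<^bsub>M\<^esub> b \<in> V1" using a b submodD(7)[OF V1] by blast
  have car: "b' \<in> carrier M" "a \<odot>\<^bsub>M\<^esub> b \<in> carrier M" "k1 \<in> carrier M" "k2 \<in> carrier M"
    using b' N ab submodD(3)[OF V1] submodD(3)[OF V2] k by auto
  have "b' \<ominus>\<^bsub>M\<^esub> k2 = (b' \<ominus>\<^bsub>M\<^esub> a \<odot>\<^bsub>M\<^esub> b) \<oplus>\<^bsub>M\<^esub> a \<odot>\<^bsub>M\<^esub> b \<ominus>\<^bsub>M\<^esub> k2" using car by algebra
  also have "\<dots> = k1 \<oplus>\<^bsub>M\<^esub> a \<odot>\<^bsub>M\<^esub> b" unfolding k(4) using car by algebra
  finally have "b' \<ominus>\<^bsub>M\<^esub> k2 = k1 \<oplus>\<^bsub>M\<^esub> a \<odot>\<^bsub>M\<^esub> b" .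
  moreover have "b' \<ominus>\<^bsub>M\<^esub> k2 \<in> V2" using b' k submodD(6)[OF V2] by blast
  moreover have "k1 \<oplus>\<^bsub>M\<^esub> a \<odot>\<^bsub>M\<^esub> b \<in> V1" using k ab submodD(4)[OF V1] by blast
  ultimately have "b' \<ominus>\<^bsub>M\<^esub> k2 \<in> K" using sub by auto
  then have "b' \<in> K" using submod_diff_cancel[OF K k(3)] car by blast
  with b' show False by blast
qed

lemma submod_preimage:
  assumes lm: "left_module R M'" and N': "submodule N' R M'" and U: "submodule U R M"
    and f: "\<And>x. x \<in> U \<Longrightarrow> f x \<in> carrier M'"
    and add: "\<And>x y. x \<in> U \<Longrightarrow> y \<in> U \<Longrightarrow> f (x \<oplus>\<^bsub>M\<^esub> y) = f x \<oplus>\<^bsub>M'\<^esub> f y"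
    and smult: "\<And>a x. a \<in> carrier R \<Longrightarrow> x \<in> U \<Longrightarrow> f (a \<odot>\<^bsub>M\<^esub> x) = a \<odot>\<^bsub>M'\<^esub> f x"
  shows "submodule {x \<in> U. f x \<in> N'} R M"
proof -
  interpret M': left_module R M' by fact
  note D = submodD[OF U] and D' = M'.submodD[OF N']
  have "f \<zero>\<^bsub>M\<^esub> = f (\<zero>\<^bsub>R\<^esub> \<odot>\<^bsub>M\<^esub> \<zero>\<^bsub>M\<^esub>)" by (simp add: smult_r_zero)
  also have "\<dots> = \<zero>\<^bsub>M'\<^esub>" using f D(2) by (simp add: smult M'.smult_l_zero)
  finally have "f \<zero>\<^bsub>M\<^esub> \<in> N'" using D' by simp
  then show ?thesis
    by (intro submodI) (use D D' in \<open>auto simp: add smult\<close>)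
qed

lemma submod_image:
  assumes lm: "left_module R M'" and U: "submodule U R M"
    and f: "\<And>x. x \<in> U \<Longrightarrow> f x \<in> carrier M'"
    and add: "\<And>x y. x \<in> U \<Longrightarrow> y \<in> U \<Longrightarrow> f (x \<oplus>\<^bsub>M\<^esub> y) = f x \<oplus>\<^bsub>M'\<^esub> f y"
    and smult: "\<And>a x. a \<in> carrier R \<Longrightarrow> x \<in> U \<Longrightarrow> f (a \<odot>\<^bsub>M\<^esub> x) = a \<odot>\<^bsub>M'\<^esub> f x"
  shows "submodule (f ` U) R M'"
proof -
  interpret M': left_module R M' by fact
  note D = submodD[OF U]
  have "f \<zero>\<^bsub>M\<^esub> = f (\<zero>\<^bsub>R\<^esub> \<odot>\<^bsub>M\<^esub> \<zero>\<^bsub>M\<^esub>)" by (simp add: smult_r_zero)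
  also have "\<dots> = \<zero>\<^bsub>M'\<^esub>" using f D(2) by (simp add: smult M'.smult_l_zero)
  finally have "\<zero>\<^bsub>M'\<^esub> \<in> f ` U" using D(2) by force
  then show ?thesis
    by (intro M'.submodI) (use D f in \<open>auto simp flip: add smult\<close>)
qed

end

subsection \<open>Covers\<close>

text \<open>The section \<open>N / Y\<close> is simple, expressed without forming the
  quotient.\<close>

definition covers :: "('a, 'r) ring_scheme \<Rightarrow> ('a, 'm, 's) module_scheme \<Rightarrow> 'm set \<Rightarrow> 'm set \<Rightarrow> bool" where
  "covers R M N Y \<longleftrightarrow> submodule N R M \<and> submodule Y R M \<and> Y \<subset> N \<and>
    (\<forall>B. submodule B R M \<and> Y \<subseteq> B \<and> B \<subseteq> N \<longrightarrow> B = Y \<or> B = N)"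

text \<open>The map induced by \<open>f\<close> from the simple section \<open>N / Y\<close> onto
  \<open>(f N + Y') / Y'\<close> is zero or injective. The proof pulls an intermediate submodule
  \<open>B\<close> back to \<open>N\<close>, where only the two extreme cases remain.\<close>

lemma (in left_module) covers_image:
  assumes cov: "covers R M N Y" and Y': "submodule Y' R M"
    and f: "\<And>x. x \<in> N \<Longrightarrow> f x \<in> carrier M"
    and add: "\<And>x y. x \<in> N \<Longrightarrow> y \<in> N \<Longrightarrow> f (x \<oplus>\<^bsub>M\<^esub> y) = f x \<oplus>\<^bsub>M\<^esub> f y"
    and smult: "\<And>a x. a \<in> carrier R \<Longrightarrow> x \<in> N \<Longrightarrow> f (a \<odot>\<^bsub>M\<^esub> x) = a \<odot>\<^bsub>M\<^esub> f x"
    and fY: "f ` Y \<subseteq> Y'"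
  shows "f ` N <+>\<^bsub>M\<^esub> Y' = Y' \<or> covers R M (f ` N <+>\<^bsub>M\<^esub> Y') Y'"
proof -
  have N: "submodule N R M" and Y: "submodule Y R M"
    and max: "\<And>B. submodule B R M \<Longrightarrow> Y \<subseteq> B \<Longrightarrow> B \<subseteq> N \<Longrightarrow> B = Y \<or> B = N"
    using cov by (auto simp: covers_def)
  have lm: "left_module R M" ..
  have fN: "submodule (f ` N) R M" by (rule submod_image[OF lm N]) (use f add smult in auto)
  note S = submod_add[OF fN Y']
  have up: "Y' \<subseteq> f ` N <+>\<^bsub>M\<^esub> Y'" by (rule submod_add_upper2[OF fN Y'])
  have "B = Y' \<or> B = f ` N <+>\<^bsub>M\<^esub> Y'" if B: "submodule B R M" "Y' \<subseteq> B" "B \<subseteq> f ` N <+>\<^bsub>M\<^esub> Y'" for B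
  proof -
    let ?C = "{x \<in> N. f x \<in> B}"
    have "submodule ?C R M" by (rule submod_preimage[OF lm B(1) N]) (use f add smult in auto)
    moreover have "Y \<subseteq> ?C" using cov fY B(2) by (auto simp: covers_def)
    ultimately consider "?C = Y" | "?C = N" using max by blast
    then show ?thesis
    proof cases
      case 1
      have "B \<subseteq> Y'"
      proof
        fix b assume b: "b \<in> B"
        then obtain n y where ny: "n \<in> N" "y \<in> Y'" "b = f n \<oplus>\<^bsub>M\<^esub> y"
          using B(3) unfolding subset_iff mem_set_add by blast
        then have "f n \<in> B"
          using submod_cancel_left[OF B(1), of y "f n"] b B(2) f submodD(3)[OF Y'] by (auto simp: M.a_comm)
        then have "f n \<in> Y'" using 1 ny fY by auto
        then show "b \<in> Y'" using ny submodD(4)[OF Y'] by auto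
      qed
      with B show ?thesis by auto
    next
      case 2
      then have "f ` N \<subseteq> B" by auto
      then have "f ` N <+>\<^bsub>M\<^esub> Y' \<subseteq> B" by (rule submod_add_least[OF B(1) _ B(2)])
      with B show ?thesis by auto
    qed
  qed
  then show ?thesis unfolding covers_def using S Y' up by auto
qed

text \<open>By simplicity, \<open>(N \<inter> H) + Y\<close> is all of \<open>N\<close> once it is
  larger than \<open>Y\<close>. So a single element of \<open>H\<close> places the whole simple
  section in the image of \<open>H\<close>.\<close>

lemma (in left_module) cover_meets:
  assumes cov: "covers R M N Y" and H: "submodule H R M" and h: "h \<in> N" "h \<in> H" "h \<notin> Y"
  shows "N \<subseteq> H <+>\<^bsub>M\<^esub> Y"
proof -
  have N: "submodule N R M" and Y: "submodule Y R M" and YN: "Y \<subseteq> N"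
    and max: "\<And>B. submodule B R M \<Longrightarrow> Y \<subseteq> B \<Longrightarrow> B \<subseteq> N \<Longrightarrow> B = Y \<or> B = N"
    using cov by (auto simp: covers_def)
  let ?B = "(N \<inter> H) <+>\<^bsub>M\<^esub> Y"
  have NH: "submodule (N \<inter> H) R M" by (rule submod_Int[OF N H])
  have up: "N \<inter> H \<subseteq> ?B" "Y \<subseteq> ?B"
    by (rule submod_add_upper1[OF NH Y], rule submod_add_upper2[OF NH Y])
  have "?B \<subseteq> N" by (rule submod_add_least[OF N _ YN]) auto
  then have "?B = Y \<or> ?B = N" by (rule max[OF submod_add[OF NH Y] up(2)])
  moreover have "?B \<noteq> Y" using up(1) h by blast
  ultimately have "N = ?B" by simp
  also have "\<dots> \<subseteq> H <+>\<^bsub>M\<^esub> Y" by (rule set_add_mono) auto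
  finally show ?thesis .
qed

subsection \<open>Bounded length\<close>

text \<open>Finite length, in the form of a bounded and strictly monotone rank on the submodules of
  \<open>U\<close>. Both chain conditions can be read off directly.\<close>

definition bounded_length :: "('a, 'r) ring_scheme \<Rightarrow> ('a, 'm, 's) module_scheme \<Rightarrow> 'm set \<Rightarrow> bool" where
  "bounded_length R M U \<longleftrightarrow> (\<exists>(\<mu> :: 'm set \<Rightarrow> nat) b. \<forall>N N'. submodule N R M \<and> submodule N' R M \<and>
     N \<subset> N' \<and> N' \<subseteq> U \<longrightarrow> \<mu> N < \<mu> N' \<and> \<mu> N' \<le> b)"

lemma bounded_length_mono: "bounded_length R M U \<Longrightarrow> U' \<subseteq> U \<Longrightarrow> bounded_length R M U'"
  unfolding bounded_length_def by (meson subset_trans)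

lemma bounded_length_maximal:
  assumes "bounded_length R M U" "Q N0" and Q: "\<And>N. Q N \<Longrightarrow> submodule N R M \<and> N \<subseteq> U"
  obtains N where "Q N" "\<And>N'. Q N' \<Longrightarrow> N \<subseteq> N' \<Longrightarrow> N' = N"
proof -
  obtain \<mu> :: "_ \<Rightarrow> nat" and b where mu: "\<And>N N'. submodule N R M \<Longrightarrow> submodule N' R M \<Longrightarrow>
     N \<subset> N' \<Longrightarrow> N' \<subseteq> U \<Longrightarrow> \<mu> N < \<mu> N' \<and> \<mu> N' \<le> b"
    using assms(1) unfolding bounded_length_def by metis
  have "\<exists>N. Q N \<and> (\<forall>N'. Q N' \<longrightarrow> N \<subseteq> N' \<longrightarrow> N' = N)" if "Q N" for N
    using that
  proof (induction "b - \<mu> N" arbitrary: N rule: less_induct)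
    case less
    show ?case
    proof (cases "\<exists>N'. Q N' \<and> N \<subset> N'")
      case True
      then obtain N' where N': "Q N'" "N \<subset> N'" by blast
      then have "\<mu> N < \<mu> N'" "\<mu> N' \<le> b" using mu Q less.prems by blast+
      then have "b - \<mu> N' < b - \<mu> N" by linarith
      then show ?thesis using less.hyps N'(1) by blast
    next
      case False
      then show ?thesis using less.prems by blast
    qed
  qed
  then show ?thesis using assms(2) that by blast
qed

lemma bounded_length_minimal:
  assumes "bounded_length R M U" "Q N0" and Q: "\<And>N. Q N \<Longrightarrow> submodule N R M \<and> N \<subseteq> U"
  obtains N where "Q N" "\<And>N'. Q N' \<Longrightarrow> N' \<subseteq> N \<Longrightarrow> N' = N"
proof -
  obtain \<mu> :: "_ \<Rightarrow> nat" and b where mu: "\<And>N N'. submodule N R M \<Longrightarrow> submodule N' R M \<Longrightarrow>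
     N \<subset> N' \<Longrightarrow> N' \<subseteq> U \<Longrightarrow> \<mu> N < \<mu> N' \<and> \<mu> N' \<le> b"
    using assms(1) unfolding bounded_length_def by metis
  have "\<exists>N. Q N \<and> (\<forall>N'. Q N' \<longrightarrow> N' \<subseteq> N \<longrightarrow> N' = N)" if "Q N" for N
    using that
  proof (induction "\<mu> N" arbitrary: N rule: less_induct)
    case less
    show ?case
    proof (cases "\<exists>N'. Q N' \<and> N' \<subset> N")
      case True
      then obtain N' where N': "Q N'" "N' \<subset> N" by blast
      then have "\<mu> N' < \<mu> N" using mu Q less.prems by blast
      then show ?thesis using less.hyps N'(1) by blast
    next
      case False
      then show ?thesis using less.prems by blast
    qed
  qed
  then show ?thesis using assms(2) that by blast
qed

text \<open>A nonzero section has a nonzero socle: take a minimal submodule of \<open>N\<close>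
  strictly above \<open>Y\<close>.\<close>

lemma bounded_length_cover:
  assumes "bounded_length R M U" "submodule N R M" "submodule Y R M" "Y \<subset> N" "N \<subseteq> U"
  obtains N0 where "covers R M N0 Y" "N0 \<subseteq> N"
proof -
  let ?Q = "\<lambda>N'. submodule N' R M \<and> Y \<subset> N' \<and> N' \<subseteq> N"
  have "?Q N" using assms by auto
  moreover have "\<And>N'. ?Q N' \<Longrightarrow> submodule N' R M \<and> N' \<subseteq> U" using assms(5) by auto
  ultimately obtain N0 where N0: "?Q N0" and min: "\<And>N'. ?Q N' \<Longrightarrow> N' \<subseteq> N0 \<Longrightarrow> N' = N0"
    using bounded_length_minimal[OF assms(1), of ?Q N] by blast
  have "B = Y \<or> B = N0" if B: "submodule B R M" "Y \<subseteq> B" "B \<subseteq> N0" for B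
  proof (cases "B = Y")
    case False
    then have "?Q B" using B N0 by auto
    then show ?thesis using min B(3) by blast
  qed simp
  then have "covers R M N0 Y"
    unfolding covers_def using N0 assms(3) by blast
  with N0 show ?thesis using that by blast
qed

text \<open>The measure of \<open>N\<close> counts the jumps of the filtration \<open>N \<inter> S k\<close>.\<close>

lemma (in left_module) bounded_length_filtration:
  fixes S :: "nat \<Rightarrow> 'm set"
  assumes S0: "S 0 = {\<zero>\<^bsub>M\<^esub>}" and mono: "\<And>k. S k \<subseteq> S (Suc k)"
    and step: "\<And>k u v. u \<in> S (Suc k) - S k \<Longrightarrow> v \<in> S (Suc k) \<Longrightarrow>
      \<exists>a\<in>carrier R. v \<ominus>\<^bsub>M\<^esub> a \<odot>\<^bsub>M\<^esub> u \<in> S k"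
  shows "bounded_length R M (S m)"
proof -
  define J where "J N = {k. k < m \<and> N \<inter> (S (Suc k) - S k) \<noteq> {}}" for N
  have fin: "finite (J N)" for N unfolding J_def by auto
  \<comment> \<open>If \<open>N\<close> jumps wherever \<open>N'\<close> does, then \<open>N\<close>
    already contains \<open>N'\<close>: a suitable multiple of a jump element \<open>u\<close> of
    \<open>N\<close> pushes an element of \<open>N'\<close> down from \<open>S (Suc k)\<close> to
    \<open>S k\<close>.\<close>
  have key: "N' \<inter> S k \<subseteq> N" if N: "submodule N R M" "submodule N' R M" "N \<subseteq> N'" "J N' \<subseteq> J N" "k \<le> m"
    for N N' k using \<open>k \<le> m\<close>
  proof (induction k)
    case 0
    then show ?case using S0 submodD(2)[OF N(1)] by auto
  next
    case (Suc k)
    show ?case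
    proof
      fix v assume v: "v \<in> N' \<inter> S (Suc k)"
      show "v \<in> N"
      proof (cases "v \<in> S k")
        case True
        with v Suc show ?thesis by auto
      next
        case False
        then have "k \<in> J N'" using v Suc.prems by (auto simp: J_def)
        then obtain u where u: "u \<in> N" "u \<in> S (Suc k)" "u \<notin> S k" using N(4) by (auto simp: J_def)
        then obtain a where a: "a \<in> carrier R" "v \<ominus>\<^bsub>M\<^esub> a \<odot>\<^bsub>M\<^esub> u \<in> S k" using step v by blast
        have au: "a \<odot>\<^bsub>M\<^esub> u \<in> N" using submodD(7)[OF N(1)] a u by blast
        have "v \<ominus>\<^bsub>M\<^esub> a \<odot>\<^bsub>M\<^esub> u \<in> N'" using submodD(6)[OF N(2)] au N(3) v by blast
        then have "v \<ominus>\<^bsub>M\<^esub> a \<odot>\<^bsub>M\<^esub> u \<in> N" using Suc a by auto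
        then show ?thesis using submod_diff_cancel[OF N(1) au] v submodD(3)[OF N(2)] by blast
      qed
    qed
  qed
  have "card (J N) < card (J N') \<and> card (J N') \<le> m"
    if N: "submodule N R M" "submodule N' R M" "N \<subset> N'" "N' \<subseteq> S m" for N N'
  proof
    have "J N \<subseteq> J N'" using N(3) by (auto simp: J_def)
    moreover have "\<not> J N' \<subseteq> J N" using key[OF N(1,2), of m] N(3,4) by auto
    ultimately show "card (J N) < card (J N')" by (intro psubset_card_mono fin) auto
    have "J N' \<subseteq> {..<m}" by (auto simp: J_def)
    then show "card (J N') \<le> m" by (metis card_lessThan card_mono finite_lessThan)
  qed
  then show ?thesis unfolding bounded_length_def by (intro exI[of _ "\<lambda>N. card (J N)"] exI[of _ m]) blast
qed

section \<open>Subquotients\<close>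

text \<open>Indecomposability of \<open>V / Y\<close>, stated in the lattice of submodules. The
  equation \<open>V1 \<inter> V2 = Y\<close> already forces both summands to contain
  \<open>Y\<close>.\<close>

definition indecomposable_section ::
    "('a, 'r) ring_scheme \<Rightarrow> ('a, 'm, 's) module_scheme \<Rightarrow> 'm set \<Rightarrow> 'm set \<Rightarrow> bool" where
  "indecomposable_section R M V Y \<longleftrightarrow> V \<noteq> Y \<and>
    (\<forall>V1 V2. submodule V1 R M \<and> submodule V2 R M \<and> V1 <+>\<^bsub>M\<^esub> V2 = V \<and> V1 \<inter> V2 = Y \<longrightarrow>
      V1 = Y \<or> V2 = Y)"

text \<open>\<open>h\<close> exhibits \<open>N\<close> as \<open>U / Y\<close>. No module law is
  assumed for \<open>N\<close>; all of them are transported along \<open>h\<close>, so a record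
  built by hand only has to admit such an \<open>h\<close>.\<close>

locale presentation = left_module R M
  for R :: "('a, 'r) ring_scheme" (structure) and M :: "('a, 'm, 's) module_scheme" (structure) +
  fixes U Y :: "'m set" and N :: "('a, 'n, 't) module_scheme" and h :: "'m \<Rightarrow> 'n"
  assumes U: "submodule U R M" and Y: "submodule Y R M" and YU: "Y \<subseteq> U"
    and image: "h ` U = carrier N"
    and h_zero: "h \<zero>\<^bsub>M\<^esub> = \<zero>\<^bsub>N\<^esub>"
    and h_add: "\<lbrakk>x \<in> U; y \<in> U\<rbrakk> \<Longrightarrow> h (x \<oplus>\<^bsub>M\<^esub> y) = h x \<oplus>\<^bsub>N\<^esub> h y"
    and h_smult: "\<lbrakk>a \<in> carrier R; x \<in> U\<rbrakk> \<Longrightarrow> h (a \<odot>\<^bsub>M\<^esub> x) = a \<odot>\<^bsub>N\<^esub> h x"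
    and kernel: "x \<in> U \<Longrightarrow> h x = \<zero>\<^bsub>N\<^esub> \<longleftrightarrow> x \<in> Y"
begin

lemma h_closed: "x \<in> U \<Longrightarrow> h x \<in> carrier N"
  using image by auto

lemma h_surj: assumes "n \<in> carrier N" obtains x where "x \<in> U" "n = h x"
  using assms unfolding image[symmetric] by auto

lemma left_module_N: "left_module R N"
proof (intro left_module.intro left_module_axioms.intro abelian_groupI)
  note D = submodD[OF U]
  show "ring R" ..
  show "\<zero>\<^bsub>N\<^esub> \<in> carrier N" using h_closed[OF D(2)] by (simp add: h_zero)
  fix n n' n'' assume n: "n \<in> carrier N" "n' \<in> carrier N"
  obtain x where x: "x \<in> U" "n = h x" using h_surj n by blast
  obtain x' where x': "x' \<in> U" "n' = h x'" using h_surj n by blast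
  have c: "x \<in> carrier M" "x' \<in> carrier M" using x x' D by auto
  show "n \<oplus>\<^bsub>N\<^esub> n' \<in> carrier N"
    using h_closed[OF D(4)[of x x']] x x' by (simp add: h_add)
  show "n \<oplus>\<^bsub>N\<^esub> n' = n' \<oplus>\<^bsub>N\<^esub> n"
    using h_add[of x x'] h_add[of x' x] x x' c by (simp add: M.a_comm)
  {
    assume "n'' \<in> carrier N"
    then obtain x'' where x'': "x'' \<in> U" "n'' = h x''" using h_surj by blast
    then show "n \<oplus>\<^bsub>N\<^esub> n' \<oplus>\<^bsub>N\<^esub> n'' = n \<oplus>\<^bsub>N\<^esub> (n' \<oplus>\<^bsub>N\<^esub> n'')"
      using x x' c D by (simp flip: h_add add: M.a_assoc)
  }
next
  note D = submodD[OF U]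
  fix n assume "n \<in> carrier N"
  then obtain x where x: "x \<in> U" "n = h x" using h_surj by blast
  then show "\<zero>\<^bsub>N\<^esub> \<oplus>\<^bsub>N\<^esub> n = n" using D by (simp flip: h_add h_zero)
  have "h (\<ominus>\<^bsub>M\<^esub> x) \<oplus>\<^bsub>N\<^esub> n = \<zero>\<^bsub>N\<^esub>"
    using x D by (simp flip: h_add h_zero add: M.l_neg)
  then show "\<exists>y\<in>carrier N. y \<oplus>\<^bsub>N\<^esub> n = \<zero>\<^bsub>N\<^esub>" using h_closed[OF D(5)[OF x(1)]] by blast
  show "\<one> \<odot>\<^bsub>N\<^esub> n = n" using x D by (simp flip: h_smult add: smult_one)
  fix a assume a: "a \<in> carrier R"
  show "a \<odot>\<^bsub>N\<^esub> n \<in> carrier N"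
    using a x D h_closed by (simp flip: h_smult)
  {
    fix b assume b: "b \<in> carrier R"
    show "(a \<oplus> b) \<odot>\<^bsub>N\<^esub> n = a \<odot>\<^bsub>N\<^esub> n \<oplus>\<^bsub>N\<^esub> b \<odot>\<^bsub>N\<^esub> n"
      using a b x D by (simp flip: h_smult h_add add: smult_l_distr)
    show "a \<otimes> b \<odot>\<^bsub>N\<^esub> n = a \<odot>\<^bsub>N\<^esub> (b \<odot>\<^bsub>N\<^esub> n)"
      using a b x D by (simp flip: h_smult add: smult_assoc1)
  }
  {
    fix n' assume "n' \<in> carrier N"
    then obtain x' where x': "x' \<in> U" "n' = h x'" using h_surj by blast
    show "a \<odot>\<^bsub>N\<^esub> (n \<oplus>\<^bsub>N\<^esub> n') = a \<odot>\<^bsub>N\<^esub> n \<oplus>\<^bsub>N\<^esub> a \<odot>\<^bsub>N\<^esub> n'"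
      using a x x' D by (simp flip: h_smult h_add add: smult_r_distr)
  }
qed

sublocale N: left_module R N by (rule left_module_N)

lemma h_eq_iff:
  assumes "x \<in> U" "y \<in> U" shows "h x = h y \<longleftrightarrow> x \<ominus>\<^bsub>M\<^esub> y \<in> Y"
proof -
  note D = submodD[OF U]
  have e: "x = (x \<ominus>\<^bsub>M\<^esub> y) \<oplus>\<^bsub>M\<^esub> y" using D(3) assms by algebra
  have "h x = h (x \<ominus>\<^bsub>M\<^esub> y) \<oplus>\<^bsub>N\<^esub> h y"
    using arg_cong[OF e, of h] h_add[of "x \<ominus>\<^bsub>M\<^esub> y" y] assms D by simp
  then have "h x = h y \<longleftrightarrow> h (x \<ominus>\<^bsub>M\<^esub> y) = \<zero>\<^bsub>N\<^esub>"
    using assms D(6) h_closed by (metis N.M.add.r_cancel_one' N.M.l_zero)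
  then show ?thesis using kernel D(6) assms by blast
qed

lemma preimage_submodule:
  "submodule C R N \<Longrightarrow> submodule {x \<in> U. h x \<in> C} R M"
  by (rule submod_preimage[OF left_module_N _ U]) (auto simp: h_closed h_add h_smult)

lemma preimage_lower: "submodule C R N \<Longrightarrow> Y \<subseteq> {x \<in> U. h x \<in> C}"
  using YU kernel N.submodD(2) by fastforce

lemma image_submodule:
  assumes "submodule V R M" "V \<subseteq> U" shows "submodule (h ` V) R N"
  by (rule submod_image[OF left_module_N assms(1)]) (use assms in \<open>auto simp: h_closed h_add h_smult subsetD\<close>)

lemma image_preimage: "submodule C R N \<Longrightarrow> h ` {x \<in> U. h x \<in> C} = C"
  using N.submodD(1) h_surj by blast

text \<open>Preimages under \<open>h\<close> turn a direct sum decomposition of \<open>N\<close>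
  into a pair with sum \<open>U\<close> and intersection \<open>Y\<close>, and images under
  \<open>h\<close> lead back.\<close>

lemma indecomposable_module_of_section:
  assumes "indecomposable_section R M U Y"
  shows "indecomposable_module R N"
  unfolding indecomposable_module_def
proof (intro conjI allI impI)
  show "carrier N \<noteq> {\<zero>\<^bsub>N\<^esub>}"
  proof
    assume "carrier N = {\<zero>\<^bsub>N\<^esub>}"
    then have "U \<subseteq> Y" using h_closed kernel by auto
    then show False using assms YU by (auto simp: indecomposable_section_def)
  qed
  fix C1 C2 assume C: "submodule C1 R N \<and> submodule C2 R N \<and> C1 <+>\<^bsub>N\<^esub> C2 = carrier N \<and> C1 \<inter> C2 = {\<zero>\<^bsub>N\<^esub>}"
  let ?V1 = "{x \<in> U. h x \<in> C1}" and ?V2 = "{x \<in> U. h x \<in> C2}"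
  have V: "submodule ?V1 R M" "submodule ?V2 R M" using C preimage_submodule by auto
  have "?V1 \<inter> ?V2 = Y"
  proof -
    have "?V1 \<inter> ?V2 = {x \<in> U. h x \<in> C1 \<inter> C2}" by blast
    also have "\<dots> = {x \<in> U. h x = \<zero>\<^bsub>N\<^esub>}" using C by blast
    also have "\<dots> = Y" using kernel YU by blast
    finally show ?thesis .
  qed
  moreover have "?V1 <+>\<^bsub>M\<^esub> ?V2 = U"
  proof
    show "?V1 <+>\<^bsub>M\<^esub> ?V2 \<subseteq> U" by (rule submod_add_least[OF U]) auto
    show "U \<subseteq> ?V1 <+>\<^bsub>M\<^esub> ?V2"
    proof
      fix x assume x: "x \<in> U"
      then have "h x \<in> C1 <+>\<^bsub>N\<^esub> C2" using C h_closed by auto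
      then obtain c1 c2 where c: "c1 \<in> C1" "c2 \<in> C2" "h x = c1 \<oplus>\<^bsub>N\<^esub> c2"
        unfolding N.mem_set_add by blast
      obtain x1 where x1: "x1 \<in> U" "c1 = h x1" using h_surj c C N.submodD(3) by metis
      have xm: "x \<in> carrier M" "x1 \<in> carrier M" using x x1 submodD(3)[OF U] by auto
      have d: "x = x1 \<oplus>\<^bsub>M\<^esub> (x \<ominus>\<^bsub>M\<^esub> x1)" using xm by algebra
      have dU: "x \<ominus>\<^bsub>M\<^esub> x1 \<in> U" using x x1 submodD(6)[OF U] by blast
      have "h x = c1 \<oplus>\<^bsub>N\<^esub> h (x \<ominus>\<^bsub>M\<^esub> x1)"
        using arg_cong[OF d, of h] h_add[OF x1(1) dU] x1 by simp
      then have "h (x \<ominus>\<^bsub>M\<^esub> x1) = c2"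
        using c x1 dU C N.submodD(3)[of C2] h_closed by (metis N.M.add.l_cancel)
      then show "x \<in> ?V1 <+>\<^bsub>M\<^esub> ?V2"
        using d dU x1 c unfolding mem_set_add by blast
    qed
  qed
  ultimately have "?V1 = Y \<or> ?V2 = Y"
    using assms V unfolding indecomposable_section_def by blast
  then have "h ` ?V1 = h ` Y \<or> h ` ?V2 = h ` Y" by metis
  moreover have "h ` Y = {\<zero>\<^bsub>N\<^esub>}"
  proof
    show "h ` Y \<subseteq> {\<zero>\<^bsub>N\<^esub>}" using kernel YU by auto
    show "{\<zero>\<^bsub>N\<^esub>} \<subseteq> h ` Y" using h_zero[symmetric] submodD(2)[OF Y] by auto
  qed
  moreover have "h ` ?V1 = C1" "h ` ?V2 = C2" using image_preimage C by auto
  ultimately show "C1 = {\<zero>\<^bsub>N\<^esub>} \<or> C2 = {\<zero>\<^bsub>N\<^esub>}" by simp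
qed

lemma restrict:
  assumes "submodule V R M" "Y \<subseteq> V" "V \<subseteq> U"
  shows "presentation R M V Y (N\<lparr>carrier := h ` V\<rparr>) h"
proof (rule presentation.intro[OF left_module_axioms presentation_axioms.intro])
  show "submodule V R M" "submodule Y R M" "Y \<subseteq> V" using assms Y by simp_all
  show "h ` V = carrier (N\<lparr>carrier := h ` V\<rparr>)" "h \<zero>\<^bsub>M\<^esub> = \<zero>\<^bsub>N\<lparr>carrier := h ` V\<rparr>\<^esub>"
    by (simp_all add: h_zero)
next
  fix x y assume "x \<in> V" "y \<in> V"
  then show "h (x \<oplus>\<^bsub>M\<^esub> y) = h x \<oplus>\<^bsub>N\<lparr>carrier := h ` V\<rparr>\<^esub> h y"
    using h_add[of x y] assms(3) by auto
next
  fix a x assume "a \<in> carrier R" "x \<in> V"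
  then show "h (a \<odot>\<^bsub>M\<^esub> x) = a \<odot>\<^bsub>N\<lparr>carrier := h ` V\<rparr>\<^esub> h x"
    using h_smult[of a x] assms(3) by auto
next
  fix x assume "x \<in> V"
  then show "(h x = \<zero>\<^bsub>N\<lparr>carrier := h ` V\<rparr>\<^esub>) = (x \<in> Y)"
    using kernel[of x] assms(3) by auto
qed

lemma indecomposable_submodule:
  assumes "submodule V R M" "Y \<subseteq> V" "V \<subseteq> U" "indecomposable_section R M V Y"
  shows "indecomposable_module R (N\<lparr>carrier := h ` V\<rparr>)"
  by (rule presentation.indecomposable_module_of_section[OF restrict[OF assms(1-3)] assms(4)])

text \<open>Third isomorphism theorem: \<open>N / C\<close> is \<open>U\<close> modulo the preimage
  of \<open>C\<close>. Through it couniformity is tested on sections of the ambient module.\<close>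

lemma quotient:
  assumes C: "submodule C R N"
  shows "presentation R M U {x \<in> U. h x \<in> C} (quotient_module N C) (\<lambda>x. C +>\<^bsub>N\<^esub> h x)"
proof -
  have sub: "additive_subgroup C N"
    using submodule.axioms(1)[OF C] by (simp add: additive_subgroup_def)
  interpret S: abelian_subgroup C N
    by (rule abelian_subgroupI3[OF sub N.M.abelian_group_axioms])
  have self: "C +>\<^bsub>N\<^esub> n = C \<longleftrightarrow> n \<in> C" if "n \<in> carrier N" for n
    using that S.a_rcos_self S.a_rcos_const by metis
  \<comment> \<open>The union in the scalar action of \<open>quotient_module\<close> runs over equal
    cosets, because \<open>a\<close> maps \<open>C\<close> into itself.\<close>
  have sm: "(\<Union>m\<in>C +>\<^bsub>N\<^esub> n. C +>\<^bsub>N\<^esub> (a \<odot>\<^bsub>N\<^esub> m)) = C +>\<^bsub>N\<^esub> (a \<odot>\<^bsub>N\<^esub> n)"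
    if a: "a \<in> carrier R" and n: "n \<in> carrier N" for a n
  proof -
    have "C +>\<^bsub>N\<^esub> (a \<odot>\<^bsub>N\<^esub> m) = C +>\<^bsub>N\<^esub> (a \<odot>\<^bsub>N\<^esub> n)" if m: "m \<in> C +>\<^bsub>N\<^esub> n" for m
    proof -
      obtain c where c: "c \<in> C" "m = c \<oplus>\<^bsub>N\<^esub> n" using m by (auto simp: a_r_coset_def')
      have cN: "c \<in> carrier N" using c N.submodD(3)[OF C] by blast
      have e: "a \<odot>\<^bsub>N\<^esub> m = a \<odot>\<^bsub>N\<^esub> c \<oplus>\<^bsub>N\<^esub> a \<odot>\<^bsub>N\<^esub> n"
        using c cN a n by (simp add: N.smult_r_distr)
      have "a \<odot>\<^bsub>N\<^esub> c \<in> C" using c a N.submodD(7)[OF C] by blast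
      then have "a \<odot>\<^bsub>N\<^esub> m \<in> C +>\<^bsub>N\<^esub> (a \<odot>\<^bsub>N\<^esub> n)" unfolding e by (auto simp: a_r_coset_def')
      then show ?thesis
        using N.M.a_repr_independence[OF _ _ S.a_subgroup] a n N.smult_closed by metis
    qed
    moreover have "n \<in> C +>\<^bsub>N\<^esub> n" using n S.a_rcos_self by blast
    ultimately show ?thesis by blast
  qed
  show ?thesis
  proof (rule presentation.intro[OF left_module_axioms presentation_axioms.intro])
    show "submodule U R M" by (rule U)
    show "submodule {x \<in> U. h x \<in> C} R M" by (rule preimage_submodule[OF C])
    show "(\<lambda>x. C +>\<^bsub>N\<^esub> h x) ` U = carrier (quotient_module N C)"
      unfolding quotient_module_def A_RCOSETS_def' using image[symmetric] by auto
    show "C +>\<^bsub>N\<^esub> h \<zero>\<^bsub>M\<^esub> = \<zero>\<^bsub>quotient_module N C\<^esub>"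
      using self[of "\<zero>\<^bsub>N\<^esub>"] N.submodD(2)[OF C] by (simp add: h_zero quotient_module_def)
  next
    fix x y assume "x \<in> U" "y \<in> U"
    then show "C +>\<^bsub>N\<^esub> h (x \<oplus>\<^bsub>M\<^esub> y) = (C +>\<^bsub>N\<^esub> h x) \<oplus>\<^bsub>quotient_module N C\<^esub> (C +>\<^bsub>N\<^esub> h y)"
      using S.a_rcos_sum h_closed by (simp add: h_add quotient_module_def)
  next
    fix a x assume "a \<in> carrier R" "x \<in> U"
    then show "C +>\<^bsub>N\<^esub> h (a \<odot>\<^bsub>M\<^esub> x) = a \<odot>\<^bsub>quotient_module N C\<^esub> (C +>\<^bsub>N\<^esub> h x)"
      using sm h_closed by (simp add: h_smult quotient_module_def)
  next
    fix x assume "x \<in> U"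
    then show "(C +>\<^bsub>N\<^esub> h x = \<zero>\<^bsub>quotient_module N C\<^esub>) = (x \<in> {x \<in> U. h x \<in> C})"
      using self h_closed by (simp add: quotient_module_def)
  qed auto
qed

text \<open>A submodule of \<open>N\<close> that contains a nonzero one has a preimage strictly
  above \<open>Y\<close>, so sections with lower end \<open>Y\<close> decide uniformity.\<close>

lemma uniform_module_of_section:
  assumes ne: "U \<noteq> Y"
    and indec: "\<And>V. submodule V R M \<Longrightarrow> Y \<subset> V \<Longrightarrow> V \<subseteq> U \<Longrightarrow> indecomposable_section R M V Y"
  shows "uniform_module R N"
  unfolding uniform_module_def
proof (intro conjI allI impI)
  show "carrier N \<noteq> {\<zero>\<^bsub>N\<^esub>}"
  proof
    assume "carrier N = {\<zero>\<^bsub>N\<^esub>}"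
    then have "U \<subseteq> Y" using h_closed kernel by auto
    then show False using ne YU by auto
  qed
  fix C assume C: "submodule C R N \<and> C \<noteq> {\<zero>\<^bsub>N\<^esub>}"
  show "uniform_submodule R C N"
    unfolding uniform_submodule_def
  proof (intro conjI allI impI)
    show "submodule C R N" using C by simp
    fix B assume B: "submodule B R N \<and> C \<subseteq> B"
    let ?V = "{x \<in> U. h x \<in> B}"
    have V: "submodule ?V R M" "Y \<subseteq> ?V" "?V \<subseteq> U" "h ` ?V = B"
      using B preimage_submodule preimage_lower image_preimage by auto
    have "?V \<noteq> Y"
    proof
      assume "?V = Y"
      then have "B = h ` Y" using V by simp
      moreover have "h ` Y \<subseteq> {\<zero>\<^bsub>N\<^esub>}" using kernel YU by auto
      ultimately have "C \<subseteq> {\<zero>\<^bsub>N\<^esub>}" using B by blast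
      then show False using C N.submodD(2) by blast
    qed
    then have "indecomposable_section R M ?V Y" using indec V by blast
    then show "indecomposable_module R (N\<lparr>carrier := B\<rparr>)"
      using indecomposable_submodule[OF V(1-3)] V(4) by simp
  qed
qed

end

section \<open>Homomorphisms between subquotients of one ambient module\<close>

lemma induced_hom:
  assumes "presentation R M U Y N h" "presentation R M U' Y' N' h'" and UU': "U \<subseteq> U'" and YY': "Y \<subseteq> Y'"
  obtains f where "f \<in> left_module_hom R N N'" "\<And>x. x \<in> U \<Longrightarrow> f (h x) = h' x"
proof -
  interpret P: presentation R M U Y N h by fact
  interpret P': presentation R M U' Y' N' h' by fact
  \<comment> \<open>Any preimage will do: two of them differ by an element of \<open>Y\<close>,
    which \<open>h'\<close> kills because \<open>Y \<subseteq> Y'\<close>.\<close>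
  define f where "f n = h' (SOME x. x \<in> U \<and> h x = n)" for n
  have f: "f (h x) = h' x" if x: "x \<in> U" for x
  proof -
    define y where "y = (SOME y. y \<in> U \<and> h y = h x)"
    have "y \<in> U \<and> h y = h x" unfolding y_def by (rule someI[of _ x]) (use x in simp)
    then have "y \<ominus>\<^bsub>M\<^esub> x \<in> Y'" "y \<in> U'" "x \<in> U'" using P.h_eq_iff YY' UU' x by auto
    then show ?thesis using P'.h_eq_iff unfolding f_def y_def[symmetric] by blast
  qed
  note D = P.submodD[OF P.U]
  have "f \<in> left_module_hom R N N'"
    unfolding left_module_hom_def
  proof (intro CollectI conjI ballI)
    show "f \<in> carrier N \<rightarrow> carrier N'"
    proof
      fix n assume "n \<in> carrier N"
      then obtain x where "x \<in> U" "n = h x" using P.h_surj by metis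
      then show "f n \<in> carrier N'" using f[of x] P'.h_closed[of x] UU' by auto
    qed
  next
    fix n n' assume "n \<in> carrier N" "n' \<in> carrier N"
    then obtain x x' where x: "x \<in> U" "n = h x" "x' \<in> U" "n' = h x'" using P.h_surj by metis
    then have "f (n \<oplus>\<^bsub>N\<^esub> n') = h' (x \<oplus>\<^bsub>M\<^esub> x')" using D(4) by (simp add: f flip: P.h_add)
    then show "f (n \<oplus>\<^bsub>N\<^esub> n') = f n \<oplus>\<^bsub>N'\<^esub> f n'" using x UU' by (simp add: f P'.h_add subsetD)
  next
    fix a n assume a: "a \<in> carrier R" "n \<in> carrier N"
    then obtain x where x: "x \<in> U" "n = h x" using P.h_surj by metis
    then have "f (a \<odot>\<^bsub>N\<^esub> n) = h' (a \<odot>\<^bsub>M\<^esub> x)" using D(7) a by (simp add: f flip: P.h_smult)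
    then show "f (a \<odot>\<^bsub>N\<^esub> n) = a \<odot>\<^bsub>N'\<^esub> f n" using x a UU' by (simp add: f P'.h_smult subsetD)
  qed
  with f show ?thesis using that by blast
qed

lemma uniform_inclusion_of_sections:
  assumes "presentation R M U Y N h" "presentation R M U' Y' N' h'"
    and UU': "U \<subseteq> U'" and Y: "Y = U \<inter> Y'" and ne: "\<not> U' \<subseteq> U <+>\<^bsub>M\<^esub> Y'"
    and indec: "\<And>V. submodule V R M \<Longrightarrow> U \<subseteq> V \<Longrightarrow> Y' \<subseteq> V \<Longrightarrow> V \<subseteq> U' \<Longrightarrow> indecomposable_section R M V Y'"
  shows "\<exists>f. uniform_inclusion R N N' f \<and> \<not> invertible_hom R N N' f"
proof -
  interpret P: presentation R M U Y N h by fact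
  interpret P': presentation R M U' Y' N' h' by fact
  obtain f where hom: "f \<in> left_module_hom R N N'" and f: "\<And>x. x \<in> U \<Longrightarrow> f (h x) = h' x"
    using induced_hom[OF assms(1,2) UU'] Y by blast
  have im: "f ` carrier N = h' ` U" unfolding P.image[symmetric] using f by force
  have "inj_on f (carrier N)"
  proof (rule inj_onI)
    fix n n' assume "n \<in> carrier N" "n' \<in> carrier N" and eq: "f n = f n'"
    then obtain x x' where x: "x \<in> U" "n = h x" "x' \<in> U" "n' = h x'" using P.h_surj by metis
    then have "x \<ominus>\<^bsub>M\<^esub> x' \<in> Y'" using eq P'.h_eq_iff UU' by (auto simp: f)
    moreover have "x \<ominus>\<^bsub>M\<^esub> x' \<in> U" using x P.submodD(6)[OF P.U] by blast
    ultimately show "n = n'" using x P.h_eq_iff Y by auto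
  qed
  moreover have "uniform_submodule R (f ` carrier N) N'"
    unfolding uniform_submodule_def im
  proof (intro conjI allI impI)
    show "submodule (h' ` U) R N'" by (rule P'.image_submodule[OF P.U UU'])
    fix B assume B: "submodule B R N' \<and> h' ` U \<subseteq> B"
    let ?V = "{x \<in> U'. h' x \<in> B}"
    have "submodule ?V R M" "Y' \<subseteq> ?V" "?V \<subseteq> U'" "h' ` ?V = B" "U \<subseteq> ?V"
      using B P'.preimage_submodule P'.preimage_lower P'.image_preimage UU' by auto
    then show "indecomposable_module R (N'\<lparr>carrier := B\<rparr>)"
      using P'.indecomposable_submodule[of ?V] indec by simp
  qed
  moreover have "\<not> invertible_hom R N N' f"
  proof
    assume "invertible_hom R N N' f"
    then obtain g where g: "g \<in> left_module_hom R N' N" "\<And>y. y \<in> carrier N' \<Longrightarrow> f (g y) = y"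
      unfolding invertible_hom_def by blast
    have "U' \<subseteq> U <+>\<^bsub>M\<^esub> Y'"
    proof
      fix x assume x: "x \<in> U'"
      then have "g (h' x) \<in> carrier N" using g(1) P'.h_closed by (auto simp: left_module_hom_def)
      then obtain u where u: "u \<in> U" "g (h' x) = h u" using P.h_surj by metis
      then have "h' x = h' u" using f g(2)[OF P'.h_closed[OF x]] by metis
      then have d: "x \<ominus>\<^bsub>M\<^esub> u \<in> Y'" using P'.h_eq_iff x u UU' by blast
      have "x = u \<oplus>\<^bsub>M\<^esub> (x \<ominus>\<^bsub>M\<^esub> u)"
        using P.submodD(3)[OF P'.U x] P.submodD(3)[OF P.U u(1)] by algebra
      then show "x \<in> U <+>\<^bsub>M\<^esub> Y'" using u d unfolding P.mem_set_add by blast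
    qed
    with ne show False by blast
  qed
  ultimately show ?thesis using hom unfolding uniform_inclusion_def by blast
qed

text \<open>The kernel of the induced map is \<open>Y' / Y\<close>, and factoring out a submodule of
  it leaves \<open>U / V\<close> with \<open>V\<close> between \<open>Y\<close> and
  \<open>Y'\<close>. Strictness of \<open>Y \<subset> Y'\<close> prevents an inverse.\<close>

lemma couniform_projection_of_sections:
  assumes "presentation R M U Y N h" "presentation R M U Y' N' h'" and YY': "Y \<subset> Y'"
    and indec: "\<And>V. submodule V R M \<Longrightarrow> Y \<subseteq> V \<Longrightarrow> V \<subseteq> Y' \<Longrightarrow> indecomposable_section R M U V"
  shows "\<exists>f. couniform_projection R N N' f \<and> \<not> invertible_hom R N N' f"
proof -
  interpret P: presentation R M U Y N h by fact
  interpret P': presentation R M U Y' N' h' by fact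
  obtain f where hom: "f \<in> left_module_hom R N N'" and f: "\<And>x. x \<in> U \<Longrightarrow> f (h x) = h' x"
    using induced_hom[OF assms(1,2)] YY' by blast
  have im: "f ` carrier N = carrier N'" unfolding P.image[symmetric] P'.image[symmetric] using f by force
  have ker: "a_kernel N N' f = h ` Y'"
  proof -
    have "a_kernel N N' f = {n \<in> h ` U. f n = \<zero>\<^bsub>N'\<^esub>}" unfolding a_kernel_def' P.image ..
    also have "\<dots> = h ` Y'" using f P'.kernel P'.YU by force
    finally show ?thesis .
  qed
  have "couniform_quotient R N (a_kernel N N' f)"
    unfolding couniform_quotient_def ker
  proof (intro conjI allI impI)
    show "submodule (h ` Y') R N" by (rule P.image_submodule[OF P'.Y P'.YU])
    fix C assume C: "submodule C R N \<and> C \<subseteq> h ` Y'"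
    let ?V = "{x \<in> U. h x \<in> C}"
    have "?V \<subseteq> Y'"
    proof
      fix x assume x: "x \<in> ?V"
      then obtain y where y: "y \<in> Y'" "h x = h y" using C by blast
      then have "x \<ominus>\<^bsub>M\<^esub> y \<in> Y'" using P.h_eq_iff x P'.YU YY' by blast
      then show "x \<in> Y'" using P.submod_diff_cancel[OF P'.Y y(1)] x P.submodD(3)[OF P.U] by blast
    qed
    moreover have "submodule ?V R M" "Y \<subseteq> ?V" using C P.preimage_submodule P.preimage_lower by auto
    ultimately have "indecomposable_section R M U ?V" using indec by blast
    then show "indecomposable_module R (quotient_module N C)"
      using presentation.indecomposable_module_of_section[OF P.quotient] C by blast
  qed
  moreover have "\<not> invertible_hom R N N' f"
  proof
    assume "invertible_hom R N N' f"
    then obtain g where g: "\<And>y. y \<in> carrier N \<Longrightarrow> g (f y) = y"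
      unfolding invertible_hom_def by blast
    have "Y' \<subseteq> Y"
    proof
      fix x assume x: "x \<in> Y'"
      then have xU: "x \<in> U" "\<zero>\<^bsub>M\<^esub> \<in> U" using P'.YU P.submodD(2)[OF P.U] by auto
      have "f (h x) = f (h \<zero>\<^bsub>M\<^esub>)" using f xU x P'.kernel by (simp add: P'.h_zero)
      then have "h x = \<zero>\<^bsub>N\<^esub>" using g xU P.h_closed P.h_zero by metis
      then show "x \<in> Y" using P.kernel xU by blast
    qed
    with YY' show False by blast
  qed
  ultimately show ?thesis using hom im unfolding couniform_projection_def by blast
qed

text \<open>The quotient has to live in the type \<open>'z\<close>, so a coset is represented by the
  value of \<open>\<kappa>\<close> at a chosen element. The choice \<open>r\<close> depends only on
  the coset (\<open>r_eq\<close>), hence \<open>h\<close> identifies exactly the elements congruent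
  modulo \<open>Y\<close>. The operations are transported through a section \<open>g\<close> of
  \<open>h\<close>.\<close>

lemma (in left_module) presentation_exists:
  fixes \<kappa> :: "'m \<Rightarrow> 'z"
  assumes U: "submodule U R M" and Y: "submodule Y R M" and YU: "Y \<subseteq> U"
    and inj: "inj_on \<kappa> U"
  shows "\<exists>(N :: ('a, 'z) module) h. presentation R M U Y N h"
proof -
  note D = submodD[OF U] and E = submodD[OF Y]
  define r where "r x = (SOME y. y \<in> U \<and> y \<ominus>\<^bsub>M\<^esub> x \<in> Y)" for x
  have r: "r x \<in> U \<and> r x \<ominus>\<^bsub>M\<^esub> x \<in> Y" if "x \<in> U" for x
    unfolding r_def by (rule someI[of _ x]) (use that D E M.r_neg in \<open>simp add: a_minus_def\<close>)
  have r_eq: "r x = r y" if "x \<in> U" "y \<in> U" "x \<ominus>\<^bsub>M\<^esub> y \<in> Y" for x y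
  proof -
    have "z \<ominus>\<^bsub>M\<^esub> x \<in> Y \<longleftrightarrow> z \<ominus>\<^bsub>M\<^esub> y \<in> Y" if z: "z \<in> U" for z
    proof
      have c: "x \<in> carrier M" "y \<in> carrier M" "z \<in> carrier M" using z that \<open>x \<in> U\<close> \<open>y \<in> U\<close> D by auto
      have e1: "z \<ominus>\<^bsub>M\<^esub> x = (z \<ominus>\<^bsub>M\<^esub> y) \<ominus>\<^bsub>M\<^esub> (x \<ominus>\<^bsub>M\<^esub> y)" using c by algebra
      have e2: "z \<ominus>\<^bsub>M\<^esub> y = (z \<ominus>\<^bsub>M\<^esub> x) \<oplus>\<^bsub>M\<^esub> (x \<ominus>\<^bsub>M\<^esub> y)" using c by algebra
      show "z \<ominus>\<^bsub>M\<^esub> x \<in> Y \<Longrightarrow> z \<ominus>\<^bsub>M\<^esub> y \<in> Y" unfolding e2 using E(4) \<open>x \<ominus>\<^bsub>M\<^esub> y \<in> Y\<close> by blast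
      show "z \<ominus>\<^bsub>M\<^esub> y \<in> Y \<Longrightarrow> z \<ominus>\<^bsub>M\<^esub> x \<in> Y" unfolding e1 using E(6) \<open>x \<ominus>\<^bsub>M\<^esub> y \<in> Y\<close> by blast
    qed
    then show ?thesis unfolding r_def by metis
  qed
  define h where "h x = \<kappa> (r x)" for x
  define g where "g n = (SOME x. x \<in> U \<and> h x = n)" for n
  have g: "g (h x) \<in> U \<and> h (g (h x)) = h x" if "x \<in> U" for x
    unfolding g_def by (rule someI[of _ x]) (use that in simp)
  have h_eq: "h x = h y \<longleftrightarrow> x \<ominus>\<^bsub>M\<^esub> y \<in> Y" if xy: "x \<in> U" "y \<in> U" for x y
  proof
    assume "h x = h y"
    then have e: "r x = r y" using inj r[OF xy(1)] r[OF xy(2)] by (auto simp: h_def inj_on_def)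
    have c: "x \<in> carrier M" "y \<in> carrier M" "r x \<in> carrier M" using xy r D by auto
    have "x \<ominus>\<^bsub>M\<^esub> y = (r x \<ominus>\<^bsub>M\<^esub> y) \<ominus>\<^bsub>M\<^esub> (r x \<ominus>\<^bsub>M\<^esub> x)" using c by algebra
    then show "x \<ominus>\<^bsub>M\<^esub> y \<in> Y" using r[OF xy(1)] r[OF xy(2)] e E(6) by simp
  qed (auto simp: h_def dest: r_eq[OF xy])
  define N :: "('a, 'z) module" where
    "N = \<lparr>carrier = h ` U, monoid.mult = undefined, one = undefined, ring.zero = h \<zero>\<^bsub>M\<^esub>,
      ring.add = (\<lambda>m n. h (g m \<oplus>\<^bsub>M\<^esub> g n)), smult = (\<lambda>a n. h (a \<odot>\<^bsub>M\<^esub> g n))\<rparr>"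
  have "presentation R M U Y N h"
  proof (rule presentation.intro[OF left_module_axioms presentation_axioms.intro])
    fix x y assume xy: "x \<in> U" "y \<in> U"
    have gx: "g (h x) \<in> U" "g (h x) \<ominus>\<^bsub>M\<^esub> x \<in> Y" "g (h y) \<in> U" "g (h y) \<ominus>\<^bsub>M\<^esub> y \<in> Y"
      using g xy h_eq by auto
    have c: "x \<in> carrier M" "y \<in> carrier M" "g (h x) \<in> carrier M" "g (h y) \<in> carrier M"
      using xy gx D by auto
    have "(x \<oplus>\<^bsub>M\<^esub> y) \<ominus>\<^bsub>M\<^esub> (g (h x) \<oplus>\<^bsub>M\<^esub> g (h y)) =
        \<ominus>\<^bsub>M\<^esub> ((g (h x) \<ominus>\<^bsub>M\<^esub> x) \<oplus>\<^bsub>M\<^esub> (g (h y) \<ominus>\<^bsub>M\<^esub> y))" using c by algebra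
    then have "(x \<oplus>\<^bsub>M\<^esub> y) \<ominus>\<^bsub>M\<^esub> (g (h x) \<oplus>\<^bsub>M\<^esub> g (h y)) \<in> Y" using gx E by simp
    then have "h (x \<oplus>\<^bsub>M\<^esub> y) = h (g (h x) \<oplus>\<^bsub>M\<^esub> g (h y))" using h_eq xy gx D by simp
    then show "h (x \<oplus>\<^bsub>M\<^esub> y) = h x \<oplus>\<^bsub>N\<^esub> h y" by (simp add: N_def)
  next
    fix a x assume a: "a \<in> carrier R" and x: "x \<in> U"
    have gx: "g (h x) \<in> U" "g (h x) \<ominus>\<^bsub>M\<^esub> x \<in> Y" using g x h_eq by auto
    have c: "x \<in> carrier M" "g (h x) \<in> carrier M" using x gx D by auto
    have "a \<odot>\<^bsub>M\<^esub> x \<ominus>\<^bsub>M\<^esub> a \<odot>\<^bsub>M\<^esub> g (h x) = \<ominus>\<^bsub>M\<^esub> (a \<odot>\<^bsub>M\<^esub> (g (h x) \<ominus>\<^bsub>M\<^esub> x))"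
      using c a by algebra
    then have "a \<odot>\<^bsub>M\<^esub> x \<ominus>\<^bsub>M\<^esub> a \<odot>\<^bsub>M\<^esub> g (h x) \<in> Y" using gx E a by simp
    then have "h (a \<odot>\<^bsub>M\<^esub> x) = h (a \<odot>\<^bsub>M\<^esub> g (h x))" using h_eq x gx D a by simp
    then show "h (a \<odot>\<^bsub>M\<^esub> x) = a \<odot>\<^bsub>N\<^esub> h x" by (simp add: N_def)
  next
    fix x assume x: "x \<in> U"
    have "x \<ominus>\<^bsub>M\<^esub> \<zero>\<^bsub>M\<^esub> = x" using x D(3) by (simp add: a_minus_def)
    then show "(h x = \<zero>\<^bsub>N\<^esub>) = (x \<in> Y)" using h_eq[OF x D(2)] by (simp add: N_def)
  qed (use U Y YU in \<open>auto simp: N_def\<close>)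
  then show ?thesis by blast
qed

section \<open>Finite dimension\<close>

text \<open>Lists are used because their suffixes give a filtration whose steps have dimension at
  most one, which bounds the length, and because the recursion produces coefficient
  sequences.\<close>

primrec scalar_span ::
    "('k, 'r) ring_scheme \<Rightarrow> ('k, 'a, 's) module_scheme \<Rightarrow> ('a, 'm, 't) module_scheme \<Rightarrow> 'm list \<Rightarrow> 'm set" where
  "scalar_span K A M [] = {\<zero>\<^bsub>M\<^esub>}"
| "scalar_span K A M (v # vs) =
    {((c \<odot>\<^bsub>A\<^esub> \<one>\<^bsub>A\<^esub>) \<odot>\<^bsub>M\<^esub> v) \<oplus>\<^bsub>M\<^esub> s | c s. c \<in> carrier K \<and> s \<in> scalar_span K A M vs}"

locale module_over_algebra = left_module A M + alg: assoc_algebra K A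
  for K :: "('k, 'r) ring_scheme" (structure) and A :: "('k, 'a, 's) module_scheme" (structure)
    and M :: "('a, 'm, 't) module_scheme" (structure)
begin

abbreviation scal :: "'k \<Rightarrow> 'a" where "scal c \<equiv> c \<odot>\<^bsub>A\<^esub> \<one>\<^bsub>A\<^esub>"

lemma scal_closed: "c \<in> carrier K \<Longrightarrow> scal c \<in> carrier A"
  using module.smult_closed[OF alg.module_axioms] by simp

lemma scal_add: "c \<in> carrier K \<Longrightarrow> d \<in> carrier K \<Longrightarrow> scal (c \<oplus>\<^bsub>K\<^esub> d) = scal c \<oplus>\<^bsub>A\<^esub> scal d"
  using module.smult_l_distr[OF alg.module_axioms] by simp

lemma scal_mult: "c \<in> carrier K \<Longrightarrow> d \<in> carrier K \<Longrightarrow> scal (c \<otimes>\<^bsub>K\<^esub> d) = scal c \<otimes>\<^bsub>A\<^esub> scal d"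
  using module.smult_assoc1[OF alg.module_axioms] scal_closed alg.smult_mult_left by simp

lemma scalar_span_closed: "set vs \<subseteq> carrier M \<Longrightarrow> scalar_span K A M vs \<subseteq> carrier M"
  by (induction vs) (auto intro!: M.a_closed smult_closed scal_closed)

lemma scalar_span_add:
  assumes "set vs \<subseteq> carrier M" "x \<in> scalar_span K A M vs" "y \<in> scalar_span K A M vs"
  shows "x \<oplus>\<^bsub>M\<^esub> y \<in> scalar_span K A M vs"
  using assms
proof (induction vs arbitrary: x y)
  case (Cons v vs)
  then obtain c s d t where cd: "c \<in> carrier K" "d \<in> carrier K"
      "s \<in> scalar_span K A M vs" "t \<in> scalar_span K A M vs"
    and x: "x = scal c \<odot>\<^bsub>M\<^esub> v \<oplus>\<^bsub>M\<^esub> s" and y: "y = scal d \<odot>\<^bsub>M\<^esub> v \<oplus>\<^bsub>M\<^esub> t" by auto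
  have car: "v \<in> carrier M" "s \<in> carrier M" "t \<in> carrier M"
    "scal c \<odot>\<^bsub>M\<^esub> v \<in> carrier M" "scal d \<odot>\<^bsub>M\<^esub> v \<in> carrier M"
    using cd Cons.prems(1) scalar_span_closed[of vs] by (auto intro!: smult_closed scal_closed)
  have "x \<oplus>\<^bsub>M\<^esub> y = (scal c \<odot>\<^bsub>M\<^esub> v \<oplus>\<^bsub>M\<^esub> scal d \<odot>\<^bsub>M\<^esub> v) \<oplus>\<^bsub>M\<^esub> (s \<oplus>\<^bsub>M\<^esub> t)"
    unfolding x y using car by algebra
  also have "\<dots> = scal (c \<oplus>\<^bsub>K\<^esub> d) \<odot>\<^bsub>M\<^esub> v \<oplus>\<^bsub>M\<^esub> (s \<oplus>\<^bsub>M\<^esub> t)"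
    using car cd by (simp add: scal_add smult_l_distr scal_closed)
  finally show ?case using Cons.IH cd Cons.prems(1) by auto
qed simp

lemma scalar_span_scal:
  assumes "set vs \<subseteq> carrier M" "x \<in> scalar_span K A M vs" "a \<in> carrier K"
  shows "scal a \<odot>\<^bsub>M\<^esub> x \<in> scalar_span K A M vs"
  using assms
proof (induction vs arbitrary: x)
  case Nil
  then show ?case by (simp add: smult_r_zero scal_closed)
next
  case (Cons v vs)
  then obtain c s where c: "c \<in> carrier K" "s \<in> scalar_span K A M vs"
    and x: "x = scal c \<odot>\<^bsub>M\<^esub> v \<oplus>\<^bsub>M\<^esub> s" by auto
  have car: "v \<in> carrier M" "s \<in> carrier M" using c Cons.prems scalar_span_closed[of vs] by auto
  have "scal a \<odot>\<^bsub>M\<^esub> x = scal (a \<otimes>\<^bsub>K\<^esub> c) \<odot>\<^bsub>M\<^esub> v \<oplus>\<^bsub>M\<^esub> scal a \<odot>\<^bsub>M\<^esub> s"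
    unfolding x using car c Cons.prems(3) scal_closed
    by (simp add: smult_r_distr smult_closed scal_mult smult_assoc1)
  then show ?case using Cons.IH c Cons.prems by auto
qed

lemma scalar_span_minus:
  assumes "set vs \<subseteq> carrier M" "x \<in> scalar_span K A M vs" "y \<in> scalar_span K A M vs"
  shows "x \<ominus>\<^bsub>M\<^esub> y \<in> scalar_span K A M vs"
proof -
  have y: "y \<in> carrier M" using assms scalar_span_closed by auto
  have "scal (\<ominus>\<^bsub>K\<^esub> \<one>\<^bsub>K\<^esub>) = \<ominus>\<^bsub>A\<^esub> \<one>\<^bsub>A\<^esub>"
    using module.smult_l_minus[OF alg.module_axioms, of "\<one>\<^bsub>K\<^esub>" "\<one>\<^bsub>A\<^esub>"] module.smult_one[OF alg.module_axioms] by simp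
  then have "\<ominus>\<^bsub>M\<^esub> y = scal (\<ominus>\<^bsub>K\<^esub> \<one>\<^bsub>K\<^esub>) \<odot>\<^bsub>M\<^esub> y" using y by (simp add: smult_l_neg smult_one)
  then have "\<ominus>\<^bsub>M\<^esub> y \<in> scalar_span K A M vs" using scalar_span_scal assms by simp
  then show ?thesis using scalar_span_add assms unfolding a_minus_def by blast
qed

lemma scalar_span_tail:
  assumes "v \<in> carrier M" "set vs \<subseteq> carrier M"
  shows "scalar_span K A M vs \<subseteq> scalar_span K A M (v # vs)"
proof
  fix x assume x: "x \<in> scalar_span K A M vs"
  then have xM: "x \<in> carrier M" using assms scalar_span_closed by auto
  have "scal \<zero>\<^bsub>K\<^esub> = \<zero>\<^bsub>A\<^esub>" using module.smult_l_null[OF alg.module_axioms] by simp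
  then have "x = scal \<zero>\<^bsub>K\<^esub> \<odot>\<^bsub>M\<^esub> v \<oplus>\<^bsub>M\<^esub> x" using assms xM by (simp add: smult_l_zero)
  then show "x \<in> scalar_span K A M (v # vs)" using x alg.K.zero_closed unfolding scalar_span.simps mem_Collect_eq by blast
qed

lemma scalar_span_append:
  assumes "set vs \<subseteq> carrier M" "set ws \<subseteq> carrier M" "x \<in> scalar_span K A M vs" "y \<in> scalar_span K A M ws"
  shows "x \<oplus>\<^bsub>M\<^esub> y \<in> scalar_span K A M (vs @ ws)"
  using assms
proof (induction vs arbitrary: x)
  case Nil
  then show ?case using scalar_span_closed[of ws] by auto
next
  case (Cons v vs)
  then obtain c s where c: "c \<in> carrier K" "s \<in> scalar_span K A M vs"
    and x: "x = scal c \<odot>\<^bsub>M\<^esub> v \<oplus>\<^bsub>M\<^esub> s" by auto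
  have car: "v \<in> carrier M" "s \<in> carrier M" "y \<in> carrier M" "scal c \<odot>\<^bsub>M\<^esub> v \<in> carrier M"
    using c Cons.prems scalar_span_closed[of vs] scalar_span_closed[of ws]
    by (auto intro!: smult_closed scal_closed)
  have "x \<oplus>\<^bsub>M\<^esub> y = scal c \<odot>\<^bsub>M\<^esub> v \<oplus>\<^bsub>M\<^esub> (s \<oplus>\<^bsub>M\<^esub> y)" unfolding x using car by algebra
  then show ?case using Cons.IH[OF _ _ c(2)] c(1) Cons.prems by auto
qed

lemma scalar_span_bounded_length:
  assumes "set vs \<subseteq> carrier M"
  shows "bounded_length A M (scalar_span K A M vs)"
proof -
  \<comment> \<open>\<open>S k\<close> is spanned by the last \<open>k\<close> vectors and becomes
    constant once \<open>k\<close> reaches the length of the list.\<close>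
  define S where "S k = scalar_span K A M (drop (length vs - k) vs)" for k
  have dropS: "\<exists>v. v \<in> carrier M \<and> drop (length vs - Suc k) vs = v # drop (length vs - k) vs" if "k < length vs" for k
  proof -
    have l: "length vs - Suc k < length vs" "Suc (length vs - Suc k) = length vs - k" using that by auto
    then have "vs ! (length vs - Suc k) \<in> carrier M" using assms nth_mem by blast
    then show ?thesis using Cons_nth_drop_Suc[OF l(1)] l(2) by metis
  qed
  have sub: "set (drop n vs) \<subseteq> carrier M" for n using assms set_drop_subset[of n vs] by simp
  have "bounded_length A M (S (length vs))"
  proof (rule bounded_length_filtration)
    show "S 0 = {\<zero>\<^bsub>M\<^esub>}" by (simp add: S_def)
    fix k
    show "S k \<subseteq> S (Suc k)"
    proof (cases "k < length vs")
      case True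
      then show ?thesis using dropS[OF True] scalar_span_tail[OF _ sub] unfolding S_def by metis
    qed (simp add: S_def)
    fix u v assume uv: "u \<in> S (Suc k) - S k" "v \<in> S (Suc k)"
    have k: "k < length vs" using uv(1) by (cases "k < length vs") (auto simp: S_def)
    then obtain w where w: "w \<in> carrier M" "drop (length vs - Suc k) vs = w # drop (length vs - k) vs"
      using dropS by blast
    obtain c s where c: "c \<in> carrier K" "s \<in> S k" "u = scal c \<odot>\<^bsub>M\<^esub> w \<oplus>\<^bsub>M\<^esub> s"
      using uv(1) w(2) unfolding S_def by auto
    obtain d t where d: "d \<in> carrier K" "t \<in> S k" "v = scal d \<odot>\<^bsub>M\<^esub> w \<oplus>\<^bsub>M\<^esub> t"
      using uv(2) w(2) unfolding S_def by auto
    have st: "s \<in> carrier M" "t \<in> carrier M" using c d scalar_span_closed[OF sub] unfolding S_def by auto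
    have "c \<noteq> \<zero>\<^bsub>K\<^esub>"
    proof
      assume "c = \<zero>\<^bsub>K\<^esub>"
      then have "u = s" using c w st module.smult_l_null[OF alg.module_axioms] by (simp add: smult_l_zero)
      then show False using c uv by blast
    qed
    then have cU: "c \<in> Units K" using alg.K.field_Units c by simp
    \<comment> \<open>With this quotient of leading coefficients, \<open>v - q u\<close> has no
      component along \<open>w\<close>.\<close>
    define q where "q = d \<otimes>\<^bsub>K\<^esub> inv\<^bsub>K\<^esub> c"
    have q: "q \<in> carrier K" "q \<otimes>\<^bsub>K\<^esub> c = d"
      using cU c d by (auto simp: q_def alg.K.m_assoc)
    have "scal q \<odot>\<^bsub>M\<^esub> u = scal d \<odot>\<^bsub>M\<^esub> w \<oplus>\<^bsub>M\<^esub> scal q \<odot>\<^bsub>M\<^esub> s"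
      using c q w st scal_closed scal_mult[of q c] by (simp add: smult_r_distr smult_closed smult_assoc1)
    then have "v \<ominus>\<^bsub>M\<^esub> scal q \<odot>\<^bsub>M\<^esub> u = (scal d \<odot>\<^bsub>M\<^esub> w \<oplus>\<^bsub>M\<^esub> t) \<ominus>\<^bsub>M\<^esub> (scal d \<odot>\<^bsub>M\<^esub> w \<oplus>\<^bsub>M\<^esub> scal q \<odot>\<^bsub>M\<^esub> s)"
      using d by simp
    also have "\<dots> = t \<ominus>\<^bsub>M\<^esub> scal q \<odot>\<^bsub>M\<^esub> s"
    proof -
      have "scal d \<odot>\<^bsub>M\<^esub> w \<in> carrier M" "scal q \<odot>\<^bsub>M\<^esub> s \<in> carrier M"
        using d q st w by (auto intro!: smult_closed scal_closed)
      then show ?thesis using st by algebra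
    qed
    also have "\<dots> \<in> S k"
      using scalar_span_minus[OF sub] scalar_span_scal[OF sub] c d q unfolding S_def by blast
    finally show "\<exists>a\<in>carrier A. v \<ominus>\<^bsub>M\<^esub> a \<odot>\<^bsub>M\<^esub> u \<in> S k" using scal_closed q by blast
  qed
  then show ?thesis by (simp add: S_def)
qed

text \<open>Each element is coded by the coefficients of one chosen expansion; the code determines
  the element even if the list is linearly dependent. This puts all carriers into
  \<open>nat \<Rightarrow> 'k\<close>.\<close>

lemma scalar_span_inj:
  "set vs \<subseteq> carrier M \<Longrightarrow> \<exists>\<kappa> :: 'm \<Rightarrow> nat \<Rightarrow> 'k. inj_on \<kappa> (scalar_span K A M vs)"
proof (induction vs)
  case (Cons v vs)
  then obtain \<kappa> :: "'m \<Rightarrow> nat \<Rightarrow> 'k" where k: "inj_on \<kappa> (scalar_span K A M vs)" by auto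
  have "\<exists>c s. c \<in> carrier K \<and> s \<in> scalar_span K A M vs \<and> x = scal c \<odot>\<^bsub>M\<^esub> v \<oplus>\<^bsub>M\<^esub> s"
    if "x \<in> scalar_span K A M (v # vs)" for x using that by auto
  then obtain c s where cs: "\<And>x. x \<in> scalar_span K A M (v # vs) \<Longrightarrow>
      s x \<in> scalar_span K A M vs \<and> x = scal (c x) \<odot>\<^bsub>M\<^esub> v \<oplus>\<^bsub>M\<^esub> s x" by metis
  define \<kappa>' where "\<kappa>' x = case_nat (c x) (\<kappa> (s x))" for x
  have "inj_on \<kappa>' (scalar_span K A M (v # vs))"
  proof (rule inj_onI)
    fix x y assume xy: "x \<in> scalar_span K A M (v # vs)" "y \<in> scalar_span K A M (v # vs)" "\<kappa>' x = \<kappa>' y"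
    have "c x = c y" using fun_cong[OF xy(3), of 0] by (simp add: \<kappa>'_def)
    moreover have "\<kappa> (s x) = \<kappa> (s y)"
    proof
      fix n show "\<kappa> (s x) n = \<kappa> (s y) n" using fun_cong[OF xy(3), of "Suc n"] by (simp add: \<kappa>'_def)
    qed
    ultimately show "x = y" using cs xy(1,2) k by (metis inj_onD)
  qed
  then show ?case by blast
qed simp

lemma finite_dim_of_scalar_span:
  assumes vs: "set vs \<subseteq> carrier M" and span: "carrier M \<subseteq> scalar_span K A M vs"
  shows "finite_dim K (underlying_space A M)"
proof -
  let ?V = "underlying_space A M"
  interpret V: abelian_group ?V
    by (rule abelian_groupI)
      (auto simp: underlying_space_def M.a_ac intro: M.a_inv_closed M.l_neg)
  have sV: "c \<odot>\<^bsub>?V\<^esub> x = scal c \<odot>\<^bsub>M\<^esub> x" "x \<oplus>\<^bsub>?V\<^esub> y = x \<oplus>\<^bsub>M\<^esub> y" "carrier ?V = carrier M" "\<zero>\<^bsub>?V\<^esub> = \<zero>\<^bsub>M\<^esub>" for c x y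
    by (simp_all add: underlying_space_def)
  have "\<exists>c \<in> set vs \<rightarrow> carrier K. x = (\<Oplus>\<^bsub>?V\<^esub>b\<in>set vs. c b \<odot>\<^bsub>?V\<^esub> b)"
    if "x \<in> scalar_span K A M vs" "set vs \<subseteq> carrier M" for x vs
    using that
  proof (induction vs arbitrary: x)
    case Nil
    then show ?case by (simp add: sV)
  next
    case (Cons v vs)
    then obtain d s where d: "d \<in> carrier K" "s \<in> scalar_span K A M vs"
      and x: "x = scal d \<odot>\<^bsub>M\<^esub> v \<oplus>\<^bsub>M\<^esub> s" by auto
    obtain c where c: "c \<in> set vs \<rightarrow> carrier K" "s = (\<Oplus>\<^bsub>?V\<^esub>b\<in>set vs. c b \<odot>\<^bsub>?V\<^esub> b)"
      using Cons.IH[OF d(2)] Cons.prems by auto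
    have vsM: "v \<in> carrier M" "set vs \<subseteq> carrier M" using Cons.prems by auto
    have trm: "f b \<odot>\<^bsub>?V\<^esub> b \<in> carrier ?V" if "f \<in> T \<rightarrow> carrier K" "b \<in> T" "T \<subseteq> carrier M" for f b and T :: "'m set"
      using that by (auto simp: sV intro!: smult_closed scal_closed)
    show ?case
    proof (cases "v \<in> set vs")
      case False
      define c' where "c' = c(v := d)"
      have "(\<Oplus>\<^bsub>?V\<^esub>b\<in>set vs. c' b \<odot>\<^bsub>?V\<^esub> b) = s"
        unfolding c(2) by (rule V.finsum_cong') (use False c vsM trm[of c "set vs"] in \<open>auto simp: c'_def\<close>)
      then have "(\<Oplus>\<^bsub>?V\<^esub>b\<in>set (v # vs). c' b \<odot>\<^bsub>?V\<^esub> b) = x"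
        using False c vsM d trm[of c "set vs"] unfolding x
        by (simp, subst V.finsum_insert) (auto simp: c'_def sV intro!: smult_closed scal_closed)
      moreover have "c' \<in> set (v # vs) \<rightarrow> carrier K" using c d by (auto simp: c'_def)
      ultimately show ?thesis by metis
    next
      \<comment> \<open>\<open>finite_dim\<close> sums over a set, whereas the list may repeat
        \<open>v\<close>; the coefficients of the repeated vector are added.\<close>
      case True
      define c' where "c' = c(v := d \<oplus>\<^bsub>K\<^esub> c v)"
      let ?X = "set vs - {v}"
      have X: "set vs = insert v ?X" "v \<notin> ?X" "finite ?X" using True by auto
      have "(\<Oplus>\<^bsub>?V\<^esub>b\<in>insert v ?X. c b \<odot>\<^bsub>?V\<^esub> b) = c v \<odot>\<^bsub>?V\<^esub> v \<oplus>\<^bsub>?V\<^esub> (\<Oplus>\<^bsub>?V\<^esub>b\<in>?X. c b \<odot>\<^bsub>?V\<^esub> b)"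
        using X c vsM trm[OF c(1) _ vsM(2)] True by (intro V.finsum_insert) auto
      then have s: "s = c v \<odot>\<^bsub>?V\<^esub> v \<oplus>\<^bsub>?V\<^esub> (\<Oplus>\<^bsub>?V\<^esub>b\<in>?X. c b \<odot>\<^bsub>?V\<^esub> b)" using c(2) X(1) by simp
      have c'K: "c' \<in> set vs \<rightarrow> carrier K" using c(1) d True by (simp add: c'_def Pi_iff)
      have "(\<Oplus>\<^bsub>?V\<^esub>b\<in>insert v ?X. c' b \<odot>\<^bsub>?V\<^esub> b) = c' v \<odot>\<^bsub>?V\<^esub> v \<oplus>\<^bsub>?V\<^esub> (\<Oplus>\<^bsub>?V\<^esub>b\<in>?X. c' b \<odot>\<^bsub>?V\<^esub> b)"
        using X vsM trm[OF c'K _ vsM(2)] True by (intro V.finsum_insert) auto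
      also have "(\<Oplus>\<^bsub>?V\<^esub>b\<in>?X. c' b \<odot>\<^bsub>?V\<^esub> b) = (\<Oplus>\<^bsub>?V\<^esub>b\<in>?X. c b \<odot>\<^bsub>?V\<^esub> b)"
        by (rule V.finsum_cong') (use trm[OF c(1) _ vsM(2)] in \<open>auto simp: c'_def\<close>)
      finally have "(\<Oplus>\<^bsub>?V\<^esub>b\<in>set (v # vs). c' b \<odot>\<^bsub>?V\<^esub> b) =
          (scal d \<odot>\<^bsub>M\<^esub> v \<oplus>\<^bsub>M\<^esub> scal (c v) \<odot>\<^bsub>M\<^esub> v) \<oplus>\<^bsub>M\<^esub> (\<Oplus>\<^bsub>?V\<^esub>b\<in>?X. c b \<odot>\<^bsub>?V\<^esub> b)"
        using c d True vsM X(1) by (simp add: sV c'_def Pi_iff scal_add smult_l_distr scal_closed insert_absorb)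
      moreover have "(\<Oplus>\<^bsub>?V\<^esub>b\<in>?X. c b \<odot>\<^bsub>?V\<^esub> b) \<in> carrier M"
        using V.finsum_closed[of "\<lambda>b. c b \<odot>\<^bsub>?V\<^esub> b" ?X] trm[OF c(1) _ vsM(2)] by (auto simp: sV)
      moreover have "scal d \<odot>\<^bsub>M\<^esub> v \<in> carrier M" "scal (c v) \<odot>\<^bsub>M\<^esub> v \<in> carrier M"
        using d c True vsM by (auto intro!: smult_closed scal_closed)
      ultimately have "(\<Oplus>\<^bsub>?V\<^esub>b\<in>set (v # vs). c' b \<odot>\<^bsub>?V\<^esub> b) = x"
        unfolding x s by (simp add: sV M.a_assoc)
      moreover have "c' \<in> set (v # vs) \<rightarrow> carrier K" using c'K True by auto
      ultimately show ?thesis by metis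
    qed
  qed
  then show ?thesis
    unfolding finite_dim_def using vs span by (intro exI[of _ "set vs"]) (auto simp: sV)
qed

end

section \<open>The algebra as a left module over itself\<close>

definition regular_module :: "('a, 'r) ring_scheme \<Rightarrow> ('a, 'a) module" where
  "regular_module A = \<lparr>carrier = carrier A, monoid.mult = monoid.mult A, one = one A,
     ring.zero = ring.zero A, ring.add = ring.add A, smult = monoid.mult A\<rparr>"

lemma regular_module_simps [simp]:
  "carrier (regular_module A) = carrier A" "ring.zero (regular_module A) = ring.zero A"
  "ring.add (regular_module A) = ring.add A" "smult (regular_module A) = monoid.mult A"
  by (simp_all add: regular_module_def)

lemma (in ring) regular_module_inv [simp]:
  "a_inv (regular_module R) = a_inv R" "a_minus (regular_module R) = a_minus R"
  by (auto simp: a_inv_def a_minus_def regular_module_def fun_eq_iff m_inv_def)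

lemma (in ring) left_module_regular: "left_module R (regular_module R)"
proof (intro left_module.intro left_module_axioms.intro abelian_groupI)
  show "ring R" ..
  show "\<And>x. x \<in> carrier (regular_module R) \<Longrightarrow> \<exists>y\<in>carrier (regular_module R). y \<oplus>\<^bsub>regular_module R\<^esub> x = \<zero>\<^bsub>regular_module R\<^esub>"
    using l_neg by auto
qed (auto simp: a_ac l_distr r_distr m_assoc)

lemma (in assoc_algebra) regular_scalar_span:
  assumes "finite_dim K A"
  obtains bs where "set bs \<subseteq> carrier A" "carrier A \<subseteq> scalar_span K A (regular_module A) bs"
proof -
  interpret reg: module_over_algebra K A "regular_module A"
    by (intro module_over_algebra.intro A.left_module_regular assoc_algebra_axioms)
  obtain B where B: "finite B" "B \<subseteq> carrier A"
      "\<And>v. v \<in> carrier A \<Longrightarrow> \<exists>c \<in> B \<rightarrow> carrier K. v = (\<Oplus>\<^bsub>A\<^esub>b\<in>B. c b \<odot>\<^bsub>A\<^esub> b)"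
    using assms unfolding finite_dim_def by blast
  obtain bs where bs: "set bs = B" "distinct bs" using finite_distinct_list[OF B(1)] by blast
  have "(\<Oplus>\<^bsub>A\<^esub>b\<in>set bs. c b \<odot>\<^bsub>A\<^esub> b) \<in> scalar_span K A (regular_module A) bs"
    if "c \<in> set bs \<rightarrow> carrier K" "set bs \<subseteq> carrier A" "distinct bs" for c bs
    using that
  proof (induction bs)
    case (Cons b bs)
    have "(\<Oplus>\<^bsub>A\<^esub>b\<in>set (b # bs). c b \<odot>\<^bsub>A\<^esub> b) = c b \<odot>\<^bsub>A\<^esub> b \<oplus>\<^bsub>A\<^esub> (\<Oplus>\<^bsub>A\<^esub>b\<in>set bs. c b \<odot>\<^bsub>A\<^esub> b)"
      using Cons.prems by (simp, subst M.finsum_insert) (auto intro!: module.smult_closed[OF module_axioms])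
    moreover have "c b \<odot>\<^bsub>A\<^esub> b = reg.scal (c b) \<otimes>\<^bsub>A\<^esub> b" using Cons.prems smult_mult_left by simp
    ultimately show ?case using Cons by auto
  qed simp
  note span = this
  have "carrier A \<subseteq> scalar_span K A (regular_module A) bs"
  proof
    fix v assume "v \<in> carrier A"
    then obtain c where "c \<in> B \<rightarrow> carrier K" "v = (\<Oplus>\<^bsub>A\<^esub>b\<in>B. c b \<odot>\<^bsub>A\<^esub> b)" using B(3) by blast
    then show "v \<in> scalar_span K A (regular_module A) bs" using span[of c bs] bs B(2) by simp
  qed
  with that[of bs] bs(1) B(2) show ?thesis by simp
qed

section \<open>Sequences over a left ideal\<close>

text \<open>The common ambient module. Indices are integers because the window of generators grows
  at both ends.\<close>

definition int_functions :: "('a, 'r) ring_scheme \<Rightarrow> ('a, int \<Rightarrow> 'a) module" where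
  "int_functions A = \<lparr>carrier = {u. \<forall>i. u i \<in> carrier A}, monoid.mult = undefined, one = undefined,
     ring.zero = (\<lambda>i. \<zero>\<^bsub>A\<^esub>), ring.add = (\<lambda>u v i. u i \<oplus>\<^bsub>A\<^esub> v i), smult = (\<lambda>a u i. a \<otimes>\<^bsub>A\<^esub> u i)\<rparr>"

lemma int_functions_simps [simp]:
  "carrier (int_functions A) = {u. \<forall>i. u i \<in> carrier A}"
  "ring.zero (int_functions A) = (\<lambda>i. \<zero>\<^bsub>A\<^esub>)"
  "u \<oplus>\<^bsub>int_functions A\<^esub> v = (\<lambda>i. u i \<oplus>\<^bsub>A\<^esub> v i)"
  "a \<odot>\<^bsub>int_functions A\<^esub> u = (\<lambda>i. a \<otimes>\<^bsub>A\<^esub> u i)"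
  by (simp_all add: int_functions_def)

lemma (in ring) left_module_int_functions: "left_module R (int_functions R)"
proof (intro left_module.intro left_module_axioms.intro abelian_groupI)
  show "ring R" ..
  fix x assume "x \<in> carrier (int_functions R)"
  then show "\<exists>y\<in>carrier (int_functions R). y \<oplus>\<^bsub>int_functions R\<^esub> x = \<zero>\<^bsub>int_functions R\<^esub>"
    by (intro bexI[of _ "\<lambda>i. \<ominus> x i"]) (auto simp: l_neg)
qed (auto simp: a_ac l_distr r_distr m_assoc)

definition single :: "('a, 'r) ring_scheme \<Rightarrow> int \<Rightarrow> 'a \<Rightarrow> int \<Rightarrow> 'a" where
  "single A i p = (\<lambda>j. if j = i then p else \<zero>\<^bsub>A\<^esub>)"

text \<open>
  \<open>P\<close> is a local module with maximal submodule \<open>P'\<close>.  The maps \<open>vB\<close>, \<open>vC\<close> are the two coordinates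
  of a homomorphism from \<open>S = (B + C)e\<close> to the square of a simple module \<open>L\<close>; axiom \<open>balance\<close> makes
  the action of \<open>B\<close> and \<open>C\<close> on \<open>P / P'\<close> resemble the two arrows of the Kronecker quiver.
\<close>

locale kronecker_data = ring A + B: ideal B A + C: ideal C A + L: left_module A L
  for A :: "('a, 'r) ring_scheme" (structure) and B C :: "'a set"
    and L :: "('a, 'l, 't) module_scheme" +
  fixes e :: 'a and vB vC :: "'a \<Rightarrow> 'l" and S P P' :: "'a set"
  defines "S \<equiv> {x \<otimes> e \<oplus> y \<otimes> e | x y. x \<in> B \<and> y \<in> C}"
    and "P \<equiv> {a \<otimes> e | a. a \<in> carrier A}"
    and "P' \<equiv> {p \<in> P. \<forall>x\<in>B. vB (x \<otimes> p) = \<zero>\<^bsub>L\<^esub>}"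
  assumes e: "e \<in> carrier A"
    and vB_closed: "s \<in> S \<Longrightarrow> vB s \<in> carrier L" and vC_closed: "s \<in> S \<Longrightarrow> vC s \<in> carrier L"
    and vB_add: "\<lbrakk>s \<in> S; t \<in> S\<rbrakk> \<Longrightarrow> vB (s \<oplus> t) = vB s \<oplus>\<^bsub>L\<^esub> vB t"
    and vC_add: "\<lbrakk>s \<in> S; t \<in> S\<rbrakk> \<Longrightarrow> vC (s \<oplus> t) = vC s \<oplus>\<^bsub>L\<^esub> vC t"
    and vB_smult: "\<lbrakk>a \<in> carrier A; s \<in> S\<rbrakk> \<Longrightarrow> vB (a \<otimes> s) = a \<odot>\<^bsub>L\<^esub> vB s"
    and vC_smult: "\<lbrakk>a \<in> carrier A; s \<in> S\<rbrakk> \<Longrightarrow> vC (a \<otimes> s) = a \<odot>\<^bsub>L\<^esub> vC s"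
    and vB_C: "y \<in> C \<Longrightarrow> vB (y \<otimes> e) = \<zero>\<^bsub>L\<^esub>" and vC_B: "x \<in> B \<Longrightarrow> vC (x \<otimes> e) = \<zero>\<^bsub>L\<^esub>"
    and balance_B: "x \<in> B \<Longrightarrow> \<exists>y\<in>C. \<forall>p\<in>P. vC (y \<otimes> p) = vB (x \<otimes> p)"
    and balance_C: "y \<in> C \<Longrightarrow> \<exists>x\<in>B. \<forall>p\<in>P. vB (x \<otimes> p) = vC (y \<otimes> p)"
    and vB_surj: "l \<in> carrier L \<Longrightarrow> \<exists>x\<in>B. vB (x \<otimes> e) = l"
    and L_simple: "\<lbrakk>l \<in> carrier L; l \<noteq> \<zero>\<^bsub>L\<^esub>; l' \<in> carrier L\<rbrakk> \<Longrightarrow> \<exists>a\<in>carrier A. l' = a \<odot>\<^bsub>L\<^esub> l"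
    and L_nonzero: "carrier L \<noteq> {\<zero>\<^bsub>L\<^esub>}"
    and P_local: "\<lbrakk>p \<in> P - P'; q \<in> P\<rbrakk> \<Longrightarrow> \<exists>a\<in>carrier A. q = a \<otimes> p"
begin

sublocale F: left_module A "int_functions A" by (rule left_module_int_functions)

abbreviation "F \<equiv> int_functions A"

lemma F_minus: "u \<in> carrier F \<Longrightarrow> v \<in> carrier F \<Longrightarrow> u \<ominus>\<^bsub>F\<^esub> v = (\<lambda>i. u i \<ominus> v i)"
proof -
  assume u: "u \<in> carrier F" and v: "v \<in> carrier F"
  have "\<ominus>\<^bsub>F\<^esub> v = (\<lambda>i. \<ominus> v i)"
    by (rule F.M.minus_equality) (use v in \<open>auto simp: l_neg\<close>)
  then show ?thesis by (simp add: a_minus_def)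
qed

lemma P_carrier: "p \<in> P \<Longrightarrow> p \<in> carrier A"
  using e by (auto simp: P_def)

lemma e_P: "e \<in> P"
  using e by (auto simp: P_def intro!: exI[of _ \<one>])

lemma P_zero: "\<zero> \<in> P"
  using e by (auto simp: P_def intro!: exI[of _ \<zero>])

lemma P_add: "p \<in> P \<Longrightarrow> q \<in> P \<Longrightarrow> p \<oplus> q \<in> P"
  using e by (auto simp: P_def l_distr[symmetric])

lemma P_smult: "a \<in> carrier A \<Longrightarrow> p \<in> P \<Longrightarrow> a \<otimes> p \<in> P"
  using e by (auto simp: P_def m_assoc[symmetric])

lemma S_I: "x \<in> B \<Longrightarrow> y \<in> C \<Longrightarrow> x \<otimes> e \<oplus> y \<otimes> e \<in> S"
  by (auto simp: S_def)

lemma S_carrier: "s \<in> S \<Longrightarrow> s \<in> carrier A"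
  using e by (auto simp: S_def)

lemma S_B: "x \<in> B \<Longrightarrow> x \<otimes> e \<in> S"
  using S_I[of x \<zero>] e by simp

lemma S_C: "y \<in> C \<Longrightarrow> y \<otimes> e \<in> S"
  using S_I[of \<zero> y] e by simp

lemma S_zero: "\<zero> \<in> S"
  using S_B[of \<zero>] e by simp

lemma S_add: "s \<in> S \<Longrightarrow> t \<in> S \<Longrightarrow> s \<oplus> t \<in> S"
proof -
  assume "s \<in> S" "t \<in> S"
  then obtain x y x' y' where s: "s = x \<otimes> e \<oplus> y \<otimes> e" "x \<in> B" "y \<in> C"
    and t: "t = x' \<otimes> e \<oplus> y' \<otimes> e" "x' \<in> B" "y' \<in> C" by (auto simp: S_def)
  have "s \<oplus> t = (x \<oplus> x') \<otimes> e \<oplus> (y \<oplus> y') \<otimes> e"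
    unfolding s t using s t e B.Icarr C.Icarr by (simp add: l_distr a_ac)
  then show ?thesis using S_I[of "x \<oplus> x'" "y \<oplus> y'"] s t by simp
qed

lemma S_smult: "a \<in> carrier A \<Longrightarrow> s \<in> S \<Longrightarrow> a \<otimes> s \<in> S"
proof -
  assume a: "a \<in> carrier A" and "s \<in> S"
  then obtain x y where s: "s = x \<otimes> e \<oplus> y \<otimes> e" "x \<in> B" "y \<in> C" by (auto simp: S_def)
  have "a \<otimes> s = (a \<otimes> x) \<otimes> e \<oplus> (a \<otimes> y) \<otimes> e"
    unfolding s using s a e B.Icarr C.Icarr by (simp add: r_distr m_assoc)
  then show ?thesis using S_I[of "a \<otimes> x" "a \<otimes> y"] s a B.I_l_closed C.I_l_closed by simp
qed

lemma S_P: "s \<in> S \<Longrightarrow> s \<in> P"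
  using P_add P_smult[OF _ e_P] B.Icarr C.Icarr by (auto simp: S_def)

lemma B_P: assumes "x \<in> B" "p \<in> P" shows "x \<otimes> p \<in> S" "vC (x \<otimes> p) = \<zero>\<^bsub>L\<^esub>"
proof -
  obtain a where a: "a \<in> carrier A" "p = a \<otimes> e" using assms by (auto simp: P_def)
  then have "x \<otimes> p = (x \<otimes> a) \<otimes> e" "x \<otimes> a \<in> B" using assms e B.Icarr B.I_r_closed by (auto simp: m_assoc)
  then show "x \<otimes> p \<in> S" "vC (x \<otimes> p) = \<zero>\<^bsub>L\<^esub>" using S_B vC_B by auto
qed

lemma C_P: assumes "y \<in> C" "p \<in> P" shows "y \<otimes> p \<in> S" "vB (y \<otimes> p) = \<zero>\<^bsub>L\<^esub>"
proof -
  obtain a where a: "a \<in> carrier A" "p = a \<otimes> e" using assms by (auto simp: P_def)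
  then have "y \<otimes> p = (y \<otimes> a) \<otimes> e" "y \<otimes> a \<in> C" using assms e C.Icarr C.I_r_closed by (auto simp: m_assoc)
  then show "y \<otimes> p \<in> S" "vB (y \<otimes> p) = \<zero>\<^bsub>L\<^esub>" using S_C vB_C by auto
qed

lemma v_zero: "vB \<zero> = \<zero>\<^bsub>L\<^esub>" "vC \<zero> = \<zero>\<^bsub>L\<^esub>"
  using vB_C[of \<zero>] vC_B[of \<zero>] e by simp_all

lemma vC_surj: "l \<in> carrier L \<Longrightarrow> \<exists>y\<in>C. vC (y \<otimes> e) = l"
  using vB_surj balance_B e_P by metis

lemma P'_P: "p \<in> P' \<Longrightarrow> p \<in> P" by (simp add: P'_def)

lemma P'_B: "p \<in> P' \<Longrightarrow> x \<in> B \<Longrightarrow> vB (x \<otimes> p) = \<zero>\<^bsub>L\<^esub>" by (simp add: P'_def)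

text \<open>\<open>balance_C\<close> transfers the description of \<open>P'\<close> from
  \<open>B\<close> to \<open>C\<close>. Together with \<open>P'_I_C\<close> this makes
  \<open>P'\<close> the part of \<open>P\<close> that either arrow fails to see.\<close>

lemma P'_C: "p \<in> P' \<Longrightarrow> y \<in> C \<Longrightarrow> vC (y \<otimes> p) = \<zero>\<^bsub>L\<^esub>"
  using balance_C P'_P P'_B by metis

lemma P'_I_B: "p \<in> P \<Longrightarrow> (\<And>x. x \<in> B \<Longrightarrow> vB (x \<otimes> p) = \<zero>\<^bsub>L\<^esub>) \<Longrightarrow> p \<in> P'" by (simp add: P'_def)

lemma P'_I_C: "p \<in> P \<Longrightarrow> (\<And>y. y \<in> C \<Longrightarrow> vC (y \<otimes> p) = \<zero>\<^bsub>L\<^esub>) \<Longrightarrow> p \<in> P'"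
  using balance_B P'_I_B by metis

lemma P'_zero: "\<zero> \<in> P'"
  using P_zero B.Icarr by (auto simp: P'_def v_zero)

lemma P'_add: "p \<in> P' \<Longrightarrow> q \<in> P' \<Longrightarrow> p \<oplus> q \<in> P'"
proof (rule P'_I_B)
  assume pq: "p \<in> P'" "q \<in> P'"
  then show "p \<oplus> q \<in> P" using P_add P'_P by blast
  fix x assume x: "x \<in> B"
  have "x \<otimes> (p \<oplus> q) = x \<otimes> p \<oplus> x \<otimes> q" using pq x P'_P P_carrier B.Icarr by (simp add: r_distr)
  then show "vB (x \<otimes> (p \<oplus> q)) = \<zero>\<^bsub>L\<^esub>" using pq x P'_P P'_B B_P by (simp add: vB_add)
qed

lemma P'_smult: "a \<in> carrier A \<Longrightarrow> p \<in> P' \<Longrightarrow> a \<otimes> p \<in> P'"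
proof (rule P'_I_B)
  assume a: "a \<in> carrier A" "p \<in> P'"
  then show "a \<otimes> p \<in> P" using P_smult P'_P by blast
  fix x assume x: "x \<in> B"
  have "x \<otimes> (a \<otimes> p) = (x \<otimes> a) \<otimes> p" using a x P'_P P_carrier B.Icarr by (simp add: m_assoc)
  then show "vB (x \<otimes> (a \<otimes> p)) = \<zero>\<^bsub>L\<^esub>" using a x P'_B B.I_r_closed by simp
qed

lemma P'_minus: "p \<in> P' \<Longrightarrow> q \<in> P' \<Longrightarrow> p \<ominus> q \<in> P'"
proof -
  assume pq: "p \<in> P'" "q \<in> P'"
  have "p \<ominus> q = p \<oplus> (\<ominus> \<one>) \<otimes> q" using P_carrier P'_P pq by (simp add: l_minus a_minus_def)
  then show ?thesis using P'_add P'_smult pq by simp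
qed

lemma e_P': "e \<notin> P'"
proof
  assume "e \<in> P'"
  then have "l = \<zero>\<^bsub>L\<^esub>" if "l \<in> carrier L" for l using vB_surj[OF that] P'_B by auto
  then show False using L_nonzero L.M.zero_closed by blast
qed

section \<open>Powers of \<open>P\<close> and their socle coordinates\<close>

definition PP :: "int set \<Rightarrow> (int \<Rightarrow> 'a) set" where
  "PP I = {u. (\<forall>i. u i \<in> P) \<and> (\<forall>i. i \<notin> I \<longrightarrow> u i = \<zero>)}"

definition HH :: "int set \<Rightarrow> (int \<Rightarrow> 'a) set" where
  "HH I = {u. (\<forall>i. u i \<in> S) \<and> (\<forall>i. i \<notin> I \<longrightarrow> u i = \<zero>)}"

text \<open>Coordinate \<open>j\<close> sits between the generators \<open>j - 1\<close> and
  \<open>j\<close>: it receives \<open>C\<close> acting on the former and \<open>B\<close> acting on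
  the latter. For matching \<open>b\<close> and \<open>c\<close> the difference of
  \<open>b w(j)\<close> and \<open>c w(j-1)\<close> has value zero at \<open>j\<close>, which is how
  the relations are encoded.\<close>

definition val :: "int \<Rightarrow> (int \<Rightarrow> 'a) \<Rightarrow> 'l" where
  "val j u = vB (u j) \<oplus>\<^bsub>L\<^esub> vC (u (j - 1))"

text \<open>The relations within the socle part: modulo \<open>KK I J\<close> exactly the
  coordinates in \<open>J\<close> are remembered.\<close>

definition KK :: "int set \<Rightarrow> int set \<Rightarrow> (int \<Rightarrow> 'a) set" where
  "KK I J = {h \<in> HH I. \<forall>j\<in>J. val j h = \<zero>\<^bsub>L\<^esub>}"

definition RR :: "(int \<Rightarrow> 'a) set" where
  "RR = {u. \<forall>i. u i \<in> P'}"

lemma PP_submodule: "submodule (PP I) A F"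
  by (rule F.submodI) (auto simp: PP_def P_carrier P_zero P_add P_smult)

lemma HH_submodule: "submodule (HH I) A F"
  by (rule F.submodI) (auto simp: HH_def S_carrier S_zero S_add S_smult)

lemma RR_submodule: "submodule RR A F"
  by (rule F.submodI) (auto simp: RR_def P_carrier P'_P P'_zero P'_add P'_smult)

lemma HH_PP: "HH I \<subseteq> PP I"
  by (auto simp: HH_def PP_def S_P)

lemma PP_mono: "I \<subseteq> I' \<Longrightarrow> PP I \<subseteq> PP I'"
  by (auto simp: PP_def)

lemma HH_mono: "I \<subseteq> I' \<Longrightarrow> HH I \<subseteq> HH I'"
  by (auto simp: HH_def)

lemma HH_Int_PP: "HH I \<inter> PP I' \<subseteq> HH I'"
  by (auto simp: HH_def PP_def)

lemma HH_SD: "h \<in> HH I \<Longrightarrow> h i \<in> S" by (simp add: HH_def)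

lemma PP_PD: "u \<in> PP I \<Longrightarrow> u i \<in> P" by (simp add: PP_def)

lemma PP_carrier: "u \<in> PP I \<Longrightarrow> u \<in> carrier F"
  by (simp add: PP_def P_carrier)

lemma HH_carrier: "u \<in> HH I \<Longrightarrow> u \<in> carrier F"
  by (simp add: HH_def S_carrier)

lemma val_closed: "h \<in> HH I \<Longrightarrow> val j h \<in> carrier L"
  by (simp add: val_def vB_closed vC_closed HH_def)

lemma val_add: "h \<in> HH I \<Longrightarrow> h' \<in> HH I' \<Longrightarrow> val j (h \<oplus>\<^bsub>F\<^esub> h') = val j h \<oplus>\<^bsub>L\<^esub> val j h'"
  using vB_closed vC_closed by (simp add: val_def HH_def vB_add vC_add L.M.a_ac)

lemma val_smult: "a \<in> carrier A \<Longrightarrow> h \<in> HH I \<Longrightarrow> val j (a \<odot>\<^bsub>F\<^esub> h) = a \<odot>\<^bsub>L\<^esub> val j h"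
  using vB_closed vC_closed by (simp add: val_def HH_def vB_smult vC_smult L.smult_r_distr)

lemma val_minus:
  assumes "h \<in> HH I" "h' \<in> HH I" shows "val j (h \<ominus>\<^bsub>F\<^esub> h') = val j h \<ominus>\<^bsub>L\<^esub> val j h'"
proof -
  have d: "h \<ominus>\<^bsub>F\<^esub> h' \<in> HH I" using F.submodD(6)[OF HH_submodule] assms by blast
  have "h = (h \<ominus>\<^bsub>F\<^esub> h') \<oplus>\<^bsub>F\<^esub> h'" using HH_carrier assms by algebra
  then have "val j h = val j (h \<ominus>\<^bsub>F\<^esub> h') \<oplus>\<^bsub>L\<^esub> val j h'" using val_add[OF d assms(2)] by metis
  then have "val j h \<ominus>\<^bsub>L\<^esub> val j h' = (val j (h \<ominus>\<^bsub>F\<^esub> h') \<oplus>\<^bsub>L\<^esub> val j h') \<ominus>\<^bsub>L\<^esub> val j h'" by simp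
  also have "\<dots> = val j (h \<ominus>\<^bsub>F\<^esub> h')" using val_closed[OF d] val_closed[OF assms(2)] by algebra
  finally show ?thesis by simp
qed

lemma KK_submodule: "submodule (KK I J) A F"
proof (rule F.submodI)
  note D = F.submodD[OF HH_submodule]
  show "KK I J \<subseteq> carrier F" using D(1) by (auto simp: KK_def)
  show "\<zero>\<^bsub>F\<^esub> \<in> KK I J" using D(2) by (auto simp: KK_def val_def v_zero)
next
  fix x y assume xy: "x \<in> KK I J" "y \<in> KK I J"
  then have h: "x \<in> HH I" "y \<in> HH I" by (auto simp: KK_def)
  then have "val j (x \<oplus>\<^bsub>F\<^esub> y) = \<zero>\<^bsub>L\<^esub>" if "j \<in> J" for j
    unfolding val_add[OF h] using xy that by (simp add: KK_def)
  then show "x \<oplus>\<^bsub>F\<^esub> y \<in> KK I J" using h F.submodD(4)[OF HH_submodule] unfolding KK_def by blast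
next
  fix a x assume a: "a \<in> carrier A" and x: "x \<in> KK I J"
  then have h: "x \<in> HH I" by (auto simp: KK_def)
  then have "val j (a \<odot>\<^bsub>F\<^esub> x) = \<zero>\<^bsub>L\<^esub>" if "j \<in> J" for j
    unfolding val_smult[OF a h] using x that a by (simp add: KK_def L.smult_r_zero)
  then show "a \<odot>\<^bsub>F\<^esub> x \<in> KK I J" using h a F.submodD(7)[OF HH_submodule] unfolding KK_def by blast
qed

lemma B_smult_PP:
  assumes "x \<in> B" "v \<in> PP I"
  shows "x \<odot>\<^bsub>F\<^esub> v \<in> HH I" "val j (x \<odot>\<^bsub>F\<^esub> v) = vB (x \<otimes> v j)"
  using assms B_P[of x] vB_closed B.Icarr by (auto simp: HH_def PP_def val_def)

lemma C_smult_PP: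
  assumes "y \<in> C" "v \<in> PP I"
  shows "y \<odot>\<^bsub>F\<^esub> v \<in> HH I" "val j (y \<odot>\<^bsub>F\<^esub> v) = vC (y \<otimes> v (j - 1))"
  using assms C_P[of y] vC_closed C.Icarr by (auto simp: HH_def PP_def val_def)

lemma val_smult_RR:
  assumes "t \<in> B \<union> C" "v \<in> PP I" "v j \<in> P'" "v (j - 1) \<in> P'"
  shows "val j (t \<odot>\<^bsub>F\<^esub> v) = \<zero>\<^bsub>L\<^esub>"
  using assms B_smult_PP(2)[of t v I j] C_smult_PP(2)[of t v I j] P'_B P'_C by auto

lemma single_PP: "p \<in> P \<Longrightarrow> i \<in> I \<Longrightarrow> single A i p \<in> PP I"
  by (auto simp: PP_def single_def P_zero)

lemma single_HH: "s \<in> S \<Longrightarrow> i \<in> I \<Longrightarrow> single A i s \<in> HH I"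
  by (auto simp: HH_def single_def S_zero)

lemma smult_single: "a \<in> carrier A \<Longrightarrow> a \<odot>\<^bsub>F\<^esub> single A i p = single A i (a \<otimes> p)"
  by (auto simp: single_def)

lemma submodule_of_singles:
  assumes N: "submodule N A F" and I: "finite I"
    and "u \<in> carrier F" "\<And>i. i \<notin> I \<Longrightarrow> u i = \<zero>" "\<And>i. i \<in> I \<Longrightarrow> single A i (u i) \<in> N"
  shows "u \<in> N"
  using I assms(3-)
proof (induction I arbitrary: u)
  case empty
  then have "u = \<zero>\<^bsub>F\<^esub>" by auto
  then show ?case using F.submodD(2)[OF N] by simp
next
  case (insert k I)
  let ?u = "u(k := \<zero>)"
  have "?u \<in> N"
  proof (rule insert.IH)
    fix i assume "i \<in> I"
    then show "single A i (?u i) \<in> N" using insert by auto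
  qed (use insert in auto)
  moreover have "u = single A k (u k) \<oplus>\<^bsub>F\<^esub> ?u"
    using insert.prems(1) by (auto simp: single_def fun_eq_iff)
  ultimately show ?case using F.submodD(4)[OF N] insert.prems(3)[of k] by fastforce
qed

definition restr :: "int set \<Rightarrow> (int \<Rightarrow> 'a) \<Rightarrow> int \<Rightarrow> 'a" where
  "restr I u = (\<lambda>i. if i \<in> I then u i else \<zero>)"

lemma restr_PP: "u \<in> PP I' \<Longrightarrow> restr I u \<in> PP I"
  by (auto simp: restr_def PP_def P_zero)

lemma restr_HH: "u \<in> HH I' \<Longrightarrow> restr I u \<in> HH I"
  by (auto simp: restr_def HH_def S_zero)

text \<open>The coordinates \<open>a\<close> to \<open>b + 1\<close> are independent although there
  is one generator fewer: generator \<open>j\<close> serves coordinate \<open>j\<close> through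
  \<open>B\<close>, and the last generator serves \<open>b + 1\<close> as well, through
  \<open>C\<close>.\<close>

lemma val_prescribed:
  assumes ab: "a \<le> b" and l: "\<And>j. l j \<in> carrier L"
  obtains h where "h \<in> HH {a..b}" "\<And>j. j \<in> {a..b+1} \<Longrightarrow> val j h = l j"
proof -
  obtain x where x: "\<And>j. x j \<in> B \<and> vB (x j \<otimes> e) = l j" proof -
    have "\<forall>j. \<exists>x. x \<in> B \<and> vB (x \<otimes> e) = l j" using vB_surj[OF l] by blast
    then show ?thesis using that by metis
  qed
  obtain y where y: "y \<in> C" "vC (y \<otimes> e) = l (b + 1)" using vC_surj[OF l] by blast
  define h where "h = (\<lambda>j. if j \<in> {a..b} then if j = b then x j \<otimes> e \<oplus> y \<otimes> e else x j \<otimes> e else \<zero>)"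
  have hB: "vB (h j) = l j" if "j \<in> {a..b}" for j
    using that x[of j] y l[of j] by (auto simp: h_def vB_add S_B S_C vB_C)
  have hC: "vC (h j) = (if j = b then l (b + 1) else \<zero>\<^bsub>L\<^esub>)" for j
    using x[of j] y l[of "b + 1"] ab by (auto simp: h_def vC_add S_B S_C vC_B v_zero)
  have "h \<in> HH {a..b}" using x y by (auto simp: h_def HH_def S_I S_B S_zero)
  moreover have "val j h = l j" if j: "j \<in> {a..b+1}" for j
  proof (cases "j = b + 1")
    case True
    then show ?thesis using hC[of b] l[of "b + 1"] v_zero ab by (simp add: val_def h_def)
  next
    case False
    then show ?thesis using j hB[of j] hC[of "j - 1"] l[of j] by (simp add: val_def)
  qed
  ultimately show ?thesis by (rule that)
qed

end

section \<open>Decompositions of Kronecker-like sections\<close>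

declare int_functions_simps [simp del]

text \<open>\<open>V / Z\<close> is the direct sum of \<open>V1 / Z\<close> and
  \<open>V2 / Z\<close>. The window \<open>{c..d}\<close> is where \<open>V\<close> has its top. The
  index set \<open>I\<close> may be larger: there \<open>V\<close> can have further entries, but
  only with values in \<open>P'\<close>.\<close>

locale decomposition = kronecker_data +
  fixes V Z V1 V2 :: "(int \<Rightarrow> 'a) set" and I J :: "int set" and c d :: int
  assumes V: "submodule V A F" and V1: "submodule V1 A F" and V2: "submodule V2 A F"
    and sum: "V1 <+>\<^bsub>F\<^esub> V2 = V" and int: "V1 \<inter> V2 = Z"
    and V_PP: "V \<subseteq> PP I" and PP_V: "PP {c..d} \<subseteq> V"
    and outside: "\<lbrakk>v \<in> V; i \<notin> {c..d}\<rbrakk> \<Longrightarrow> v i \<in> P'"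
    and Z_HH: "Z \<inter> HH I = KK I J"
    and cd: "c \<le> d"
begin

lemma Z: "submodule Z A F"
  using F.submod_Int[OF V1 V2] int by simp

lemma V1_V: "V1 \<subseteq> V" using F.submod_add_upper1[OF V1 V2] sum by simp

lemma V2_V: "V2 \<subseteq> V" using F.submod_add_upper2[OF V1 V2] sum by simp

lemma Z_V: "Z \<subseteq> V" "Z \<subseteq> V1" "Z \<subseteq> V2" using V1_V int by auto

text \<open>The setting is symmetric in the two summands, so each claim about \<open>V2\<close> is
  also available for \<open>V1\<close>.\<close>

lemma swap: "decomposition A B C L e vB vC V Z V2 V1 I J c d"
proof (rule decomposition.intro[OF kronecker_data_axioms[unfolded S_def P_def P'_def]], rule decomposition_axioms.intro, unfold P_def[symmetric], unfold P'_def[symmetric])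
  show "V2 <+>\<^bsub>F\<^esub> V1 = V"
    using F.set_add_comm[OF F.submodD(1)[OF V1] F.submodD(1)[OF V2]] sum by simp
qed (use V V1 V2 int V_PP PP_V outside Z_HH cd in auto)

lemma V_carrier: "v \<in> V \<Longrightarrow> v \<in> carrier F"
  using F.submodD(3)[OF V] .

lemma split: assumes "v \<in> V" obtains v1 v2 where "v1 \<in> V1" "v2 \<in> V2" "v = v1 \<oplus>\<^bsub>F\<^esub> v2"
  using assms unfolding sum[symmetric] F.mem_set_add by blast

lemma HH_I: "HH {c..d} \<subseteq> HH I"
  using HH_PP[of "{c..d}"] PP_V V_PP HH_Int_PP[of "{c..d}" I] by blast

lemma BC_carrier: "t \<in> B \<union> C \<Longrightarrow> t \<in> carrier A"
  using B.Icarr C.Icarr by blast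

lemma smult_HH: "t \<in> B \<union> C \<Longrightarrow> v \<in> V \<Longrightarrow> t \<odot>\<^bsub>F\<^esub> v \<in> HH I"
  using B_smult_PP(1) C_smult_PP(1) V_PP by blast

lemma Z_I: "h \<in> HH I \<Longrightarrow> (\<And>j. j \<in> J \<Longrightarrow> val j h = \<zero>\<^bsub>L\<^esub>) \<Longrightarrow> h \<in> Z"
  using Z_HH unfolding KK_def by blast

lemma Z_D: "h \<in> HH I \<Longrightarrow> h \<in> Z \<Longrightarrow> j \<in> J \<Longrightarrow> val j h = \<zero>\<^bsub>L\<^esub>"
  using Z_HH unfolding KK_def by blast

definition K where "K = V \<inter> RR"

lemma K: "submodule K A F" unfolding K_def by (rule F.submod_Int[OF V RR_submodule])

lemma smult_K: "t \<in> B \<union> C \<Longrightarrow> v \<in> K \<Longrightarrow> t \<odot>\<^bsub>F\<^esub> v \<in> Z"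
proof (rule Z_I)
  assume t: "t \<in> B \<union> C" and v: "v \<in> K"
  then show "t \<odot>\<^bsub>F\<^esub> v \<in> HH I" using smult_HH by (auto simp: K_def)
  fix j show "val j (t \<odot>\<^bsub>F\<^esub> v) = \<zero>\<^bsub>L\<^esub>"
    by (rule val_smult_RR[OF t]) (use v V_PP in \<open>auto simp: K_def RR_def\<close>)
qed

text \<open>Linearity of the projection onto \<open>V2 / Z\<close>: if \<open>t\<close> sends the
  sum into \<open>V1\<close>, then \<open>t v2\<close> lies in both summands.\<close>

lemma smult_component:
  assumes t: "t \<in> carrier A" and v: "v1 \<in> V1" "v2 \<in> V2" and tv: "t \<odot>\<^bsub>F\<^esub> (v1 \<oplus>\<^bsub>F\<^esub> v2) \<in> V1"
  shows "t \<odot>\<^bsub>F\<^esub> v2 \<in> Z"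
proof -
  have c: "v1 \<in> carrier F" "v2 \<in> carrier F" using v V1_V V2_V V_carrier by auto
  have "t \<odot>\<^bsub>F\<^esub> v1 \<oplus>\<^bsub>F\<^esub> t \<odot>\<^bsub>F\<^esub> v2 \<in> V1" using tv t c by (simp add: F.smult_r_distr)
  moreover have "t \<odot>\<^bsub>F\<^esub> v1 \<in> V1" using F.submodD(7)[OF V1] t v by blast
  ultimately have "t \<odot>\<^bsub>F\<^esub> v2 \<in> V1"
    using F.submod_cancel_left[OF V1] F.smult_closed t c by blast
  moreover have "t \<odot>\<^bsub>F\<^esub> v2 \<in> V2" using F.submodD(7)[OF V2] t v by blast
  ultimately show ?thesis using int by blast
qed

end

subsection \<open>Surjective arrows\<close>

text \<open>With \<open>J = {c+1..d}\<close> or \<open>J = {c+1..d+1}\<close> the subquotient \<open>V / Z\<close> looks like a preinjective or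
  regular Kronecker module: the elements killed by \<open>B\<close> form a simple section \<open>KB / K\<close>, which must
  come from one summand, and walking along the relations \<open>b w(i+1) = c w(i)\<close> shows that this
  summand exhausts the top.\<close>

locale surjective_decomposition = decomposition +
  assumes J1: "{c+1..d} \<subseteq> J" and J2: "J \<subseteq> {c+1..d+1}" and J3: "c < d \<or> d + 1 \<in> J"
begin

lemma swap': "surjective_decomposition A B C L e vB vC V Z V2 V1 I J c d"
  by (intro surjective_decomposition.intro surjective_decomposition_axioms.intro swap J1 J2 J3)

text \<open>Here the size of \<open>J\<close> matters. Every \<open>i\<close> in
  \<open>{c..d}\<close> is seen by a coordinate in \<open>J\<close>, either at \<open>i\<close>
  through \<open>B\<close> or at \<open>i + 1\<close> through \<open>C\<close>.\<close>

lemma K_I: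
  assumes v: "v \<in> V" and tv: "\<And>t. t \<in> B \<union> C \<Longrightarrow> t \<odot>\<^bsub>F\<^esub> v \<in> Z"
  shows "v \<in> K"
proof -
  have vP: "v \<in> PP I" using v V_PP by auto
  have "v j \<in> P'" if "j \<in> J" for j
  proof (rule P'_I_B[OF PP_PD[OF vP]])
    fix x assume x: "x \<in> B"
    then show "vB (x \<otimes> v j) = \<zero>\<^bsub>L\<^esub>"
      using Z_D[OF B_smult_PP(1)[OF x vP] tv that] B_smult_PP(2)[OF x vP] by simp
  qed
  moreover have "v (j - 1) \<in> P'" if "j \<in> J" for j
  proof (rule P'_I_C[OF PP_PD[OF vP]])
    fix y assume y: "y \<in> C"
    then show "vC (y \<otimes> v (j - 1)) = \<zero>\<^bsub>L\<^esub>"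
      using Z_D[OF C_smult_PP(1)[OF y vP] tv that] C_smult_PP(2)[OF y vP] by simp
  qed
  moreover have "i \<in> J \<or> i + 1 \<in> J" if "i \<in> {c..d}" for i
  proof (cases "i < d")
    case True
    then have "i + 1 \<in> {c+1..d}" using that by auto
    then show ?thesis using J1 by blast
  next
    case False
    then have "i = d" using that by simp
    then show ?thesis using J1 J3 by auto
  qed
  ultimately have "v i \<in> P'" for i
    using outside[OF v] by (metis add_diff_cancel_right')
  then show ?thesis using v by (auto simp: K_def RR_def)
qed

text \<open>A nontrivial entry at \<open>c\<close> is invisible to \<open>B\<close>, since the
  coordinate \<open>c\<close> is not in \<open>J\<close>, and no other entry is. So
  \<open>KB / K\<close> is the kernel of \<open>B\<close> on the top of \<open>V\<close>.\<close>

definition KB where "KB = V \<inter> {v. \<forall>i. i \<noteq> c \<longrightarrow> v i \<in> P'}"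

lemma KB_I:
  assumes v: "v \<in> V" and tv: "\<And>x. x \<in> B \<Longrightarrow> x \<odot>\<^bsub>F\<^esub> v \<in> Z"
  shows "v \<in> KB"
proof -
  have vP: "v \<in> PP I" using v V_PP by auto
  have "v j \<in> P'" if "j \<in> J" for j
  proof (rule P'_I_B[OF PP_PD[OF vP]])
    fix x assume x: "x \<in> B"
    then show "vB (x \<otimes> v j) = \<zero>\<^bsub>L\<^esub>"
      using Z_D[OF B_smult_PP(1)[OF x vP] tv that] B_smult_PP(2)[OF x vP] by simp
  qed
  moreover have "i \<in> J" if "i \<in> {c..d}" "i \<noteq> c" for i
    using J1 that by auto
  ultimately show ?thesis using outside[OF v] v unfolding KB_def by blast
qed

lemma Z_K: "Z \<subseteq> K"
proof
  fix z assume z: "z \<in> Z"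
  show "z \<in> K"
    by (rule K_I) (use z Z_V F.submodD(7)[OF Z] BC_carrier in auto)
qed

text \<open>Projection to \<open>V2\<close> commutes with \<open>B\<close> and \<open>C\<close>, so
  the component of an element that both of them kill modulo \<open>Z\<close> is killed as
  well.\<close>

lemma K_split: assumes "k \<in> K" obtains k1 k2 where "k1 \<in> V1" "k2 \<in> V2" "k2 \<in> K" "k = k1 \<oplus>\<^bsub>F\<^esub> k2"
proof -
  obtain k1 k2 where k: "k1 \<in> V1" "k2 \<in> V2" "k = k1 \<oplus>\<^bsub>F\<^esub> k2" using split assms unfolding K_def by blast
  have "t \<odot>\<^bsub>F\<^esub> k2 \<in> Z" if t: "t \<in> B \<union> C" for t
    using smult_component[OF BC_carrier[OF t] k(1,2)] smult_K[OF t assms] k(3) Z_V by auto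
  then have "k2 \<in> K" using K_I k V2_V by blast
  with k show ?thesis using that by blast
qed

text \<open>Modulo \<open>K\<close> an element of \<open>KB\<close> is determined by its entry at
  \<open>c\<close> modulo \<open>P'\<close>, and an entry outside \<open>P'\<close> generates
  \<open>P\<close> by locality.\<close>

lemma KB_simple: "KB \<inter> V1 \<subseteq> K \<or> KB \<inter> V2 \<subseteq> K"
proof (rule F.simple_section_split[OF V1 V2 K])
  show "KB \<subseteq> carrier F" using V_carrier by (auto simp: KB_def)
  show "V1 \<inter> V2 \<subseteq> K" using Z_K int by simp
  show "\<And>k. k \<in> K \<Longrightarrow> \<exists>k1\<in>V1. \<exists>k2\<in>V2 \<inter> K. k = k1 \<oplus>\<^bsub>F\<^esub> k2" using K_split by (metis IntI)
next
  fix b b' assume b: "b \<in> KB - K" and b': "b' \<in> KB"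
  have bV: "b \<in> V" "b' \<in> V" using b b' by (auto simp: KB_def)
  have "b c \<notin> P'" using b by (auto simp: KB_def K_def RR_def)
  moreover have "b c \<in> P" "b' c \<in> P" using PP_PD bV V_PP by blast+
  ultimately obtain a where a: "a \<in> carrier A" "b' c = a \<otimes> b c" using P_local by blast
  have abV: "a \<odot>\<^bsub>F\<^esub> b \<in> V" using F.submodD(7)[OF V] a bV by blast
  have "(b' \<ominus>\<^bsub>F\<^esub> a \<odot>\<^bsub>F\<^esub> b) i \<in> P'" for i
  proof -
    have e: "(b' \<ominus>\<^bsub>F\<^esub> a \<odot>\<^bsub>F\<^esub> b) i = b' i \<ominus> a \<otimes> b i"
      using F_minus[OF V_carrier[OF bV(2)] V_carrier[OF abV]] by (simp add: int_functions_simps)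
    show ?thesis
    proof (cases "i = c")
      case True
      have "b' c \<in> carrier A" using bV V_carrier by (auto simp: int_functions_simps)
      moreover have "a \<otimes> b i = b' i" using True a(2) by simp
      ultimately show ?thesis unfolding e using True P'_zero by (simp add: a_minus_def r_neg)
    next
      case False
      then show ?thesis unfolding e using b b' a by (auto simp: KB_def intro!: P'_minus P'_smult)
    qed
  qed
  moreover have "b' \<ominus>\<^bsub>F\<^esub> a \<odot>\<^bsub>F\<^esub> b \<in> V" using F.submodD(6)[OF V] bV abV by blast
  ultimately show "\<exists>a\<in>carrier A. b' \<ominus>\<^bsub>F\<^esub> a \<odot>\<^bsub>F\<^esub> b \<in> K" using a by (auto simp: K_def RR_def)
qed

lemma V2_RR:
  assumes KB: "KB \<inter> V2 \<subseteq> K"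
  shows "V2 \<subseteq> RR"
proof -
  let ?G = "V1 <+>\<^bsub>F\<^esub> K"
  have G: "submodule ?G A F" by (rule F.submod_add[OF V1 K])
  \<comment> \<open>If \<open>B\<close> sends \<open>m\<close> into \<open>V1\<close>, then
    \<open>B\<close> kills the \<open>V2\<close>-component of \<open>m\<close> modulo
    \<open>Z\<close>; by assumption such a component lies in \<open>K\<close>.\<close>
  have GI: "m \<in> ?G" if m: "m \<in> V" "\<And>x. x \<in> B \<Longrightarrow> x \<odot>\<^bsub>F\<^esub> m \<in> V1" for m
  proof -
    obtain m1 m2 where m12: "m1 \<in> V1" "m2 \<in> V2" "m = m1 \<oplus>\<^bsub>F\<^esub> m2" using split m by blast
    have "x \<odot>\<^bsub>F\<^esub> m2 \<in> Z" if x: "x \<in> B" for x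
      using smult_component[OF _ m12(1,2)] m(2)[OF x] m12(3) BC_carrier x by auto
    then have "m2 \<in> K" using KB KB_I m12 V2_V by blast
    then show ?thesis using m12 unfolding F.mem_set_add by blast
  qed
  have single: "single A i q \<in> PP {c..d}" "single A i q \<in> V" if "i \<in> {c..d}" "q \<in> P" for i q
    using single_PP[of q i "{c..d}"] that PP_V by auto
  have valB: "val j (x \<odot>\<^bsub>F\<^esub> single A i q) = (if j = i then vB (x \<otimes> q) else \<zero>\<^bsub>L\<^esub>)"
    if "i \<in> {c..d}" "q \<in> P" "x \<in> B" for i q x j
    using B_smult_PP(2)[OF that(3) single(1)[OF that(1,2)]] B.Icarr that by (auto simp: single_def v_zero)
  have valC: "val j (y \<odot>\<^bsub>F\<^esub> single A i q) = (if j = i + 1 then vC (y \<otimes> q) else \<zero>\<^bsub>L\<^esub>)"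
    if "i \<in> {c..d}" "q \<in> P" "y \<in> C" for i q y j
    using C_smult_PP(2)[OF that(3) single(1)[OF that(1,2)]] C.Icarr that by (auto simp: single_def v_zero)
  \<comment> \<open>\<open>B\<close> kills the first generator modulo \<open>Z\<close>, because
    \<open>c\<close> is not in \<open>J\<close>.\<close>
  have base: "single A c q \<in> ?G" if q: "q \<in> P" for q
  proof (rule GI)
    have c: "c \<in> {c..d}" using cd by simp
    show "single A c q \<in> V" using single[OF c q] by simp
    fix x assume x: "x \<in> B"
    have "x \<odot>\<^bsub>F\<^esub> single A c q \<in> Z"
    proof (rule Z_I)
      show "x \<odot>\<^bsub>F\<^esub> single A c q \<in> HH I" using smult_HH single(2)[OF c q] x by blast
      show "\<And>j. j \<in> J \<Longrightarrow> val j (x \<odot>\<^bsub>F\<^esub> single A c q) = \<zero>\<^bsub>L\<^esub>" using valB[OF c q x] J2 by auto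
    qed
    then show "x \<odot>\<^bsub>F\<^esub> single A c q \<in> V1" using Z_V by blast
  qed
  \<comment> \<open>Modulo \<open>Z\<close>, the action of \<open>B\<close> on generator
    \<open>i + 1\<close> agrees with that of \<open>C\<close> on generator \<open>i\<close>. The
    latter ends in \<open>V1\<close>, since \<open>C\<close> kills \<open>K\<close> modulo
    \<open>Z\<close>.\<close>
  have step: "single A (i + 1) q \<in> ?G"
    if i: "c \<le> i" "i < d" and IH: "\<And>q. q \<in> P \<Longrightarrow> single A i q \<in> ?G" and q: "q \<in> P" for i q
  proof (rule GI)
    have i': "i \<in> {c..d}" "i + 1 \<in> {c..d}" using i by auto
    show "single A (i + 1) q \<in> V" using single[OF i'(2) q] by simp
    fix x assume x: "x \<in> B"
    then obtain y where y: "y \<in> C" "vC (y \<otimes> q) = vB (x \<otimes> q)" using balance_B q by blast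
    let ?m = "x \<odot>\<^bsub>F\<^esub> single A (i + 1) q" and ?n = "y \<odot>\<^bsub>F\<^esub> single A i q"
    have mn: "?m \<in> HH I" "?n \<in> HH I" using smult_HH single(2)[OF i'(1) q] single(2)[OF i'(2) q] x y by auto
    have "?m \<ominus>\<^bsub>F\<^esub> ?n \<in> Z"
    proof (rule Z_I)
      show "?m \<ominus>\<^bsub>F\<^esub> ?n \<in> HH I" using F.submodD(6)[OF HH_submodule] mn by blast
      fix j
      have "val j ?m = val j ?n" using valB[OF i'(2) q x] valC[OF i'(1) q y(1)] y(2) by auto
      then show "val j (?m \<ominus>\<^bsub>F\<^esub> ?n) = \<zero>\<^bsub>L\<^esub>"
        unfolding val_minus[OF mn] using val_closed[OF mn(2)] by (simp add: a_minus_def L.M.r_neg)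
    qed
    then have mnV: "?m \<ominus>\<^bsub>F\<^esub> ?n \<in> V1" using Z_V by blast
    obtain v k where vk: "v \<in> V1" "k \<in> K" "single A i q = v \<oplus>\<^bsub>F\<^esub> k" using IH[OF q] unfolding F.mem_set_add by blast
    have yA: "y \<in> carrier A" using C.Icarr y by blast
    have "?n = y \<odot>\<^bsub>F\<^esub> v \<oplus>\<^bsub>F\<^esub> y \<odot>\<^bsub>F\<^esub> k"
      unfolding vk(3) using vk yA V_carrier V1_V F.submodD(3)[OF K] by (intro F.smult_r_distr) auto
    moreover have "y \<odot>\<^bsub>F\<^esub> v \<in> V1" using F.submodD(7)[OF V1] yA vk by blast
    moreover have "y \<odot>\<^bsub>F\<^esub> k \<in> V1" using smult_K y vk Z_V by blast
    ultimately have "?n \<in> V1" using F.submodD(4)[OF V1] by simp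
    then show "?m \<in> V1" using F.submod_diff_cancel[OF V1 _ HH_carrier[OF mn(1)] mnV] by blast
  qed
  have all: "single A i q \<in> ?G" if "q \<in> P" "c \<le> i" "i \<le> d" for i q
    using that(2,1,3)
  proof (induction i arbitrary: q rule: int_ge_induct)
    case base
    then show ?case using \<open>\<And>q. q \<in> P \<Longrightarrow> single A c q \<in> ?G\<close> by blast
  next
    case (step i)
    show ?case by (rule \<open>\<And>i q. c \<le> i \<Longrightarrow> i < d \<Longrightarrow> (\<And>q. q \<in> P \<Longrightarrow> single A i q \<in> ?G) \<Longrightarrow> q \<in> P \<Longrightarrow> single A (i + 1) q \<in> ?G\<close>) (use step in auto)
  qed
  have KG: "K \<subseteq> ?G" by (rule F.submod_add_upper2[OF V1 K])
  have VG: "V \<subseteq> ?G"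
  proof
    fix v assume v: "v \<in> V"
    let ?r = "restr {c..d} v"
    have r: "?r \<in> PP {c..d}" using restr_PP v V_PP by blast
    have rV: "?r \<in> V" using r PP_V by blast
    have "?r \<in> ?G"
      by (rule submodule_of_singles[OF G, of "{c..d}"])
        (use PP_carrier[OF r] all PP_PD[of v I] v V_PP in \<open>auto simp: restr_def\<close>)
    moreover have "v \<ominus>\<^bsub>F\<^esub> ?r \<in> K"
    proof -
      have "(v \<ominus>\<^bsub>F\<^esub> ?r) i \<in> P'" for i
      proof -
        have "v i \<in> carrier A" using V_carrier[OF v] by (simp add: int_functions_simps)
        then show ?thesis
          unfolding F_minus[OF V_carrier[OF v] PP_carrier[OF r]]
          using outside[OF v, of i] P'_zero by (auto simp: restr_def a_minus_def r_neg)
      qed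
      then show ?thesis using F.submodD(6)[OF V v rV] by (auto simp: K_def RR_def)
    qed
    ultimately show "v \<in> ?G"
      using F.submod_diff_cancel[OF G _ V_carrier[OF v]] KG by blast
  qed
  \<comment> \<open>Now \<open>V = V1 + K\<close>. Removing the \<open>V2\<close>-component of the
    \<open>K\<close>-part from an element of \<open>V2\<close> leaves an element of
    \<open>V1 \<inter> V2\<close>, which is contained in \<open>K\<close>.\<close>
  have "V2 \<subseteq> K"
  proof
    fix v assume v: "v \<in> V2"
    then obtain v1 k where vk: "v1 \<in> V1" "k \<in> K" "v = v1 \<oplus>\<^bsub>F\<^esub> k" using VG V2_V unfolding F.mem_set_add subset_iff by blast
    obtain k1 k2 where k: "k1 \<in> V1" "k2 \<in> V2" "k2 \<in> K" "k = k1 \<oplus>\<^bsub>F\<^esub> k2" using K_split vk by blast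
    have c: "v1 \<in> carrier F" "k1 \<in> carrier F" "k2 \<in> carrier F" using vk k V1_V V2_V V_carrier by auto
    have "v \<ominus>\<^bsub>F\<^esub> k2 = v1 \<oplus>\<^bsub>F\<^esub> k1" unfolding vk(3) k(4) using c by algebra
    moreover have "v \<ominus>\<^bsub>F\<^esub> k2 \<in> V2" using F.submodD(6)[OF V2] v k by blast
    moreover have "v1 \<oplus>\<^bsub>F\<^esub> k1 \<in> V1" using F.submodD(4)[OF V1] vk k by blast
    ultimately have "v \<ominus>\<^bsub>F\<^esub> k2 \<in> K" using Z_K int by auto
    then show "v \<in> K" using F.submod_diff_cancel[OF K k(3)] v V2_V V_carrier by blast
  qed
  then show ?thesis by (auto simp: K_def)
qed

lemma summand_in_RR: "V1 \<subseteq> RR \<or> V2 \<subseteq> RR"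
proof -
  interpret sw: surjective_decomposition A B C L e vB vC S P P' V Z V2 V1 I J c d
    by (rule swap') (rule S_def P_def P'_def)+
  show ?thesis using KB_simple V2_RR sw.V2_RR unfolding KB_def K_def sw.KB_def sw.K_def by blast
qed

end

subsection \<open>Injective arrows\<close>

text \<open>For \<open>J = {c..d+1}\<close> the argument is dual: the quotient of the socle part by the image \<open>SS d\<close> of
  \<open>B\<close> is a simple section, and the summand that does not meet it is shown to have trivial top.\<close>

locale injective_decomposition = decomposition +
  assumes J: "J = {c..d+1}"
begin

lemma swap': "injective_decomposition A B C L e vB vC V Z V2 V1 I J c d"
  by (intro injective_decomposition.intro injective_decomposition_axioms.intro swap J)

text \<open>A filtration of the socle part by the last coordinate that may be nonzero.
  \<open>SS d\<close> loses only the coordinate \<open>d + 1\<close>, the one that \<open>B\<close>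
  cannot reach.\<close>

definition SS :: "int \<Rightarrow> (int \<Rightarrow> 'a) set" where
  "SS j = {h \<in> HH {c..d}. \<forall>i\<in>J. j < i \<longrightarrow> val i h = \<zero>\<^bsub>L\<^esub>} <+>\<^bsub>F\<^esub> Z"

definition SOC :: "(int \<Rightarrow> 'a) set" where
  "SOC = HH {c..d} <+>\<^bsub>F\<^esub> Z"

lemma SS_submodule: "submodule (SS j) A F"
proof -
  have "{h \<in> HH {c..d}. \<forall>i\<in>J. j < i \<longrightarrow> val i h = \<zero>\<^bsub>L\<^esub>} = KK {c..d} {i \<in> J. j < i}"
    by (auto simp: KK_def)
  then show ?thesis unfolding SS_def using F.submod_add[OF KK_submodule Z] by simp
qed

lemma SOC_submodule: "submodule SOC A F"
  unfolding SOC_def by (rule F.submod_add[OF HH_submodule Z])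

lemma SS_I: "h \<in> HH {c..d} \<Longrightarrow> (\<And>i. i \<in> J \<Longrightarrow> j < i \<Longrightarrow> val i h = \<zero>\<^bsub>L\<^esub>) \<Longrightarrow> z \<in> Z \<Longrightarrow> h \<oplus>\<^bsub>F\<^esub> z \<in> SS j"
  unfolding SS_def F.mem_set_add by blast

lemma SS_E:
  assumes "v \<in> SS j"
  obtains h z where "h \<in> HH {c..d}" "\<And>i. i \<in> J \<Longrightarrow> j < i \<Longrightarrow> val i h = \<zero>\<^bsub>L\<^esub>" "z \<in> Z" "v = h \<oplus>\<^bsub>F\<^esub> z"
  using assms unfolding SS_def F.mem_set_add by blast

lemma Z_SS: "Z \<subseteq> SS j"
proof -
  have "{h \<in> HH {c..d}. \<forall>i\<in>J. j < i \<longrightarrow> val i h = \<zero>\<^bsub>L\<^esub>} = KK {c..d} {i \<in> J. j < i}"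
    by (auto simp: KK_def)
  then show ?thesis unfolding SS_def using F.submod_add_upper2[OF KK_submodule Z] by simp
qed

lemma SOC_carrier: "SOC \<subseteq> carrier F" using F.submodD(1)[OF SOC_submodule] .

lemma val_SS:
  assumes "h \<in> HH {c..d}" "z \<in> Z" "h \<oplus>\<^bsub>F\<^esub> z \<in> SS j" "i \<in> J" "j < i"
  shows "val i h = \<zero>\<^bsub>L\<^esub>"
proof -
  obtain h' z' where h': "h' \<in> HH {c..d}" "val i h' = \<zero>\<^bsub>L\<^esub>" "z' \<in> Z" "h \<oplus>\<^bsub>F\<^esub> z = h' \<oplus>\<^bsub>F\<^esub> z'"
    using SS_E[OF assms(3)] assms(4,5) by metis
  have car: "h \<in> carrier F" "h' \<in> carrier F" "z \<in> carrier F" "z' \<in> carrier F"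
    using assms h' HH_carrier Z_V V_carrier by auto
  have "h \<ominus>\<^bsub>F\<^esub> h' = (h \<oplus>\<^bsub>F\<^esub> z) \<ominus>\<^bsub>F\<^esub> h' \<ominus>\<^bsub>F\<^esub> z" using car by algebra
  also have "\<dots> = z' \<ominus>\<^bsub>F\<^esub> z" unfolding h'(4) using car by algebra
  finally have "h \<ominus>\<^bsub>F\<^esub> h' \<in> Z" using F.submodD(6)[OF Z] assms h' by simp
  moreover have "h \<ominus>\<^bsub>F\<^esub> h' \<in> HH I" using F.submodD(6)[OF HH_submodule] assms(1) h'(1) HH_I by blast
  ultimately have "val i (h \<ominus>\<^bsub>F\<^esub> h') = \<zero>\<^bsub>L\<^esub>" using Z_D assms(4) by blast
  then have "val i h \<ominus>\<^bsub>L\<^esub> val i h' = \<zero>\<^bsub>L\<^esub>" using val_minus[OF assms(1) h'(1)] by simp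
  moreover have "\<ominus>\<^bsub>L\<^esub> \<zero>\<^bsub>L\<^esub> = \<zero>\<^bsub>L\<^esub>" by (rule L.M.minus_equality) auto
  ultimately show ?thesis using val_closed[OF assms(1)] h'(2) by (simp add: a_minus_def)
qed

text \<open>Outside the window the entries of \<open>v\<close> lie in \<open>P'\<close>, where
  neither arrow is visible. Cutting \<open>t v\<close> down to the window therefore changes it only
  by an element of \<open>Z\<close>.\<close>

lemma smult_SOC:
  assumes t: "t \<in> B \<union> C" and v: "v \<in> V"
  obtains r z where "r \<in> HH {c..d}" "z \<in> Z" "t \<odot>\<^bsub>F\<^esub> v = r \<oplus>\<^bsub>F\<^esub> z" "\<And>i. val i r = val i (t \<odot>\<^bsub>F\<^esub> v)"
proof -
  let ?u = "t \<odot>\<^bsub>F\<^esub> v" and ?r = "restr {c..d} (t \<odot>\<^bsub>F\<^esub> v)"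
  have u: "?u \<in> HH I" by (rule smult_HH[OF t v])
  have r: "?r \<in> HH {c..d}" by (rule restr_HH[OF u])
  have ui: "?u i = t \<otimes> v i" for i by (simp add: int_functions_simps)
  have vP: "v \<in> PP I" using v V_PP by auto
  have out: "vB (?u i) = \<zero>\<^bsub>L\<^esub> \<and> vC (?u i) = \<zero>\<^bsub>L\<^esub>" if "i \<notin> {c..d}" for i
    unfolding ui using t outside[OF v that] P'_B P'_C P'_P B_P(2) C_P(2) by auto
  have "vB (?r i) = vB (?u i) \<and> vC (?r i) = vC (?u i)" for i
    using out[of i] v_zero by (auto simp: restr_def)
  then have val: "val i ?r = val i ?u" for i by (simp add: val_def)
  have "?u \<ominus>\<^bsub>F\<^esub> ?r \<in> Z"
  proof (rule Z_I)
    have rI: "?r \<in> HH I" using r HH_I by blast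
    show "?u \<ominus>\<^bsub>F\<^esub> ?r \<in> HH I" using F.submodD(6)[OF HH_submodule u rI] .
    show "val j (?u \<ominus>\<^bsub>F\<^esub> ?r) = \<zero>\<^bsub>L\<^esub>" for j
      unfolding val_minus[OF u rI] val using val_closed[OF u] by (simp add: a_minus_def L.M.r_neg)
  qed
  moreover have "?u = ?r \<oplus>\<^bsub>F\<^esub> (?u \<ominus>\<^bsub>F\<^esub> ?r)" using HH_carrier[OF u] HH_carrier[OF r] by algebra
  ultimately show ?thesis using that r val by blast
qed

text \<open>Modulo \<open>Z\<close> an element of \<open>SS d\<close> is a sum of
  \<open>B\<close>-multiples of generators. Splitting the generators splits it, and the
  \<open>V2\<close>-parts fall into \<open>SS j\<close> because \<open>V2\<close> has no top beyond
  \<open>j\<close>.\<close>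

lemma SS_generated:
  assumes D: "\<forall>v\<in>V2. \<forall>i\<in>{c..d}. j < i \<longrightarrow> v i \<in> P'"
  shows "SS d \<subseteq> V1 <+>\<^bsub>F\<^esub> (V2 \<inter> SS j)"
proof
  let ?G = "V1 <+>\<^bsub>F\<^esub> (V2 \<inter> SS j)"
  have V2S: "submodule (V2 \<inter> SS j) A F" by (rule F.submod_Int[OF V2 SS_submodule])
  have G: "submodule ?G A F" by (rule F.submod_add[OF V1 V2S])
  have V1G: "V1 \<subseteq> ?G" by (rule F.submod_add_upper1[OF V1 V2S])
  fix v assume "v \<in> SS d"
  then obtain h z where h: "h \<in> HH {c..d}" "val (d + 1) h = \<zero>\<^bsub>L\<^esub>" "z \<in> Z" "v = h \<oplus>\<^bsub>F\<^esub> z"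
    using SS_E[of v d] J cd by (metis atLeastAtMost_iff less_add_one order_refl zle_add1_eq_le linorder_not_le order_less_imp_le)
  have "\<forall>i. \<exists>x. x \<in> B \<and> vB (x \<otimes> e) = val i h" using vB_surj val_closed[OF h(1)] by blast
  then obtain x where x: "\<And>i. x i \<in> B" "\<And>i. vB (x i \<otimes> e) = val i h" by metis
  \<comment> \<open>\<open>g\<close> has the same coordinates as \<open>h\<close> but uses
    \<open>B\<close> only, which is possible because the coordinate \<open>d + 1\<close> of
    \<open>h\<close> vanishes.\<close>
  define g where "g = (\<lambda>i. if i \<in> {c..d} then x i \<otimes> e else \<zero>)"
  have gH: "g \<in> HH {c..d}" using x by (auto simp: g_def HH_def S_B S_zero)
  have gC: "vC (g i) = \<zero>\<^bsub>L\<^esub>" for i using x by (simp add: g_def vC_B v_zero)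
  have gv: "val i g = val i h" if "i \<in> J" for i
  proof (cases "i = d + 1")
    case True
    have "g (d + 1) = \<zero>" by (simp add: g_def)
    then have "val (d + 1) g = \<zero>\<^bsub>L\<^esub>" using gC[of d] v_zero by (simp add: val_def)
    then show ?thesis using True h(2) by simp
  next
    case False
    then have "i \<in> {c..d}" using that J by auto
    then show ?thesis using gC x(2) val_closed[OF h(1)] by (simp add: val_def[of i g]) (simp add: g_def)
  qed
  have "g \<in> ?G"
  proof (rule submodule_of_singles[OF G, of "{c..d}"])
    show "g \<in> carrier F" by (rule HH_carrier[OF gH])
    show "\<And>i. i \<notin> {c..d} \<Longrightarrow> g i = \<zero>" unfolding g_def by auto
    fix i assume i: "i \<in> {c..d}"
    have sV: "single A i e \<in> V" using single_PP[OF e_P i] PP_V by blast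
    obtain v1 v2 where v12: "v1 \<in> V1" "v2 \<in> V2" "single A i e = v1 \<oplus>\<^bsub>F\<^esub> v2" using split[OF sV] by blast
    have xA: "x i \<in> carrier A" using x B.Icarr by blast
    have "single A i (g i) = x i \<odot>\<^bsub>F\<^esub> single A i e"
      using i by (simp add: smult_single[OF xA] g_def)
    also have "\<dots> = x i \<odot>\<^bsub>F\<^esub> v1 \<oplus>\<^bsub>F\<^esub> x i \<odot>\<^bsub>F\<^esub> v2"
      unfolding v12(3) using v12 xA V1_V V2_V V_carrier by (intro F.smult_r_distr) auto
    finally have s: "single A i (g i) = x i \<odot>\<^bsub>F\<^esub> v1 \<oplus>\<^bsub>F\<^esub> x i \<odot>\<^bsub>F\<^esub> v2" .
    have xBC: "x i \<in> B \<union> C" using x by simp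
    have v2V: "v2 \<in> V" using v12 V2_V by blast
    obtain r z where r: "r \<in> HH {c..d}" "z \<in> Z" "x i \<odot>\<^bsub>F\<^esub> v2 = r \<oplus>\<^bsub>F\<^esub> z" "\<And>k. val k r = val k (x i \<odot>\<^bsub>F\<^esub> v2)"
      using smult_SOC[OF xBC v2V] by blast
    have "x i \<odot>\<^bsub>F\<^esub> v2 \<in> SS j"
      unfolding r(3)
    proof (rule SS_I[OF r(1) _ r(2)])
      fix k assume k: "k \<in> J" "j < k"
      have "v2 k \<in> P'" using D v12(2) outside[OF v2V] k by blast
      then show "val k r = \<zero>\<^bsub>L\<^esub>"
        unfolding r(4) using B_smult_PP(2)[of "x i" v2 I k] x V_PP v2V P'_B by auto
    qed
    moreover have "x i \<odot>\<^bsub>F\<^esub> v2 \<in> V2" using F.submodD(7)[OF V2] xA v12 by blast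
    moreover have "x i \<odot>\<^bsub>F\<^esub> v1 \<in> V1" using F.submodD(7)[OF V1] xA v12 by blast
    ultimately show "single A i (g i) \<in> ?G" unfolding s F.mem_set_add by blast
  qed simp
  moreover have "h \<ominus>\<^bsub>F\<^esub> g \<in> Z"
  proof (rule Z_I)
    show "h \<ominus>\<^bsub>F\<^esub> g \<in> HH I" using F.submodD(6)[OF HH_submodule h(1) gH] HH_I by blast
    show "\<And>j. j \<in> J \<Longrightarrow> val j (h \<ominus>\<^bsub>F\<^esub> g) = \<zero>\<^bsub>L\<^esub>"
      unfolding val_minus[OF h(1) gH] using gv val_closed[OF h(1)] by (simp add: a_minus_def L.M.r_neg)
  qed
  ultimately have "h \<in> ?G"
    using F.submod_diff_cancel[OF G _ HH_carrier[OF h(1)]] V1G Z_V by blast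
  then show "v \<in> ?G" unfolding h(4) using F.submodD(4)[OF G] h(3) Z_V V1G by blast
qed

text \<open>The section \<open>SOC / SS d\<close> is read off from the coordinate
  \<open>d + 1\<close>, whose values lie in the simple module \<open>L\<close>.\<close>

lemma SOC_simple: "SOC \<inter> V1 \<subseteq> SS d \<or> SOC \<inter> V2 \<subseteq> SS d"
proof (rule F.simple_section_split[OF V1 V2 SS_submodule SOC_carrier])
  show "V1 \<inter> V2 \<subseteq> SS d" using Z_SS int by simp
  have "SS d \<subseteq> V1 <+>\<^bsub>F\<^esub> (V2 \<inter> SS d)" by (rule SS_generated) auto
  then show "\<And>k. k \<in> SS d \<Longrightarrow> \<exists>k1\<in>V1. \<exists>k2\<in>V2 \<inter> SS d. k = k1 \<oplus>\<^bsub>F\<^esub> k2"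
    unfolding subset_iff F.mem_set_add by blast
next
  fix b b' assume "b \<in> SOC - SS d" "b' \<in> SOC"
  then obtain h z h' z' where h: "h \<in> HH {c..d}" "z \<in> Z" "b = h \<oplus>\<^bsub>F\<^esub> z" "b \<notin> SS d"
    and h': "h' \<in> HH {c..d}" "z' \<in> Z" "b' = h' \<oplus>\<^bsub>F\<^esub> z'"
    unfolding SOC_def by (auto simp: F.mem_set_add)
  have "val (d + 1) h \<noteq> \<zero>\<^bsub>L\<^esub>"
  proof
    assume 0: "val (d + 1) h = \<zero>\<^bsub>L\<^esub>"
    have "b \<in> SS d" unfolding h(3) by (rule SS_I[OF h(1) _ h(2)]) (use 0 J in \<open>auto simp: le_less\<close>)
    then show False using h by blast
  qed
  then obtain a where a: "a \<in> carrier A" "val (d + 1) h' = a \<odot>\<^bsub>L\<^esub> val (d + 1) h"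
    using L_simple val_closed[OF h(1)] val_closed[OF h'(1)] by metis
  have car: "h \<in> carrier F" "h' \<in> carrier F" "z \<in> carrier F" "z' \<in> carrier F"
    using h h' HH_carrier Z_V V_carrier by auto
  have ah: "a \<odot>\<^bsub>F\<^esub> h \<in> HH {c..d}" using F.submodD(7)[OF HH_submodule] a h by blast
  have az: "z' \<ominus>\<^bsub>F\<^esub> a \<odot>\<^bsub>F\<^esub> z \<in> Z" using F.submodD(6,7)[OF Z] a h h' by blast
  have "b' \<ominus>\<^bsub>F\<^esub> a \<odot>\<^bsub>F\<^esub> b = (h' \<ominus>\<^bsub>F\<^esub> a \<odot>\<^bsub>F\<^esub> h) \<oplus>\<^bsub>F\<^esub> (z' \<ominus>\<^bsub>F\<^esub> a \<odot>\<^bsub>F\<^esub> z)"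
    unfolding h(3) h'(3) using car a(1) by algebra
  also have "\<dots> \<in> SS d"
  proof (rule SS_I[OF _ _ az])
    show "h' \<ominus>\<^bsub>F\<^esub> a \<odot>\<^bsub>F\<^esub> h \<in> HH {c..d}" using F.submodD(6)[OF HH_submodule h'(1) ah] .
    fix i assume "i \<in> J" "d < i"
    then have i: "i = d + 1" using J by auto
    show "val i (h' \<ominus>\<^bsub>F\<^esub> a \<odot>\<^bsub>F\<^esub> h) = \<zero>\<^bsub>L\<^esub>"
      unfolding i val_minus[OF h'(1) ah] val_smult[OF a(1) h(1)] a(2)[symmetric]
      using val_closed[OF h'(1)] by (simp add: a_minus_def L.M.r_neg)
  qed
  finally show "\<exists>a\<in>carrier A. b' \<ominus>\<^bsub>F\<^esub> a \<odot>\<^bsub>F\<^esub> b \<in> SS d" using a by blast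
qed

lemma V2_RR:
  assumes SOC: "SOC \<inter> V2 \<subseteq> SS d"
  shows "V2 \<subseteq> RR"
proof -
  \<comment> \<open>Descending induction from the vacuous case \<open>j = d\<close>; at
    \<open>j = c - 1\<close> the top of \<open>V2\<close> is gone.\<close>
  have D: "\<forall>v\<in>V2. \<forall>i\<in>{c..d}. j < i \<longrightarrow> v i \<in> P'" if "c - 1 \<le> j" "j \<le> d" for j
    using that(2,1)
  proof (induction j rule: int_le_induct)
    case base
    then show ?case by auto
  next
    case (step j)
    then have D: "\<forall>v\<in>V2. \<forall>i\<in>{c..d}. j < i \<longrightarrow> v i \<in> P'" by auto
    have "v j \<in> P'" if v: "v \<in> V2" for v
    proof (rule P'_I_C)
      have vV: "v \<in> V" using v V2_V by blast
      have vP: "v \<in> PP I" using vV V_PP by blast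
      show "v j \<in> P" by (rule PP_PD[OF vP])
      fix y assume y: "y \<in> C"
      then have yA: "y \<in> carrier A" and yBC: "y \<in> B \<union> C" using C.Icarr by auto
      obtain r z where r: "r \<in> HH {c..d}" "z \<in> Z" "y \<odot>\<^bsub>F\<^esub> v = r \<oplus>\<^bsub>F\<^esub> z" "\<And>k. val k r = val k (y \<odot>\<^bsub>F\<^esub> v)"
        using smult_SOC[OF yBC vV] by blast
      have "y \<odot>\<^bsub>F\<^esub> v \<in> SOC" unfolding SOC_def F.mem_set_add using r by blast
      moreover have yV: "y \<odot>\<^bsub>F\<^esub> v \<in> V2" using F.submodD(7)[OF V2] yA v by blast
      \<comment> \<open>The \<open>V1\<close>-part of \<open>y v\<close> also lies in
        \<open>V2\<close>, hence in \<open>Z\<close>, so \<open>y v\<close> itself is in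
        \<open>SS j\<close>. Its coordinate \<open>j + 1\<close> is the value of \<open>C\<close> on
        the entry at \<open>j\<close>.\<close>
      ultimately have "y \<odot>\<^bsub>F\<^esub> v \<in> V1 <+>\<^bsub>F\<^esub> (V2 \<inter> SS j)" using SOC SS_generated[OF D] by blast
      then obtain v1 w where w: "v1 \<in> V1" "w \<in> V2" "w \<in> SS j" "y \<odot>\<^bsub>F\<^esub> v = v1 \<oplus>\<^bsub>F\<^esub> w"
        unfolding F.mem_set_add by blast
      have car: "v1 \<in> carrier F" "w \<in> carrier F" using w V1_V V2_V V_carrier by auto
      have "v1 = y \<odot>\<^bsub>F\<^esub> v \<ominus>\<^bsub>F\<^esub> w" unfolding w(4) using car by algebra
      then have "v1 \<in> V2" using F.submodD(6)[OF V2] yV w by metis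
      then have "v1 \<in> SS j" using w int Z_SS by blast
      then have "r \<oplus>\<^bsub>F\<^esub> z \<in> SS j" using F.submodD(4)[OF SS_submodule] w r(3) by metis
      then have "val (j + 1) r = \<zero>\<^bsub>L\<^esub>" using val_SS[OF r(1,2), of j "j + 1"] J step by auto
      then show "vC (y \<otimes> v j) = \<zero>\<^bsub>L\<^esub>" using r(4) C_smult_PP(2)[OF y vP] by simp
    qed
    then show ?case using D by (metis diff_add_cancel linorder_not_less order_le_less zle_diff1_eq)
  qed
  then have "v i \<in> P'" if "v \<in> V2" for v i
    using outside[of v i] V2_V D[of "c - 1"] that cd by (cases "i \<in> {c..d}") auto
  then show ?thesis by (auto simp: RR_def)
qed

lemma summand_in_RR: "V1 \<subseteq> RR \<or> V2 \<subseteq> RR"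
proof -
  interpret sw: injective_decomposition A B C L e vB vC S P P' V Z V2 V1 I J c d
    by (rule swap') (rule S_def P_def P'_def)+
  show ?thesis using SOC_simple V2_RR sw.V2_RR unfolding SOC_def SS_def sw.SOC_def sw.SS_def by blast
qed

end

section \<open>The construction\<close>

locale kronecker_finite = kronecker_data +
  assumes finite_length: "bounded_length A F (PP {a..b})"
begin

text \<open>The three Kronecker shapes on the generators \<open>c\<close> to \<open>d\<close>:
  \<open>{c..d+1}\<close> is preprojective, \<open>{c+1..d+1}\<close> regular,
  \<open>{c+1..d}\<close> preinjective. The last clause keeps \<open>J\<close> nonempty.\<close>

definition arrow_type :: "int \<Rightarrow> int \<Rightarrow> int set \<Rightarrow> bool" where
  "arrow_type c d J \<longleftrightarrow> c \<le> d \<and>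
    (J = {c..d+1} \<or> {c+1..d} \<subseteq> J \<and> J \<subseteq> {c+1..d+1} \<and> (c < d \<or> d + 1 \<in> J))"

lemma arrow_type_summand:
  assumes "decomposition A B C L e vB vC V Z V1 V2 I J c d" "arrow_type c d J"
  shows "V1 \<subseteq> RR \<or> V2 \<subseteq> RR"
proof (cases "J = {c..d+1}")
  case True
  interpret injective_decomposition A B C L e vB vC S P P' V Z V1 V2 I J c d
    by (intro injective_decomposition.intro injective_decomposition_axioms.intro assms True)
      (rule S_def P_def P'_def)+
  show ?thesis by (rule summand_in_RR)
next
  case False
  then interpret surjective_decomposition A B C L e vB vC S P P' V Z V1 V2 I J c d
    using assms(2) unfolding arrow_type_def
    by (intro surjective_decomposition.intro surjective_decomposition_axioms.intro assms(1))
      (auto simp: S_def P_def P'_def)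
  show ?thesis by (rule summand_in_RR)
qed

lemma decomposition_I:
  assumes "submodule V A F" "submodule V1 A F" "submodule V2 A F"
    "V1 <+>\<^bsub>F\<^esub> V2 = V" "V1 \<inter> V2 = Z" "V \<subseteq> PP I" "PP {c..d} \<subseteq> V"
    "\<And>v i. \<lbrakk>v \<in> V; i \<notin> {c..d}\<rbrakk> \<Longrightarrow> v i \<in> P'" "Z \<inter> HH I = KK I J" "c \<le> d"
  shows "decomposition A B C L e vB vC V Z V1 V2 I J c d"
  by (rule decomposition.intro[OF kronecker_data_axioms[unfolded S_def P_def P'_def]],
      rule decomposition_axioms.intro, unfold P_def[symmetric], unfold P'_def[symmetric])
    (use assms in auto)

lemma val_nonzero:
  assumes "j \<in> {a..b+1}" "a \<le> b"
  obtains h where "h \<in> HH {a..b}" "val j h \<noteq> \<zero>\<^bsub>L\<^esub>" "\<And>i. i \<in> {a..b+1} \<Longrightarrow> i \<noteq> j \<Longrightarrow> val i h = \<zero>\<^bsub>L\<^esub>"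
proof -
  obtain l where l: "l \<in> carrier L" "l \<noteq> \<zero>\<^bsub>L\<^esub>" using L_nonzero L.M.zero_closed by blast
  have "(if i = j then l else \<zero>\<^bsub>L\<^esub>) \<in> carrier L" for i using l by simp
  then show ?thesis
  proof (rule val_prescribed[OF assms(2)])
    fix h assume "h \<in> HH {a..b}" "\<And>i. i \<in> {a..b+1} \<Longrightarrow> val i h = (if i = j then l else \<zero>\<^bsub>L\<^esub>)"
    with assms l show ?thesis using that[of h] by simp
  qed
qed

lemma section_nontrivial:
  assumes "arrow_type c d J" "Z \<inter> HH I = KK I J" "{c..d} \<subseteq> I" "PP {c..d} \<subseteq> V"
  shows "V \<noteq> Z"
proof
  assume "V = Z"
  have "\<exists>j. j \<in> J \<and> j \<in> {c..d+1}"
  proof (cases "d + 1 \<in> J")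
    case True
    then show ?thesis using assms(1) by (auto simp: arrow_type_def)
  next
    case False
    then have "c < d" "c + 1 \<in> J" using assms(1) by (auto simp: arrow_type_def)
    then show ?thesis by auto
  qed
  then obtain j where j: "j \<in> J" "j \<in> {c..d+1}" by blast
  have "c \<le> d" using assms(1) by (simp add: arrow_type_def)
  then obtain h where h: "h \<in> HH {c..d}" "val j h \<noteq> \<zero>\<^bsub>L\<^esub>" using val_nonzero[OF j(2)] by metis
  then have "h \<in> Z \<inter> HH I" using assms(3,4) HH_PP HH_mono \<open>V = Z\<close> by blast
  then show False using assms(2) h j by (auto simp: KK_def)
qed

text \<open>Nakayama's lemma for a power of \<open>P\<close>, derived from locality: if
  \<open>w k\<close> is in \<open>P'\<close>, then \<open>e - w k\<close> still generates
  \<open>P\<close>. This removes the coordinates from the radical part one at a time.\<close>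

lemma top_superfluous:
  assumes N: "submodule N A F" and I: "finite I" and top: "PP I \<subseteq> N <+>\<^bsub>F\<^esub> (RR \<inter> PP I)"
  shows "PP I \<subseteq> N"
proof -
  have G: "submodule (N <+>\<^bsub>F\<^esub> (RR \<inter> PP T)) A F" for T
    by (intro F.submod_add F.submod_Int N RR_submodule PP_submodule)
  \<comment> \<open>\<open>T'\<close> holds the coordinates already removed and \<open>T\<close>
    those where the radical part may live. The two may overlap, hence the case
    \<open>k \<in> T\<close> below.\<close>
  have "PP I \<subseteq> N <+>\<^bsub>F\<^esub> (RR \<inter> PP T)" if T: "finite T'" "T' \<union> T = I" for T T'
    using T
  proof (induction T' arbitrary: T)
    case empty
    then show ?case using top by simp
  next
    case (insert k T')
    let ?G = "N <+>\<^bsub>F\<^esub> (RR \<inter> PP T)"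
    have upN: "N \<subseteq> ?G" and upR: "RR \<inter> PP T \<subseteq> ?G"
      using F.submod_add_upper1 F.submod_add_upper2 N F.submod_Int[OF RR_submodule PP_submodule] by blast+
    have IH: "PP I \<subseteq> N <+>\<^bsub>F\<^esub> (RR \<inter> PP (insert k T))" by (rule insert.IH) (use insert.prems in auto)
    have k: "k \<in> I" using insert.prems by auto
    have decomp: "\<exists>w'\<in>RR \<inter> PP T. w = single A k (w k) \<oplus>\<^bsub>F\<^esub> w'" if w: "w \<in> RR \<inter> PP (insert k T)" for w
    proof (cases "k \<in> T")
      case True
      then have "insert k T = T" by auto
      have "w = single A k (w k) \<oplus>\<^bsub>F\<^esub> (w \<ominus>\<^bsub>F\<^esub> single A k (w k))"
      proof -
        have "w \<in> carrier F" "single A k (w k) \<in> carrier F"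
          using w PP_carrier PP_carrier[OF single_PP[of "w k" k I]] k PP_PD by blast+
        then show ?thesis by algebra
      qed
      moreover have "single A k (w k) \<in> RR \<inter> PP T"
        using w True P'_zero P_zero by (auto simp: RR_def single_def PP_def)
      ultimately show ?thesis
        using F.submodD(6)[OF F.submod_Int[OF RR_submodule PP_submodule]] w \<open>insert k T = T\<close> by metis
    next
      case False
      let ?w = "w(k := \<zero>)"
      have "?w \<in> RR \<inter> PP T" using w P'_zero P_zero by (auto simp: RR_def PP_def)
      moreover have "w = single A k (w k) \<oplus>\<^bsub>F\<^esub> ?w"
        using w PP_carrier[of w] by (auto simp: single_def fun_eq_iff int_functions_simps)
      ultimately show ?thesis by blast
    qed
    have sk: "single A k q \<in> ?G" if q: "q \<in> P" for q
    proof -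
      have "single A k e \<in> PP I" by (rule single_PP[OF e_P k])
      then obtain n w where nw: "n \<in> N" "w \<in> RR \<inter> PP (insert k T)" "single A k e = n \<oplus>\<^bsub>F\<^esub> w"
        using IH unfolding F.mem_set_add subset_iff by blast
      obtain w' where w': "w' \<in> RR \<inter> PP T" "w = single A k (w k) \<oplus>\<^bsub>F\<^esub> w'" using decomp nw by blast
      have wk: "w k \<in> P'" "w k \<in> P" using nw P'_P by (auto simp: RR_def)
      have d: "e \<ominus> w k \<notin> P'"
      proof
        assume "e \<ominus> w k \<in> P'"
        then have "(e \<ominus> w k) \<oplus> w k \<in> P'" using P'_add wk by blast
        moreover have "(e \<ominus> w k) \<oplus> w k = e" using e P_carrier[OF wk(2)] by algebra
        ultimately show False using e_P' by simp
      qed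
      have eP: "e \<ominus> w k \<in> P"
      proof -
        have "e \<ominus> w k = e \<oplus> (\<ominus> \<one>) \<otimes> w k" using P_carrier[OF wk(2)] by (simp add: l_minus a_minus_def)
        then show ?thesis using P_add[OF e_P] P_smult wk by simp
      qed
      then obtain a where a: "a \<in> carrier A" "q = a \<otimes> (e \<ominus> w k)" using P_local d q by blast
      have "single A k (e \<ominus> w k) = n \<oplus>\<^bsub>F\<^esub> w'"
      proof
        fix i
        have c: "n i \<in> carrier A" "w' i \<in> carrier A" "w k \<in> carrier A"
          using F.submodD(3)[OF N nw(1)] w'(1) P_carrier[OF wk(2)] P_carrier[OF PP_PD[of w']]
          by (auto simp: int_functions_simps)
        have "single A k e i = n i \<oplus> (single A k (w k) i \<oplus> w' i)"
          using nw(3) w'(2) by (metis int_functions_simps(3))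
        then show "single A k (e \<ominus> w k) i = (n \<oplus>\<^bsub>F\<^esub> w') i"
        proof (cases "i = k")
          case True
          then have "e = n k \<oplus> (w k \<oplus> w' k)" using \<open>single A k e i = _\<close> by (simp add: single_def)
          then have "e \<ominus> w k = n k \<oplus> (w k \<oplus> w' k) \<ominus> w k" by simp
          also have "\<dots> = n k \<oplus> w' k" using c True by (simp add: a_minus_def, algebra)
          finally show ?thesis using True by (simp add: single_def int_functions_simps)
        next
          case False
          then show ?thesis using \<open>single A k e i = _\<close> c by (simp add: single_def int_functions_simps)
        qed
      qed
      moreover have "n \<oplus>\<^bsub>F\<^esub> w' \<in> ?G" unfolding F.mem_set_add using nw w' by blast
      ultimately show ?thesis
        using F.submodD(7)[OF G a(1)] smult_single[OF a(1)] unfolding a(2) by metis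
    qed
    show ?case
    proof
      fix u assume "u \<in> PP I"
      then obtain n w where nw: "n \<in> N" "w \<in> RR \<inter> PP (insert k T)" "u = n \<oplus>\<^bsub>F\<^esub> w"
        using IH unfolding F.mem_set_add subset_iff by blast
      obtain w' where w': "w' \<in> RR \<inter> PP T" "w = single A k (w k) \<oplus>\<^bsub>F\<^esub> w'" using decomp nw by blast
      have "single A k (w k) \<in> ?G" using sk nw P'_P by (auto simp: RR_def)
      then have "w \<in> ?G" using F.submodD(4)[OF G, where x = "single A k (w k)" and y = w'] w' upR by auto
      then show "u \<in> ?G" using F.submodD(4)[OF G, where x = n and y = w] nw upN by auto
    qed
  qed
  then have "PP I \<subseteq> N <+>\<^bsub>F\<^esub> (RR \<inter> PP {})" using I by simp
  moreover have "RR \<inter> PP {} \<subseteq> N"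
  proof
    fix u assume "u \<in> RR \<inter> PP {}"
    then have "u = \<zero>\<^bsub>F\<^esub>" by (auto simp: PP_def int_functions_simps)
    then show "u \<in> N" using F.submodD(2)[OF N] by simp
  qed
  ultimately show ?thesis using F.submod_add_least[OF N order_refl] by blast
qed

lemma projective_section:
  assumes Z: "submodule Z A F" and HH: "Z \<inter> HH {c..d} = KK {c..d} J" and J: "arrow_type c d J"
  shows "indecomposable_section A F (PP {c..d}) Z"
  unfolding indecomposable_section_def
proof (intro conjI allI impI)
  show "PP {c..d} \<noteq> Z" by (rule section_nontrivial[OF J HH]) auto
  fix V1 V2 assume V: "submodule V1 A F \<and> submodule V2 A F \<and> V1 <+>\<^bsub>F\<^esub> V2 = PP {c..d} \<and> V1 \<inter> V2 = Z"
  have "decomposition A B C L e vB vC (PP {c..d}) Z V1 V2 {c..d} J c d"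
  proof (rule decomposition_I)
    show "\<And>v i. v \<in> PP {c..d} \<Longrightarrow> i \<notin> {c..d} \<Longrightarrow> v i \<in> P'" using P'_zero by (simp add: PP_def)
  qed (use V HH J PP_submodule in \<open>auto simp: arrow_type_def\<close>)
  note * = arrow_type_summand[OF this J]
  have up: "V1 \<subseteq> PP {c..d}" "V2 \<subseteq> PP {c..d}"
    using V F.submod_add_upper1 F.submod_add_upper2 by metis+
  from * show "V1 = Z \<or> V2 = Z"
  proof
    assume "V1 \<subseteq> RR"
    then have "PP {c..d} \<subseteq> V2 <+>\<^bsub>F\<^esub> (RR \<inter> PP {c..d})"
      using F.set_add_comm[of V1 V2] F.submodD(1) V F.set_add_mono[of V2 V2 V1 "RR \<inter> PP {c..d}"] up by auto
    then have "PP {c..d} \<subseteq> V2" using top_superfluous V by blast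
    then show ?thesis using V up by blast
  next
    assume "V2 \<subseteq> RR"
    then have "PP {c..d} \<subseteq> V1 <+>\<^bsub>F\<^esub> (RR \<inter> PP {c..d})"
      using V F.set_add_mono[of V1 V1 V2 "RR \<inter> PP {c..d}"] up by auto
    then have "PP {c..d} \<subseteq> V1" using top_superfluous V by blast
    then show ?thesis using V up by blast
  qed
qed

text \<open>The uniform side: \<open>B\<close> and \<open>C\<close> kill a summand \<open>V2\<close>
  with trivial top modulo \<open>Z\<close>, so all they produce from the generators over
  \<open>I0\<close> lies in \<open>V1\<close>, in particular \<open>HH I0\<close>. If
  \<open>V2\<close> were larger than \<open>Z\<close>, then \<open>ess\<close> would give it an
  element of \<open>HH I0\<close> outside \<open>Z\<close>.\<close>

lemma essential_section:
  assumes V: "submodule V A F" and VI: "V \<subseteq> PP I" and PV: "PP {c..d} \<subseteq> V"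
    and out: "\<And>v i. \<lbrakk>v \<in> V; i \<notin> {c..d}\<rbrakk> \<Longrightarrow> v i \<in> P'"
    and HH: "Z \<inter> HH I = KK I J" and J: "arrow_type c d J" and cdI: "{c..d} \<subseteq> I"
    and I0: "finite I0" "PP I0 \<subseteq> V"
    and ess: "\<And>N. submodule N A F \<Longrightarrow> Z \<subset> N \<Longrightarrow> N \<subseteq> V \<Longrightarrow> \<exists>h\<in>N \<inter> HH I0. h \<notin> Z"
  shows "indecomposable_section A F V Z"
  unfolding indecomposable_section_def
proof (intro conjI allI impI)
  show "V \<noteq> Z" by (rule section_nontrivial[OF J HH cdI PV])
  have main: "V2 = Z"
    if V12: "submodule V1 A F" "submodule V2 A F" "V1 <+>\<^bsub>F\<^esub> V2 = V" "V1 \<inter> V2 = Z" and R: "V2 \<subseteq> RR" for V1 V2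
  proof (rule ccontr)
    assume "V2 \<noteq> Z"
    have "decomposition A B C L e vB vC V Z V1 V2 I J c d"
      by (rule decomposition_I) (use V12 V HH J VI PV out in \<open>auto simp: arrow_type_def\<close>)
    then interpret decomposition A B C L e vB vC S P P' V Z V1 V2 I J c d
      by - (assumption, (rule S_def P_def P'_def)+)
    have "Z \<subset> V2" using \<open>V2 \<noteq> Z\<close> V12 by auto
    then obtain h where h: "h \<in> V2" "h \<in> HH I0" "h \<notin> Z"
      using ess V12(2) V2_V by blast
    have "h \<in> V1"
    proof (rule submodule_of_singles[OF V12(1) I0(1) HH_carrier[OF h(2)]])
      show "\<And>i. i \<notin> I0 \<Longrightarrow> h i = \<zero>" using h by (auto simp: HH_def)
      fix i assume i: "i \<in> I0"
      obtain x y where xy: "x \<in> B" "y \<in> C" "h i = x \<otimes> e \<oplus> y \<otimes> e" using HH_SD[OF h(2), of i] by (auto simp: S_def)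
      have sV: "single A i e \<in> V" using single_PP[OF e_P i] I0 by blast
      obtain v1 v2 where v: "v1 \<in> V1" "v2 \<in> V2" "single A i e = v1 \<oplus>\<^bsub>F\<^esub> v2" using split[OF sV] by blast
      have v2K: "v2 \<in> K" using v R V2_V by (auto simp: K_def)
      have t: "t \<odot>\<^bsub>F\<^esub> single A i e \<in> V1" if t: "t \<in> B \<union> C" for t
      proof -
        have tA: "t \<in> carrier A" by (rule BC_carrier[OF t])
        have "t \<odot>\<^bsub>F\<^esub> single A i e = t \<odot>\<^bsub>F\<^esub> v1 \<oplus>\<^bsub>F\<^esub> t \<odot>\<^bsub>F\<^esub> v2"
          unfolding v(3) using v tA V1_V V2_V V_carrier by (intro F.smult_r_distr) auto
        moreover have "t \<odot>\<^bsub>F\<^esub> v2 \<in> V1" using smult_K[OF t v2K] Z_V by blast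
        ultimately show ?thesis using F.submodD(4,7)[OF V12(1)] tA v(1) by metis
      qed
      have "x \<in> carrier A" "y \<in> carrier A" using xy B.Icarr C.Icarr by auto
      then have "single A i (h i) = x \<odot>\<^bsub>F\<^esub> single A i e \<oplus>\<^bsub>F\<^esub> y \<odot>\<^bsub>F\<^esub> single A i e"
        by (auto simp: smult_single xy(3) int_functions_simps single_def)
      then show "single A i (h i) \<in> V1" using t xy F.submodD(4)[OF V12(1)] by simp
    qed
    then show False using h V12 by blast
  qed
  fix V1 V2 assume V12: "submodule V1 A F \<and> submodule V2 A F \<and> V1 <+>\<^bsub>F\<^esub> V2 = V \<and> V1 \<inter> V2 = Z"
  have comm: "V2 <+>\<^bsub>F\<^esub> V1 = V"
    using F.set_add_comm[of V1 V2] F.submodD(1) V12 by auto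
  have "decomposition A B C L e vB vC V Z V1 V2 I J c d"
    by (rule decomposition_I) (use V12 V HH J VI PV out in \<open>auto simp: arrow_type_def\<close>)
  from arrow_type_summand[OF this J] show "V1 = Z \<or> V2 = Z"
    using main[of V1 V2] main[of V2 V1] V12 comm by blast
qed

end

section \<open>Relation modules whose quotient has a known socle\<close>

context kronecker_finite
begin

lemma KK_HH: "KK I J \<subseteq> HH I" by (auto simp: KK_def)

lemma KK_PP: "KK I J \<subseteq> PP I" using KK_HH HH_PP by blast

text \<open>\<open>J\<close> records which socle coordinates of \<open>PP {a..b} / Z\<close> survive: \<open>{a+1..b}\<close> for the modules
  \<open>W\<close>, \<open>{a+1..b+1}\<close> for \<open>R(2n)\<close> and \<open>{a..b+1}\<close> for \<open>M(2n)\<close>.  The last clause says that the socle is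
  contained in the image of \<open>HH {a..b}\<close>.\<close>

definition stage :: "int \<Rightarrow> int \<Rightarrow> int set \<Rightarrow> (int \<Rightarrow> 'a) set \<Rightarrow> bool" where
  "stage a b J Z \<longleftrightarrow> a \<le> b \<and> submodule Z A F \<and> Z \<subseteq> PP {a..b} \<and> Z \<inter> HH {a..b} = KK {a..b} J \<and>
    (\<forall>N. covers A F N Z \<and> N \<subseteq> PP {a..b} \<longrightarrow> N \<subseteq> HH {a..b} <+>\<^bsub>F\<^esub> Z)"

text \<open>A nonzero submodule of \<open>PP {a..b} / Z\<close> contains a simple one, and the
  simple ones come from \<open>HH {a..b}\<close>.\<close>

lemma stage_meets:
  assumes st: "stage a b J Z" and N: "submodule N A F" "Z \<subset> N" "N \<subseteq> PP {a..b}"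
  shows "\<exists>h\<in>N \<inter> HH {a..b}. h \<notin> Z"
proof -
  have Z: "submodule Z A F" using st by (simp add: stage_def)
  obtain N0 where N0: "covers A F N0 Z" "N0 \<subseteq> N"
    using bounded_length_cover[OF finite_length N(1) Z N(2,3)] by blast
  have "N0 \<subseteq> HH {a..b} <+>\<^bsub>F\<^esub> Z" using st N0 N by (auto simp: stage_def)
  moreover obtain n where n: "n \<in> N0" "n \<notin> Z" using N0 by (auto simp: covers_def)
  ultimately obtain h z where hz: "h \<in> HH {a..b}" "z \<in> Z" "n = h \<oplus>\<^bsub>F\<^esub> z"
    unfolding subset_iff F.mem_set_add by blast
  have car: "h \<in> carrier F" "z \<in> carrier F" using hz HH_carrier F.submodD(3)[OF Z] by auto
  have "h = n \<ominus>\<^bsub>F\<^esub> z" unfolding hz(3) using car by algebra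
  moreover have "n \<in> N" "z \<in> N" using n N0 N(2) hz(2) by auto
  ultimately have "h \<in> N" using F.submodD(6)[OF N(1)] by simp
  moreover have "h \<notin> Z" using F.submodD(4)[OF Z] hz n by blast
  ultimately show ?thesis using hz by blast
qed

text \<open>An entry of \<open>z\<close> outside \<open>P'\<close> would be moved by
  \<open>B\<close> or \<open>C\<close> to a nonzero value at a coordinate in \<open>J\<close>, but
  the multiples of \<open>z\<close> stay in \<open>Z\<close>, where those values vanish.\<close>

lemma stage_RR:
  assumes Z: "submodule Z A F" "Z \<subseteq> PP I" "Z \<inter> HH I = KK I J"
    and cov: "\<And>i. i \<in> I \<Longrightarrow> i \<in> J \<or> i + 1 \<in> J"
  shows "Z \<subseteq> RR"
proof
  fix z assume z: "z \<in> Z"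
  then have zP: "z \<in> PP I" using Z by blast
  have val: "val j (t \<odot>\<^bsub>F\<^esub> z) = \<zero>\<^bsub>L\<^esub>" if "j \<in> J" "t \<in> B \<union> C" for j t
  proof -
    have "t \<odot>\<^bsub>F\<^esub> z \<in> HH I" using that B_smult_PP(1) C_smult_PP(1) zP by blast
    moreover have "t \<odot>\<^bsub>F\<^esub> z \<in> Z" using F.submodD(7)[OF Z(1)] z that B.Icarr C.Icarr by blast
    ultimately show ?thesis using Z(3) that by (auto simp: KK_def)
  qed
  have "z i \<in> P'" for i
  proof (cases "i \<in> I")
    case False
    then show ?thesis using zP P'_zero by (simp add: PP_def)
  next
    case True
    then consider "i \<in> J" | "i + 1 \<in> J" using cov by blast
    then show ?thesis
    proof cases
      case 1
      then show ?thesis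
        using val[OF 1] B_smult_PP(2)[OF _ zP, of _ i] by (intro P'_I_B PP_PD[OF zP]) auto
    next
      case 2
      then show ?thesis
        using val[OF 2] C_smult_PP(2)[OF _ zP, of _ "i + 1"] by (intro P'_I_C PP_PD[OF zP]) auto
    qed
  qed
  then show "z \<in> RR" by (simp add: RR_def)
qed

text \<open>Two generators share the single coordinate \<open>1\<close>. A cover of a maximal such
  \<open>Z\<close> must enlarge the trace on \<open>HH {0..1}\<close>, so the quotient has simple
  socle. It becomes W(1) and also the block glued on later.\<close>

lemma initial_stage: "\<exists>Z. stage 0 1 {1} Z"
proof -
  let ?Q = "\<lambda>N. submodule N A F \<and> N \<subseteq> PP {0..1} \<and> N \<inter> HH {0..1} = KK {0..1} {1}"
  have Q0: "?Q (KK {0..1} {1})" using KK_submodule KK_PP KK_HH by blast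
  obtain Z where Z: "?Q Z" and max: "\<And>N. ?Q N \<Longrightarrow> Z \<subseteq> N \<Longrightarrow> N = Z"
    using bounded_length_maximal[OF finite_length[of 0 1], where Q = ?Q, OF Q0] by blast
  have "N \<subseteq> HH {0..1} <+>\<^bsub>F\<^esub> Z" if N: "covers A F N Z" "N \<subseteq> PP {0..1}" for N
  proof -
    have "\<not> ?Q N" using max[of N] N by (auto simp: covers_def)
    then have "N \<inter> HH {0..1} \<noteq> Z \<inter> HH {0..1}" using N Z by (auto simp: covers_def)
    then obtain h where "h \<in> N" "h \<in> HH {0..1}" "h \<notin> Z" using N by (auto simp: covers_def)
    then show ?thesis using F.cover_meets[OF N(1) HH_submodule] by blast
  qed
  then have "stage 0 1 {1} Z" using Z by (auto simp: stage_def)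
  then show ?thesis by blast
qed

text \<open>Two nonzero summands would both meet \<open>HH {0..1}\<close> outside \<open>Z\<close>,
  yet modulo \<open>KK {0..1} {1}\<close> that part is one copy of \<open>L\<close>, read off by
  \<open>val 1\<close>.\<close>

lemma initial_stage_uniform:
  assumes st: "stage 0 1 {1} Z" and V: "submodule V A F" "Z \<subset> V" "V \<subseteq> PP {0..1}"
  shows "indecomposable_section A F V Z"
  unfolding indecomposable_section_def
proof (intro conjI allI impI)
  show "V \<noteq> Z" using V by blast
  have Z: "submodule Z A F" and KZ: "KK {0..1} {1} \<subseteq> Z" using st by (auto simp: stage_def)
  fix V1 V2 assume V12: "submodule V1 A F \<and> submodule V2 A F \<and> V1 <+>\<^bsub>F\<^esub> V2 = V \<and> V1 \<inter> V2 = Z"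
  then have up: "V1 \<subseteq> V" "V2 \<subseteq> V" using F.submod_add_upper1[of V1 V2] F.submod_add_upper2[of V1 V2] by auto
  show "V1 = Z \<or> V2 = Z"
  proof (rule ccontr)
    assume "\<not> (V1 = Z \<or> V2 = Z)"
    then have "Z \<subset> V1" "Z \<subset> V2" using V12 by auto
    then obtain h h' where h: "h \<in> V1" "h \<in> HH {0..1}" "h \<notin> Z" and h': "h' \<in> V2" "h' \<in> HH {0..1}" "h' \<notin> Z"
      using stage_meets[OF st, of V1] stage_meets[OF st, of V2] V12 up V(3) by (metis IntE order_trans)
    have "val 1 h \<noteq> \<zero>\<^bsub>L\<^esub>" using h KZ by (auto simp: KK_def)
    then obtain a where a: "a \<in> carrier A" "val 1 h' = a \<odot>\<^bsub>L\<^esub> val 1 h"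
      using L_simple val_closed[OF h(2)] val_closed[OF h'(2)] by metis
    have ah: "a \<odot>\<^bsub>F\<^esub> h \<in> HH {0..1}" "a \<odot>\<^bsub>F\<^esub> h \<in> V1"
      using F.submodD(7)[OF HH_submodule a(1) h(2)] F.submodD(7)[of V1] V12 a(1) h(1) by auto
    have "h' \<ominus>\<^bsub>F\<^esub> a \<odot>\<^bsub>F\<^esub> h \<in> HH {0..1}" using F.submodD(6)[OF HH_submodule h'(2) ah(1)] .
    moreover have "val 1 (h' \<ominus>\<^bsub>F\<^esub> a \<odot>\<^bsub>F\<^esub> h) = \<zero>\<^bsub>L\<^esub>"
      unfolding val_minus[OF h'(2) ah(1)] val_smult[OF a(1) h(2)] a(2)[symmetric]
      using val_closed[OF h'(2)] by (simp add: a_minus_def L.M.r_neg)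
    ultimately have "h' \<ominus>\<^bsub>F\<^esub> a \<odot>\<^bsub>F\<^esub> h \<in> V1" using KZ V12 by (auto simp: KK_def)
    then have "h' \<in> V1" using F.submod_diff_cancel[of V1] ah(2) HH_carrier[OF h'(2)] V12 by blast
    then show False using h' V12 by blast
  qed
qed

text \<open>Gluing a copy of the initial stage to the coordinate \<open>i\<close> imposes one more condition: this is the
  passage from a module to a submodule of its direct sum with the uniform module \<open>PP {0..1} / Z0\<close>.\<close>

lemma stage_shrink:
  assumes st: "stage a b J Z" and st0: "stage 0 1 {1} Z0"
    and j0: "j0 \<notin> J" "insert j0 J \<subseteq> {a..b+1}" and k: "k \<in> {0..1}" and i: "i \<in> {a..b}"
    and val0: "\<And>h. h \<in> HH {a..b} \<Longrightarrow> val 1 (single A k (h i)) = val j0 h"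
  shows "stage a b (insert j0 J) {u \<in> Z. single A k (u i) \<in> Z0}"
proof -
  have Z: "submodule Z A F" "Z \<subseteq> PP {a..b}" "Z \<inter> HH {a..b} = KK {a..b} J" and ab: "a \<le> b"
    and ess: "\<And>N. covers A F N Z \<Longrightarrow> N \<subseteq> PP {a..b} \<Longrightarrow> N \<subseteq> HH {a..b} <+>\<^bsub>F\<^esub> Z"
    using st by (auto simp: stage_def)
  have Z0: "submodule Z0 A F" "Z0 \<subseteq> PP {0..1}" "Z0 \<inter> HH {0..1} = KK {0..1} {1}"
    and ess0: "\<And>N. covers A F N Z0 \<Longrightarrow> N \<subseteq> PP {0..1} \<Longrightarrow> N \<subseteq> HH {0..1} <+>\<^bsub>F\<^esub> Z0"
    using st0 by (auto simp: stage_def)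
  define \<phi> where "\<phi> u = single A k (u i)" for u :: "int \<Rightarrow> 'a"
  have \<phi>c: "\<phi> u \<in> carrier F" if "u \<in> carrier F" for u
    using that by (simp add: \<phi>_def single_def int_functions_simps)
  have \<phi>a: "\<phi> (u \<oplus>\<^bsub>F\<^esub> v) = \<phi> u \<oplus>\<^bsub>F\<^esub> \<phi> v" if "u \<in> carrier F" "v \<in> carrier F" for u v
    by (auto simp: \<phi>_def single_def int_functions_simps fun_eq_iff)
  have \<phi>s: "\<phi> (c \<odot>\<^bsub>F\<^esub> u) = c \<odot>\<^bsub>F\<^esub> \<phi> u" if "c \<in> carrier A" "u \<in> carrier F" for c u
    using that by (auto simp: \<phi>_def single_def int_functions_simps fun_eq_iff)
  have \<phi>m: "\<phi> (u \<ominus>\<^bsub>F\<^esub> v) = \<phi> u \<ominus>\<^bsub>F\<^esub> \<phi> v" if "u \<in> carrier F" "v \<in> carrier F" for u v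
    using that \<phi>c by (simp add: F_minus) (auto simp: \<phi>_def single_def fun_eq_iff a_minus_def)
  have \<phi>P: "\<phi> u \<in> PP {0..1}" if "u \<in> PP {a..b}" for u
    unfolding \<phi>_def by (rule single_PP[OF PP_PD[OF that] k])
  have \<phi>H: "\<phi> h \<in> HH {0..1}" if "h \<in> HH {a..b}" for h
    unfolding \<phi>_def by (rule single_HH[OF HH_SD[OF that] k])
  have \<phi>v: "val 1 (\<phi> h) = val j0 h" if "h \<in> HH {a..b}" for h
    unfolding \<phi>_def by (rule val0[OF that])
  have lm: "left_module A F" by (rule left_module_int_functions)
  define Z' where "Z' = {u \<in> Z. \<phi> u \<in> Z0}"
  have Z': "submodule Z' A F"
    unfolding Z'_def
    by (rule F.submod_preimage[OF lm Z0(1) Z(1)])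
      (use F.submodD(3)[OF Z(1)] \<phi>c \<phi>a \<phi>s in blast)+
  have Z'_Int: "Z' \<inter> HH {a..b} = KK {a..b} (insert j0 J)"
  proof -
    have "\<phi> h \<in> Z0 \<longleftrightarrow> val j0 h = \<zero>\<^bsub>L\<^esub>" if "h \<in> HH {a..b}" for h
    proof -
      have "\<phi> h \<in> Z0 \<longleftrightarrow> \<phi> h \<in> KK {0..1} {1}" using \<phi>H[OF that] Z0(3) by blast
      also have "\<dots> \<longleftrightarrow> val j0 h = \<zero>\<^bsub>L\<^esub>" using \<phi>H[OF that] \<phi>v[OF that] by (simp add: KK_def)
      finally show ?thesis .
    qed
    moreover have "h \<in> Z \<longleftrightarrow> h \<in> KK {a..b} J" if "h \<in> HH {a..b}" for h using that Z(3) by blast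
    ultimately show ?thesis by (auto simp: Z'_def KK_def)
  qed
  have "N \<subseteq> HH {a..b} <+>\<^bsub>F\<^esub> Z'" if N: "covers A F N Z'" "N \<subseteq> PP {a..b}" for N
  proof
    fix n assume n: "n \<in> N"
    have Nm: "submodule N A F" and Z'N: "Z' \<subseteq> N" using N by (auto simp: covers_def)
    have NF: "u \<in> carrier F" if "u \<in> N" for u using F.submodD(3)[OF Nm that] .
    have up: "N \<subseteq> N <+>\<^bsub>F\<^esub> Z" "\<phi> ` N \<subseteq> \<phi> ` N <+>\<^bsub>F\<^esub> Z0"
    proof -
      show "N \<subseteq> N <+>\<^bsub>F\<^esub> Z" by (rule F.submod_add_upper1[OF Nm Z(1)])
      have "submodule (\<phi> ` N) A F"
        by (rule F.submod_image[OF lm Nm]) (use NF \<phi>c \<phi>a \<phi>s in blast)+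
      then show "\<phi> ` N \<subseteq> \<phi> ` N <+>\<^bsub>F\<^esub> Z0" by (rule F.submod_add_upper1[OF _ Z0(1)])
    qed
    \<comment> \<open>The section \<open>N / Z'\<close> is simple, so its images in
      \<open>PP {a..b} / Z\<close> and in \<open>PP {0..1} / Z0\<close> are zero or simple. In
      either case they lie in the known socles.\<close>
    have "(\<lambda>u. u) ` N <+>\<^bsub>F\<^esub> Z = Z \<or> covers A F ((\<lambda>u. u) ` N <+>\<^bsub>F\<^esub> Z) Z"
      by (rule F.covers_image[OF N(1) Z(1)]) (use NF in \<open>auto simp: Z'_def\<close>)
    then have "N <+>\<^bsub>F\<^esub> Z = Z \<or> covers A F (N <+>\<^bsub>F\<^esub> Z) Z" by simp
    moreover have "N <+>\<^bsub>F\<^esub> Z \<subseteq> PP {a..b}" by (rule F.submod_add_least[OF PP_submodule N(2) Z(2)])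
    moreover have "Z \<subseteq> HH {a..b} <+>\<^bsub>F\<^esub> Z" by (rule F.submod_add_upper2[OF HH_submodule Z(1)])
    ultimately have "N <+>\<^bsub>F\<^esub> Z \<subseteq> HH {a..b} <+>\<^bsub>F\<^esub> Z" using ess by metis
    then have "n \<in> HH {a..b} <+>\<^bsub>F\<^esub> Z" using up n by blast
    then obtain h z where hz: "h \<in> HH {a..b}" "z \<in> Z" "n = h \<oplus>\<^bsub>F\<^esub> z" unfolding F.mem_set_add by blast
    have "\<phi> ` N <+>\<^bsub>F\<^esub> Z0 = Z0 \<or> covers A F (\<phi> ` N <+>\<^bsub>F\<^esub> Z0) Z0"
      by (rule F.covers_image[OF N(1) Z0(1)]) (use NF \<phi>c \<phi>a \<phi>s in \<open>auto simp: Z'_def\<close>)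
    moreover have "\<phi> ` N <+>\<^bsub>F\<^esub> Z0 \<subseteq> PP {0..1}"
      by (rule F.submod_add_least[OF PP_submodule _ Z0(2)]) (use \<phi>P N(2) in blast)
    moreover have "Z0 \<subseteq> HH {0..1} <+>\<^bsub>F\<^esub> Z0" by (rule F.submod_add_upper2[OF HH_submodule Z0(1)])
    ultimately have "\<phi> ` N <+>\<^bsub>F\<^esub> Z0 \<subseteq> HH {0..1} <+>\<^bsub>F\<^esub> Z0" using ess0 by metis
    then have "\<phi> n \<in> HH {0..1} <+>\<^bsub>F\<^esub> Z0" using up n by blast
    then obtain h' z0 where hz0: "h' \<in> HH {0..1}" "z0 \<in> Z0" "\<phi> n = h' \<oplus>\<^bsub>F\<^esub> z0" unfolding F.mem_set_add by blast
    \<comment> \<open>The two descriptions of \<open>n\<close> may disagree at coordinate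
      \<open>j0\<close> by \<open>l\<close>. The correction \<open>g\<close> is nonzero at no other
      coordinate, so it lies in \<open>Z\<close>; moving it from \<open>z\<close> to
      \<open>h\<close> repairs the second component.\<close>
    define l where "l = val 1 h' \<ominus>\<^bsub>L\<^esub> val j0 h"
    have lL: "val 1 h' \<in> carrier L" "val j0 h \<in> carrier L" "l \<in> carrier L"
      using val_closed hz hz0 by (auto simp: l_def)
    then have "(if j = j0 then l else \<zero>\<^bsub>L\<^esub>) \<in> carrier L" for j by simp
    then obtain g where g: "g \<in> HH {a..b}"
      "\<And>j. j \<in> {a..b+1} \<Longrightarrow> val j g = (if j = j0 then l else \<zero>\<^bsub>L\<^esub>)"
      using val_prescribed[OF ab, of "\<lambda>j. if j = j0 then l else \<zero>\<^bsub>L\<^esub>"] by blast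
    have gZ: "g \<in> Z"
    proof -
      have "g \<in> KK {a..b} J" using g j0 by (auto simp: KK_def)
      then show ?thesis using Z(3) by blast
    qed
    have car: "h \<in> carrier F" "z \<in> carrier F" "g \<in> carrier F" "h' \<in> carrier F" "z0 \<in> carrier F" "n \<in> carrier F"
      using hz hz0 g HH_carrier F.submodD(3)[OF Z(1)] F.submodD(3)[OF Z0(1)] NF n by auto
    have zg: "z \<ominus>\<^bsub>F\<^esub> g \<in> Z" using F.submodD(6)[OF Z(1)] hz gZ by blast
    have "z \<ominus>\<^bsub>F\<^esub> g = n \<ominus>\<^bsub>F\<^esub> (h \<oplus>\<^bsub>F\<^esub> g)" unfolding hz(3) using car by algebra
    then have "\<phi> (z \<ominus>\<^bsub>F\<^esub> g) = \<phi> n \<ominus>\<^bsub>F\<^esub> (\<phi> h \<oplus>\<^bsub>F\<^esub> \<phi> g)" using car by (simp add: \<phi>m \<phi>a)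
    also have "\<dots> = (h' \<ominus>\<^bsub>F\<^esub> (\<phi> h \<oplus>\<^bsub>F\<^esub> \<phi> g)) \<oplus>\<^bsub>F\<^esub> z0"
      unfolding hz0(3) using car \<phi>c[OF car(1)] \<phi>c[OF car(3)] by algebra
    finally have eq: "\<phi> (z \<ominus>\<^bsub>F\<^esub> g) = (h' \<ominus>\<^bsub>F\<^esub> (\<phi> h \<oplus>\<^bsub>F\<^esub> \<phi> g)) \<oplus>\<^bsub>F\<^esub> z0" .
    have hgH: "\<phi> h \<oplus>\<^bsub>F\<^esub> \<phi> g \<in> HH {0..1}" using F.submodD(4)[OF HH_submodule] \<phi>H hz g by blast
    have "val 1 (h' \<ominus>\<^bsub>F\<^esub> (\<phi> h \<oplus>\<^bsub>F\<^esub> \<phi> g)) = val 1 h' \<ominus>\<^bsub>L\<^esub> (val j0 h \<oplus>\<^bsub>L\<^esub> l)"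
      unfolding val_minus[OF hz0(1) hgH] val_add[OF \<phi>H[OF hz(1)] \<phi>H[OF g(1)]] \<phi>v[OF hz(1)] \<phi>v[OF g(1)]
      using g(2)[of j0] j0 by simp
    also have "\<dots> = \<zero>\<^bsub>L\<^esub>" unfolding l_def using lL(1,2) by algebra
    finally have "h' \<ominus>\<^bsub>F\<^esub> (\<phi> h \<oplus>\<^bsub>F\<^esub> \<phi> g) \<in> KK {0..1} {1}"
      using F.submodD(6)[OF HH_submodule hz0(1) hgH] by (simp add: KK_def)
    then have "\<phi> (z \<ominus>\<^bsub>F\<^esub> g) \<in> Z0" unfolding eq using Z0 F.submodD(4)[OF Z0(1)] hz0(2) by blast
    then have "z \<ominus>\<^bsub>F\<^esub> g \<in> Z'" using zg by (simp add: Z'_def)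
    moreover have "h \<oplus>\<^bsub>F\<^esub> g \<in> HH {a..b}" using F.submodD(4)[OF HH_submodule] hz g by blast
    moreover have "n = (h \<oplus>\<^bsub>F\<^esub> g) \<oplus>\<^bsub>F\<^esub> (z \<ominus>\<^bsub>F\<^esub> g)" unfolding hz(3) using car by algebra
    ultimately show "n \<in> HH {a..b} <+>\<^bsub>F\<^esub> Z'" unfolding F.mem_set_add by blast
  qed
  then have "stage a b (insert j0 J) Z'"
    using ab Z' Z'_Int Z(2) unfolding stage_def by (auto simp: Z'_def)
  then show ?thesis by (simp add: Z'_def \<phi>_def)
qed

text \<open>Maximality of \<open>Z'\<close> among the relation modules with trace \<open>Z\<close>
  on the old window makes \<open>PP {a..b} / Z\<close> essential in the new quotient. So two
  generators are added while the socle does not grow. The clause on \<open>KK\<close> imposes the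
  relations that attach the new generators.\<close>

lemma stage_extend:
  assumes st: "stage a b {a..b+1} Z"
  obtains Z' where "stage (a - 1) (b + 1) {a..b+1} Z'" "Z' \<inter> PP {a..b} = Z"
    "\<And>N. submodule N A F \<Longrightarrow> Z' \<subset> N \<Longrightarrow> N \<subseteq> PP {a-1..b+1} \<Longrightarrow> \<exists>h\<in>N \<inter> HH {a..b}. h \<notin> Z'"
proof -
  have Z: "submodule Z A F" "Z \<subseteq> PP {a..b}" "Z \<inter> HH {a..b} = KK {a..b} {a..b+1}" and ab: "a \<le> b"
    using st by (auto simp: stage_def)
  let ?I = "{a-1..b+1}" and ?J = "{a..b+1}"
  have sub: "HH {a..b} \<subseteq> HH ?I" "PP {a..b} \<subseteq> PP ?I" by (intro HH_mono PP_mono; auto)+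
  let ?Q = "\<lambda>N. submodule N A F \<and> N \<subseteq> PP ?I \<and> KK ?I ?J \<subseteq> N \<and> N \<inter> PP {a..b} = Z"
  \<comment> \<open>The starting point: the old relations together with all socle relations of the
    longer window.\<close>
  let ?N = "Z <+>\<^bsub>F\<^esub> KK ?I ?J"
  have KZ: "KK ?I ?J \<inter> PP {a..b} \<subseteq> Z"
  proof
    fix k assume "k \<in> KK ?I ?J \<inter> PP {a..b}"
    then have "k \<in> KK {a..b} ?J" using HH_Int_PP[of ?I "{a..b}"] by (auto simp: KK_def)
    then show "k \<in> Z" using Z(3) by blast
  qed
  have upper: "Z \<subseteq> ?N" "KK ?I ?J \<subseteq> ?N"
    by (rule F.submod_add_upper1[OF Z(1) KK_submodule], rule F.submod_add_upper2[OF Z(1) KK_submodule])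
  have Q0: "?Q ?N"
  proof (intro conjI)
    show "submodule ?N A F" by (rule F.submod_add[OF Z(1) KK_submodule])
    show "?N \<subseteq> PP ?I"
      by (rule F.submod_add_least[OF PP_submodule]) (use Z(2) sub KK_PP in blast)+
    show "KK ?I ?J \<subseteq> ?N" by (rule upper)
    show "?N \<inter> PP {a..b} = Z"
    proof
      show "Z \<subseteq> ?N \<inter> PP {a..b}" using upper Z by blast
      show "?N \<inter> PP {a..b} \<subseteq> Z"
      proof
        fix u assume u: "u \<in> ?N \<inter> PP {a..b}"
        then obtain z k where zk: "z \<in> Z" "k \<in> KK ?I ?J" "u = z \<oplus>\<^bsub>F\<^esub> k" unfolding Int_iff F.mem_set_add by blast
        have "k \<in> carrier F" using zk F.submodD(3)[OF KK_submodule] by blast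
        then have "k \<in> PP {a..b}" using F.submod_cancel_left[OF PP_submodule, of z] zk u Z(2) by blast
        then show "u \<in> Z" unfolding zk(3) using F.submodD(4)[OF Z(1)] zk KZ by blast
      qed
    qed
  qed
  obtain Z' where Z': "?Q Z'" and max: "\<And>N. ?Q N \<Longrightarrow> Z' \<subseteq> N \<Longrightarrow> N = Z'"
    using bounded_length_maximal[OF finite_length[of "a-1" "b+1"], where Q = ?Q, OF Q0] by blast
  have meets: "\<exists>h\<in>N \<inter> HH {a..b}. h \<notin> Z'" if N: "submodule N A F" "Z' \<subset> N" "N \<subseteq> PP ?I" for N
  proof -
    have "\<not> ?Q N" using max[of N] N by blast
    then have "N \<inter> PP {a..b} \<noteq> Z" using N Z' by blast
    then have "Z \<subset> N \<inter> PP {a..b}" using N Z' by blast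
    then obtain h where "h \<in> N" "h \<in> HH {a..b}" "h \<notin> Z"
      using stage_meets[OF st F.submod_Int[OF N(1) PP_submodule]] by blast
    then show ?thesis using Z' HH_PP by blast
  qed
  have "Z' \<inter> HH ?I = KK ?I ?J"
  proof
    show "KK ?I ?J \<subseteq> Z' \<inter> HH ?I" using Z' by (auto simp: KK_def)
    show "Z' \<inter> HH ?I \<subseteq> KK ?I ?J"
    proof
      fix h assume h: "h \<in> Z' \<inter> HH ?I"
      then have hI: "h \<in> HH ?I" by blast
      \<comment> \<open>\<open>h'\<close> has the coordinates of \<open>h\<close> but support in the
        old window, where \<open>Z'\<close> is known; the two differ by an element of
        \<open>KK ?I ?J\<close>.\<close>
      obtain h' where h': "h' \<in> HH {a..b}" "\<And>j. j \<in> ?J \<Longrightarrow> val j h' = val j h"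
        using val_prescribed[OF ab, of "\<lambda>j. val j h"] val_closed[OF hI] by blast
      have h'I: "h' \<in> HH ?I" using h' sub by blast
      have "val j (h \<ominus>\<^bsub>F\<^esub> h') = \<zero>\<^bsub>L\<^esub>" if "j \<in> ?J" for j
        unfolding val_minus[OF hI h'I] h'(2)[OF that] using val_closed[OF hI] by (simp add: a_minus_def L.M.r_neg)
      then have "h \<ominus>\<^bsub>F\<^esub> h' \<in> Z'" using F.submodD(6)[OF HH_submodule hI h'I] Z' by (auto simp: KK_def)
      moreover have "h' = h \<ominus>\<^bsub>F\<^esub> (h \<ominus>\<^bsub>F\<^esub> h')" using HH_carrier[OF hI] HH_carrier[OF h'I] by algebra
      ultimately have "h' \<in> Z'" using F.submodD(6)[of Z'] Z' h by (metis IntD1)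
      then have "h' \<in> Z" using Z' h' HH_PP by blast
      then have "h' \<in> KK {a..b} ?J" using Z(3) h' by blast
      then show "h \<in> KK ?I ?J" using hI h'(2) by (auto simp: KK_def)
    qed
  qed
  moreover have "N \<subseteq> HH ?I <+>\<^bsub>F\<^esub> Z'" if N: "covers A F N Z'" "N \<subseteq> PP ?I" for N
  proof -
    obtain h where "h \<in> N" "h \<in> HH {a..b}" "h \<notin> Z'" using meets[of N] N by (auto simp: covers_def)
    then show ?thesis using F.cover_meets[OF N(1) HH_submodule] sub by blast
  qed
  ultimately have "stage (a - 1) (b + 1) ?J Z'" using Z' ab by (auto simp: stage_def)
  with Z' meets show ?thesis using that by blast
qed

text \<open>The two traces differ by one coordinate, that is, by a copy of the simple module
  \<open>L\<close>, so nothing lies strictly between them.\<close>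

lemma socle_between:
  assumes V: "submodule V A F" "Z1 \<subseteq> V" "V \<subseteq> Z2"
    and Z1: "Z1 \<inter> HH I = KK I (insert j J)" and Z2: "Z2 \<inter> HH I = KK I J"
  shows "V \<inter> HH I = KK I J \<or> V \<inter> HH I = KK I (insert j J)"
proof (cases "\<exists>h\<in>V \<inter> HH I. val j h \<noteq> \<zero>\<^bsub>L\<^esub>")
  case True
  then obtain h where h: "h \<in> V" "h \<in> HH I" "val j h \<noteq> \<zero>\<^bsub>L\<^esub>" by blast
  have hJ: "h \<in> KK I J" using h V Z2 by blast
  have "KK I J \<subseteq> V"
  proof
    fix h' assume h': "h' \<in> KK I J"
    then have h'H: "h' \<in> HH I" by (simp add: KK_def)
    obtain a where a: "a \<in> carrier A" "val j h' = a \<odot>\<^bsub>L\<^esub> val j h"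
      using L_simple val_closed[OF h(2)] val_closed[OF h'H] h(3) by metis
    have ah: "a \<odot>\<^bsub>F\<^esub> h \<in> KK I J" "a \<odot>\<^bsub>F\<^esub> h \<in> V" "a \<odot>\<^bsub>F\<^esub> h \<in> HH I"
      using F.submodD(7)[OF KK_submodule a(1) hJ] F.submodD(7)[OF V(1) a(1) h(1)]
        F.submodD(7)[OF HH_submodule a(1) h(2)] by auto
    have "h' \<ominus>\<^bsub>F\<^esub> a \<odot>\<^bsub>F\<^esub> h \<in> KK I J" by (rule F.submodD(6)[OF KK_submodule h' ah(1)])
    moreover have "val j (h' \<ominus>\<^bsub>F\<^esub> a \<odot>\<^bsub>F\<^esub> h) = \<zero>\<^bsub>L\<^esub>"
      unfolding val_minus[OF h'H ah(3)] val_smult[OF a(1) h(2)] a(2)[symmetric]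
      using val_closed[OF h'H] by (simp add: a_minus_def L.M.r_neg)
    ultimately have "h' \<ominus>\<^bsub>F\<^esub> a \<odot>\<^bsub>F\<^esub> h \<in> KK I (insert j J)" by (simp add: KK_def)
    then have "h' \<ominus>\<^bsub>F\<^esub> a \<odot>\<^bsub>F\<^esub> h \<in> V" using Z1 V by blast
    then show "h' \<in> V" using F.submod_diff_cancel[OF V(1) ah(2) HH_carrier[OF h'H]] by blast
  qed
  then show ?thesis using V Z2 by (auto simp: KK_def)
next
  case False
  then have "V \<inter> HH I \<subseteq> KK I (insert j J)" using V Z2 by (auto simp: KK_def)
  moreover have "KK I (insert j J) \<subseteq> V \<inter> HH I" using Z1 V by blast
  ultimately show ?thesis by blast
qed

section \<open>One turn of the accordion\<close>

lemma single_generates: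
  assumes V: "submodule V A F" and p: "single A i p \<in> V" "p \<in> P" "p \<notin> P'" and q: "q \<in> P"
  shows "single A i q \<in> V"
proof -
  obtain a where "a \<in> carrier A" "q = a \<otimes> p" using P_local p q by blast
  then show ?thesis using F.submodD(7)[OF V _ p(1)] smult_single by metis
qed

text \<open>Subtracting its part over \<open>I\<close> leaves \<open>v\<close> with a single entry
  at \<open>k\<close> outside \<open>P'\<close>, and this entry generates a full copy of
  \<open>P\<close>.\<close>

lemma PP_insert_subset:
  assumes V: "submodule V A F" and PV: "PP I \<subseteq> V" and I: "finite I"
    and v: "v \<in> V" "v \<in> PP (insert k I)" "v k \<notin> P'"
  shows "PP (insert k I) \<subseteq> V"
proof
  let ?r = "restr I v"
  have r: "?r \<in> PP I" by (rule restr_PP[OF v(2)])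
  fix u assume u: "u \<in> PP (insert k I)"
  show "u \<in> V"
  proof (rule submodule_of_singles[OF V, of "insert k I"])
    fix i assume i: "i \<in> insert k I"
    show "single A i (u i) \<in> V"
    proof (cases "i \<in> I")
      case True
      then show ?thesis using single_PP[OF PP_PD[OF u] True] PV by blast
    next
      case False
      then have ik: "i = k" "k \<notin> I" using i by auto
      have "v \<ominus>\<^bsub>F\<^esub> ?r = single A k (v k)"
      proof
        fix j
        have "v j \<in> carrier A" using PP_PD[OF v(2)] P_carrier by blast
        then show "(v \<ominus>\<^bsub>F\<^esub> ?r) j = single A k (v k) j"
          unfolding F_minus[OF PP_carrier[OF v(2)] PP_carrier[OF r]]
          using v(2) ik(2) by (auto simp: restr_def single_def PP_def a_minus_def r_neg)
      qed
      moreover have "v \<ominus>\<^bsub>F\<^esub> ?r \<in> V" using F.submodD(6)[OF V v(1)] r PV by blast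
      ultimately have "single A k (v k) \<in> V" by simp
      then show ?thesis unfolding ik(1)
        using single_generates[OF V _ PP_PD[OF v(2)] v(3) PP_PD[OF u]] by blast
    qed
  qed (use I u PP_carrier[OF u] in \<open>auto simp: PP_def\<close>)
qed

text \<open>The coordinates stay fixed while the top of \<open>V\<close> varies: new top at neither
  end gives the preprojective shape, at \<open>a - 1\<close> only the regular one, at both ends the
  preinjective one. Hypothesis \<open>R\<close> excludes new top at \<open>b + 1\<close>
  alone.\<close>

lemma uniform_step:
  assumes ab: "a \<le> b" and Z: "submodule Z A F" "Z \<subseteq> PP {a-1..b+1}" "Z \<inter> HH {a-1..b+1} = KK {a-1..b+1} {a..b+1}"
    and meets: "\<And>N. \<lbrakk>submodule N A F; Z \<subset> N; N \<subseteq> PP {a-1..b+1}\<rbrakk> \<Longrightarrow> \<exists>h\<in>N \<inter> HH {a..b}. h \<notin> Z"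
    and V: "submodule V A F" "PP {a..b} \<subseteq> V" "Z \<subseteq> V"
    and R: "V \<subseteq> PP {a-1..b} <+>\<^bsub>F\<^esub> Z \<or> PP {a-1..b} \<subseteq> V \<and> V \<subseteq> PP {a-1..b+1}"
  shows "indecomposable_section A F V Z"
proof -
  let ?I = "{a-1..b+1}" and ?J = "{a..b+1}"
  have ZR: "Z \<subseteq> RR" by (rule stage_RR[OF Z]) (use ab in auto)
  have sub: "PP {a-1..b} <+>\<^bsub>F\<^esub> Z \<subseteq> PP ?I"
    by (rule F.submod_add_least[OF PP_submodule PP_mono Z(2)]) auto
  then have VI: "V \<subseteq> PP ?I" using R by auto
  have sec: "indecomposable_section A F V Z"
    if "PP {c..d} \<subseteq> V" "\<And>v i. \<lbrakk>v \<in> V; i \<notin> {c..d}\<rbrakk> \<Longrightarrow> v i \<in> P'" "arrow_type c d ?J" "{c..d} \<subseteq> ?I" for c d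
  proof (rule essential_section[where I = ?I and J = ?J and c = c and d = d and ?I0.0 = "{a..b}"])
    show "\<And>v i. v \<in> V \<Longrightarrow> i \<notin> {c..d} \<Longrightarrow> v i \<in> P'" by (rule that(2))
    show "\<And>N. submodule N A F \<Longrightarrow> Z \<subset> N \<Longrightarrow> N \<subseteq> V \<Longrightarrow> \<exists>h\<in>N \<inter> HH {a..b}. h \<notin> Z"
      using meets VI by blast
  qed (use V VI Z(3) that(1,3,4) in auto)
  have out: "v i \<in> P'" if "v \<in> V" "i \<notin> ?I" for v i
    using that VI P'_zero by (auto simp: PP_def)
  show ?thesis
  proof (cases "PP {a-1..b} \<subseteq> V \<and> V \<subseteq> PP ?I \<and> (\<exists>v\<in>V. v (b + 1) \<notin> P')")
    case True
    then obtain v where v: "v \<in> V" "v (b + 1) \<notin> P'" by blast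
    have ins: "insert (b + 1) {a-1..b} = ?I" using ab by auto
    have "PP ?I \<subseteq> V"
      using PP_insert_subset[OF V(1), of "{a-1..b}" v "b + 1"] True v VI unfolding ins by auto
    then show ?thesis by (rule sec) (use ab out in \<open>auto simp: arrow_type_def\<close>)
  next
    case noB: False
    have b1: "v (b + 1) \<in> P'" if v: "v \<in> V" for v
    proof (cases "V \<subseteq> PP {a-1..b} <+>\<^bsub>F\<^esub> Z")
      case True
      then obtain p z where pz: "p \<in> PP {a-1..b}" "z \<in> Z" "v = p \<oplus>\<^bsub>F\<^esub> z"
        using v unfolding subset_iff F.mem_set_add by blast
      have "z (b + 1) \<in> P'" using pz ZR by (auto simp: RR_def)
      moreover have "p (b + 1) = \<zero>" using pz by (auto simp: PP_def)
      ultimately show ?thesis unfolding pz(3) using P_carrier P'_P by (simp add: int_functions_simps)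
    next
      case False
      then show ?thesis using noB R v by blast
    qed
    have ins: "insert (a - 1) {a..b} = {a-1..b}" using ab by auto
    show ?thesis
    proof (cases "\<exists>v\<in>V. v (a - 1) \<notin> P'")
      case True
      then obtain v where v: "v \<in> V" "v (a - 1) \<notin> P'" by blast
      have "PP {a-1..b} \<subseteq> V"
      proof (cases "PP {a-1..b} \<subseteq> V")
        case False
        then have "V \<subseteq> PP {a-1..b} <+>\<^bsub>F\<^esub> Z" using R by blast
        then obtain p z where pz: "p \<in> PP {a-1..b}" "z \<in> Z" "v = p \<oplus>\<^bsub>F\<^esub> z"
          using v unfolding subset_iff F.mem_set_add by blast
        have car: "p \<in> carrier F" "z \<in> carrier F" using pz PP_carrier F.submodD(3)[OF Z(1)] by auto
        have "p = v \<ominus>\<^bsub>F\<^esub> z" unfolding pz(3) using car by algebra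
        then have pV: "p \<in> V" using F.submodD(6)[OF V(1)] v pz(2) V(3) by blast
        have "p (a - 1) \<notin> P'"
        proof
          assume "p (a - 1) \<in> P'"
          moreover have "z (a - 1) \<in> P'" using pz ZR by (auto simp: RR_def)
          ultimately show False using v pz P'_add by (simp add: int_functions_simps)
        qed
        then show ?thesis
          using PP_insert_subset[OF V(1,2) _ pV, of "a - 1"] pz(1) unfolding ins by auto
      qed
      then show ?thesis
      proof (rule sec)
        fix v i assume "v \<in> V" "i \<notin> {a-1..b}"
        then show "v i \<in> P'" using b1 out by (cases "i = b + 1") auto
      qed (use ab in \<open>auto simp: arrow_type_def\<close>)
    next
      case False
      show ?thesis
      proof (rule sec[OF V(2)])
        fix v i assume v: "v \<in> V" "i \<notin> {a..b}"
        then consider "i = b + 1" | "i = a - 1" | "i \<notin> ?I" by force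
        then show "v i \<in> P'" using b1 out False v by cases auto
      qed (use ab in \<open>auto simp: arrow_type_def\<close>)
    qed
  qed
qed

text \<open>Modulo \<open>Z\<close>, \<open>ZR\<close>, \<open>ZM\<close> the power
  \<open>PP {a..b}\<close> becomes W(2n-1), R(2n), M(2n); modulo \<open>Z'\<close> the images of
  \<open>PP {a-1..b}\<close> and \<open>PP {a-1..b+1}\<close> are R(2n+1) and W(2n+1). The strict
  inclusions and the two negated ones are kept for non-invertibility.\<close>

lemma stage_step:
  assumes st0: "stage 0 1 {1} Z0" and st: "stage a b {a+1..b} Z" and ab: "a < b"
  obtains ZR ZM Z' where
    "stage (a - 1) (b + 1) {a..b+1} Z'"
    "submodule ZR A F" "submodule ZM A F" "ZM \<subset> ZR" "ZR \<subset> Z" "ZM = PP {a..b} \<inter> Z'"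
    "\<And>V. \<lbrakk>submodule V A F; ZR \<subseteq> V; V \<subseteq> Z\<rbrakk> \<Longrightarrow> indecomposable_section A F (PP {a..b}) V"
    "\<And>V. \<lbrakk>submodule V A F; ZM \<subseteq> V; V \<subseteq> ZR\<rbrakk> \<Longrightarrow> indecomposable_section A F (PP {a..b}) V"
    "\<And>V. \<lbrakk>submodule V A F; PP {a..b} \<subseteq> V; Z' \<subseteq> V; V \<subseteq> PP {a-1..b} <+>\<^bsub>F\<^esub> Z'\<rbrakk> \<Longrightarrow> indecomposable_section A F V Z'"
    "\<And>V. \<lbrakk>submodule V A F; PP {a-1..b} <+>\<^bsub>F\<^esub> Z' \<subseteq> V; V \<subseteq> PP {a-1..b+1}\<rbrakk> \<Longrightarrow> indecomposable_section A F V Z'"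
    "\<not> PP {a-1..b} <+>\<^bsub>F\<^esub> Z' \<subseteq> PP {a..b} <+>\<^bsub>F\<^esub> Z'"
    "\<not> PP {a-1..b+1} \<subseteq> (PP {a-1..b} <+>\<^bsub>F\<^esub> Z') <+>\<^bsub>F\<^esub> Z'"
proof -
  have ab': "a \<le> b" using ab by simp
  have JR: "insert (b + 1) {a+1..b} = {a+1..b+1}" and JM: "insert a {a+1..b+1} = {a..b+1}" using ab by auto
  \<comment> \<open>Tying the last generator to generator \<open>0\<close> of the initial block
    makes the action of \<open>C\<close> on it visible, as coordinate \<open>b + 1\<close>.\<close>
  define ZR where "ZR = {u \<in> Z. single A 0 (u b) \<in> Z0}"
  have stR: "stage a b {a+1..b+1} ZR"
    unfolding ZR_def JR[symmetric]
  proof (rule stage_shrink[OF st st0])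
    fix h assume h: "h \<in> HH {a..b}"
    then have "h (b + 1) = \<zero>" by (simp add: HH_def)
    then show "val 1 (single A 0 (h b)) = val (b + 1) h" by (simp add: val_def single_def v_zero)
  qed (use ab in auto)
  \<comment> \<open>Dually, the first generator is tied to generator \<open>1\<close> of the block,
    and the action of \<open>B\<close> on it appears as coordinate \<open>a\<close>.\<close>
  define ZM where "ZM = {u \<in> ZR. single A 1 (u a) \<in> Z0}"
  have stM: "stage a b {a..b+1} ZM"
    unfolding ZM_def JM[symmetric]
  proof (rule stage_shrink[OF stR st0])
    fix h assume h: "h \<in> HH {a..b}"
    then have "h (a - 1) = \<zero>" by (simp add: HH_def)
    then show "val 1 (single A 1 (h a)) = val a h" by (simp add: val_def single_def v_zero)
  qed (use ab in auto)
  obtain Z' where st': "stage (a - 1) (b + 1) {a..b+1} Z'" and Z'M: "Z' \<inter> PP {a..b} = ZM"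
    and meets: "\<And>N. submodule N A F \<Longrightarrow> Z' \<subset> N \<Longrightarrow> N \<subseteq> PP {a-1..b+1} \<Longrightarrow> \<exists>h\<in>N \<inter> HH {a..b}. h \<notin> Z'"
    using stage_extend[OF stM] by blast
  have Z': "submodule Z' A F" "Z' \<subseteq> PP {a-1..b+1}" "Z' \<inter> HH {a-1..b+1} = KK {a-1..b+1} {a..b+1}"
    using st' by (auto simp: stage_def)
  have Z'RR: "Z' \<subseteq> RR" by (rule stage_RR[OF Z']) (use ab in auto)
  have Zm: "submodule Z A F" "submodule ZR A F" "submodule ZM A F" and HH: "Z \<inter> HH {a..b} = KK {a..b} {a+1..b}"
    "ZR \<inter> HH {a..b} = KK {a..b} {a+1..b+1}" "ZM \<inter> HH {a..b} = KK {a..b} {a..b+1}"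
    using st stR stM by (auto simp: stage_def)
  have ZRZ: "ZR \<subseteq> Z" and ZMR: "ZM \<subseteq> ZR" by (auto simp: ZR_def ZM_def)
  have types: "arrow_type a b {a+1..b}" "arrow_type a b {a+1..b+1}" "arrow_type a b {a..b+1}"
    using ab by (auto simp: arrow_type_def)
  show ?thesis
  proof (rule that[OF st' Zm(2,3)])
    show "ZM \<subset> ZR"
    proof -
      obtain h where "h \<in> HH {a..b}" "val a h \<noteq> \<zero>\<^bsub>L\<^esub>" "\<And>i. i \<in> {a..b+1} \<Longrightarrow> i \<noteq> a \<Longrightarrow> val i h = \<zero>\<^bsub>L\<^esub>"
        using val_nonzero[of a a b] ab by auto
      then have "h \<in> KK {a..b} {a+1..b+1}" "h \<notin> KK {a..b} {a..b+1}" "h \<in> HH {a..b}"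
        using ab by (auto simp: KK_def)
      then show ?thesis using HH ZMR by blast
    qed
    show "ZR \<subset> Z"
    proof -
      obtain h where "h \<in> HH {a..b}" "val (b + 1) h \<noteq> \<zero>\<^bsub>L\<^esub>" "\<And>i. i \<in> {a..b+1} \<Longrightarrow> i \<noteq> b + 1 \<Longrightarrow> val i h = \<zero>\<^bsub>L\<^esub>"
        using val_nonzero[of "b + 1" a b] ab by auto
      then have "h \<in> KK {a..b} {a+1..b}" "h \<notin> KK {a..b} {a+1..b+1}" "h \<in> HH {a..b}"
        using ab by (auto simp: KK_def)
      then show ?thesis using HH ZRZ by blast
    qed
    show "ZM = PP {a..b} \<inter> Z'" using Z'M by blast
    show "indecomposable_section A F (PP {a..b}) V" if V: "submodule V A F" "ZR \<subseteq> V" "V \<subseteq> Z" for V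
      using socle_between[OF V HH(2)[folded JR] HH(1)] projective_section[OF V(1)] types unfolding JR by blast
    show "indecomposable_section A F (PP {a..b}) V" if V: "submodule V A F" "ZM \<subseteq> V" "V \<subseteq> ZR" for V
      using socle_between[OF V HH(3)[folded JM] HH(2)] projective_section[OF V(1)] types unfolding JM by blast
    show "indecomposable_section A F V Z'"
      if V: "submodule V A F" "PP {a..b} \<subseteq> V" "Z' \<subseteq> V" "V \<subseteq> PP {a-1..b} <+>\<^bsub>F\<^esub> Z'" for V
      by (rule uniform_step[OF ab' Z' meets]) (use V in auto)
    show "indecomposable_section A F V Z'"
      if V: "submodule V A F" "PP {a-1..b} <+>\<^bsub>F\<^esub> Z' \<subseteq> V" "V \<subseteq> PP {a-1..b+1}" for V
    proof -
      have "PP {a-1..b} \<subseteq> V" "Z' \<subseteq> V"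
        using V(2) F.submod_add_upper1[OF PP_submodule Z'(1)] F.submod_add_upper2[OF PP_submodule Z'(1)] by blast+
      moreover have "PP {a..b} \<subseteq> PP {a-1..b}" by (rule PP_mono) auto
      ultimately show ?thesis by (intro uniform_step[OF ab' Z' meets]) (use V in auto)
    qed
    have RRD: "z i \<in> P'" "z i \<in> carrier A" if "z \<in> Z'" for z i
      using that Z'RR P'_P P_carrier by (auto simp: RR_def)
    show "\<not> PP {a-1..b} <+>\<^bsub>F\<^esub> Z' \<subseteq> PP {a..b} <+>\<^bsub>F\<^esub> Z'"
    proof
      assume sub: "PP {a-1..b} <+>\<^bsub>F\<^esub> Z' \<subseteq> PP {a..b} <+>\<^bsub>F\<^esub> Z'"
      \<comment> \<open>If the new generator were congruent to an element of the old window modulo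
        \<open>Z'\<close>, then \<open>e\<close> would be an entry of an element of
        \<open>Z'\<close>, but these entries lie in \<open>P'\<close>.\<close>
      have "single A (a - 1) e \<in> PP {a-1..b}" by (rule single_PP[OF e_P]) (use ab in auto)
      then have "single A (a - 1) e \<in> PP {a..b} <+>\<^bsub>F\<^esub> Z'"
        using sub F.submod_add_upper1[OF PP_submodule Z'(1)] by blast
      then obtain p z where pz: "p \<in> PP {a..b}" "z \<in> Z'" "single A (a - 1) e = p \<oplus>\<^bsub>F\<^esub> z"
        unfolding F.mem_set_add by blast
      have "e = p (a - 1) \<oplus> z (a - 1)" using fun_cong[OF pz(3), of "a - 1"] by (simp add: single_def int_functions_simps)
      moreover have "p (a - 1) \<oplus> z (a - 1) = z (a - 1)" using pz RRD by (simp add: PP_def)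
      ultimately show False using RRD(1)[OF pz(2), of "a - 1"] e_P' by simp
    qed
    show "\<not> PP {a-1..b+1} \<subseteq> (PP {a-1..b} <+>\<^bsub>F\<^esub> Z') <+>\<^bsub>F\<^esub> Z'"
    proof
      assume sub: "PP {a-1..b+1} \<subseteq> (PP {a-1..b} <+>\<^bsub>F\<^esub> Z') <+>\<^bsub>F\<^esub> Z'"
      have "single A (b + 1) e \<in> PP {a-1..b+1}" by (rule single_PP[OF e_P]) (use ab in auto)
      then have "single A (b + 1) e \<in> (PP {a-1..b} <+>\<^bsub>F\<^esub> Z') <+>\<^bsub>F\<^esub> Z'" using sub by blast
      then obtain r z' where rz: "r \<in> PP {a-1..b} <+>\<^bsub>F\<^esub> Z'" "z' \<in> Z'" "single A (b + 1) e = r \<oplus>\<^bsub>F\<^esub> z'"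
        unfolding F.mem_set_add[of _ "PP {a-1..b} <+>\<^bsub>F\<^esub> Z'"] by blast
      then obtain p z where pz: "p \<in> PP {a-1..b}" "z \<in> Z'" "z' \<in> Z'" "single A (b + 1) e = p \<oplus>\<^bsub>F\<^esub> z \<oplus>\<^bsub>F\<^esub> z'"
        unfolding F.mem_set_add by blast
      have "e = p (b + 1) \<oplus> z (b + 1) \<oplus> z' (b + 1)"
        using fun_cong[OF pz(4), of "b + 1"] by (simp add: single_def int_functions_simps)
      moreover have "p (b + 1) \<oplus> z (b + 1) = z (b + 1)" using pz RRD by (simp add: PP_def)
      moreover have "z (b + 1) \<oplus> z' (b + 1) \<in> P'" using P'_add RRD(1) pz by blast
      ultimately show False using e_P' by simp
    qed
  qed
qed

end

section \<open>Kronecker data from a non-distributive ideal lattice\<close>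

text \<open>Ideals form a modular lattice, and a non-distributive modular lattice contains a
  diamond. The formulas come from the free modular lattice on \<open>I\<close>, \<open>J\<close>,
  \<open>L\<close>: \<open>D\<close> is the lower median, and \<open>B\<close>, \<open>C\<close>,
  \<open>E\<close> are the three atoms of the diamond above it.\<close>

lemma (in ring) diamond_of_ideals:
  assumes "\<not> distributive_ideal_lattice R"
  obtains B C D E where "ideal B R" "ideal C R" "ideal D R" "ideal E R"
    "D \<subseteq> B" "D \<subseteq> E" "\<not> B \<subseteq> D" "B \<inter> C \<subseteq> D" "B \<inter> E \<subseteq> D" "B \<subseteq> C <+>\<^bsub>R\<^esub> E" "C \<subseteq> B <+>\<^bsub>R\<^esub> E"
proof -
  obtain I J L where I: "ideal I R" and J: "ideal J R" and L: "ideal L R"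
    and ne: "I \<inter> (J <+>\<^bsub>R\<^esub> L) \<noteq> (I \<inter> J) <+>\<^bsub>R\<^esub> (I \<inter> L)"
    using assms unfolding distributive_ideal_lattice_def by blast
  interpret I: ideal I R by fact
  interpret J: ideal J R by fact
  interpret L: ideal L R by fact
  have "(I \<inter> J) <+>\<^bsub>R\<^esub> (I \<inter> L) \<subseteq> I \<inter> (J <+>\<^bsub>R\<^esub> L)"
    using I.a_closed unfolding subset_iff Int_iff set_add_mem by blast
  with ne obtain i0 where i0: "i0 \<in> I" "i0 \<in> J <+>\<^bsub>R\<^esub> L" "i0 \<notin> (I \<inter> J) <+>\<^bsub>R\<^esub> (I \<inter> L)" by blast
  define D where "D = ((I \<inter> J) <+>\<^bsub>R\<^esub> (I \<inter> L)) <+>\<^bsub>R\<^esub> (J \<inter> L)"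
  define B where "B = (I \<inter> (J <+>\<^bsub>R\<^esub> L)) <+>\<^bsub>R\<^esub> D"
  define C where "C = (J \<inter> (I <+>\<^bsub>R\<^esub> L)) <+>\<^bsub>R\<^esub> D"
  define E where "E = (L \<inter> (I <+>\<^bsub>R\<^esub> J)) <+>\<^bsub>R\<^esub> D"
  have Did: "ideal D R" unfolding D_def by (intro add_ideals i_intersect I J L)
  interpret D: ideal D R by fact
  have id: "ideal B R" "ideal C R" "ideal E R"
    unfolding B_def C_def E_def by (intro add_ideals i_intersect I J L Did)+
  have DE: "\<exists>p\<in>I \<inter> J. \<exists>q\<in>I \<inter> L. \<exists>r\<in>J \<inter> L. d = p \<oplus> q \<oplus> r" if "d \<in> D" for d
  proof -
    obtain s r where "s \<in> (I \<inter> J) <+>\<^bsub>R\<^esub> (I \<inter> L)" "r \<in> J \<inter> L" "d = s \<oplus> r"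
      using \<open>d \<in> D\<close> unfolding D_def set_add_mem[of _ R "(I \<inter> J) <+>\<^bsub>R\<^esub> (I \<inter> L)"] by blast
    then show ?thesis unfolding set_add_mem by blast
  qed
  have DI: "p \<oplus> q \<oplus> r \<in> D" if "p \<in> I \<inter> J" "q \<in> I \<inter> L" "r \<in> J \<inter> L" for p q r
  proof -
    have "p \<oplus> q \<in> (I \<inter> J) <+>\<^bsub>R\<^esub> (I \<inter> L)" unfolding set_add_mem using that by blast
    then show ?thesis
      unfolding D_def set_add_mem[of _ R "(I \<inter> J) <+>\<^bsub>R\<^esub> (I \<inter> L)"] using that by blast
  qed
  \<comment> \<open>Write \<open>d' - d\<close> as \<open>p + q + r\<close>. The one summand that
    need not lie in the ideal of \<open>j\<close> lies in \<open>I\<close>; moved to the left it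
    leaves an element of \<open>I \<inter> J\<close> or of \<open>I \<inter> L\<close>.\<close>
  have meet: "i \<in> D" if ij: "i \<in> I" "j \<in> J \<or> j \<in> L" "i \<oplus> d = j \<oplus> d'" "d \<in> D" "d' \<in> D" for i j d d'
  proof -
    have car: "i \<in> carrier R" "j \<in> carrier R" "d \<in> carrier R" "d' \<in> carrier R"
      using ij I.Icarr J.Icarr L.Icarr D.Icarr by auto
    have "d' \<ominus> d \<in> D" unfolding a_minus_def using ij D.a_closed D.a_inv_closed by blast
    then obtain p q r where pqr: "p \<in> I \<inter> J" "q \<in> I \<inter> L" "r \<in> J \<inter> L" "d' \<ominus> d = p \<oplus> q \<oplus> r" using DE by blast
    have c2: "p \<in> carrier R" "q \<in> carrier R" "r \<in> carrier R" using pqr I.Icarr J.Icarr by auto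
    have "i = (i \<oplus> d) \<ominus> d" using car by algebra
    also have "\<dots> = j \<oplus> (d' \<ominus> d)" unfolding ij(3) using car by algebra
    finally have i: "i = j \<oplus> (p \<oplus> q \<oplus> r)" unfolding pqr(4) .
    show ?thesis using ij(2)
    proof
      assume j: "j \<in> J"
      have e: "i \<ominus> q = j \<oplus> p \<oplus> r" unfolding i using car c2 by algebra
      have "j \<oplus> p \<oplus> r \<in> J" using j pqr J.a_closed by blast
      moreover have "i \<ominus> q \<in> I" unfolding a_minus_def using ij pqr I.a_closed I.a_inv_closed by blast
      ultimately have "(i \<ominus> q) \<in> I \<inter> J" unfolding e by blast
      then have "(i \<ominus> q) \<oplus> q \<oplus> \<zero> \<in> D" using DI pqr J.zero_closed L.zero_closed by blast
      moreover have "(i \<ominus> q) \<oplus> q \<oplus> \<zero> = i" using car c2 by algebra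
      ultimately show ?thesis by simp
    next
      assume j: "j \<in> L"
      have e: "i \<ominus> p = j \<oplus> q \<oplus> r" unfolding i using car c2 by algebra
      have "j \<oplus> q \<oplus> r \<in> L" using j pqr L.a_closed by blast
      moreover have "i \<ominus> p \<in> I" unfolding a_minus_def using ij pqr I.a_closed I.a_inv_closed by blast
      ultimately have "(i \<ominus> p) \<in> I \<inter> L" unfolding e by blast
      then have "p \<oplus> (i \<ominus> p) \<oplus> \<zero> \<in> D" using DI pqr J.zero_closed L.zero_closed by blast
      moreover have "p \<oplus> (i \<ominus> p) \<oplus> \<zero> = i" using car c2 by algebra
      ultimately show ?thesis by simp
    qed
  qed
  show ?thesis
  proof (rule that[OF id(1,2) Did id(3)])
    show "D \<subseteq> B"
    proof
      fix d assume "d \<in> D"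
      moreover have "\<zero> \<in> I \<inter> (J <+>\<^bsub>R\<^esub> L)"
        using I.zero_closed J.zero_closed L.zero_closed r_zero zero_closed unfolding Int_iff set_add_mem by metis
      moreover have "d = \<zero> \<oplus> d" using D.Icarr \<open>d \<in> D\<close> by simp
      ultimately show "d \<in> B" unfolding B_def set_add_mem[of _ R "I \<inter> (J <+>\<^bsub>R\<^esub> L)"] by blast
    qed
    show "D \<subseteq> E"
    proof
      fix d assume "d \<in> D"
      moreover have "\<zero> \<in> L \<inter> (I <+>\<^bsub>R\<^esub> J)"
        using I.zero_closed J.zero_closed L.zero_closed r_zero zero_closed unfolding Int_iff set_add_mem by metis
      moreover have "d = \<zero> \<oplus> d" using D.Icarr \<open>d \<in> D\<close> by simp
      ultimately show "d \<in> E" unfolding E_def set_add_mem[of _ R "L \<inter> (I <+>\<^bsub>R\<^esub> J)"] by blast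
    qed
    show "\<not> B \<subseteq> D"
    proof
      assume "B \<subseteq> D"
      moreover have "i0 = i0 \<oplus> \<zero>" using i0 I.Icarr by simp
      then have "i0 \<in> B" unfolding B_def set_add_mem[of _ R "I \<inter> (J <+>\<^bsub>R\<^esub> L)"] using i0 D.zero_closed by blast
      ultimately have "i0 \<in> D" by blast
      then obtain p q r where pqr: "p \<in> I \<inter> J" "q \<in> I \<inter> L" "r \<in> J \<inter> L" "i0 = p \<oplus> q \<oplus> r" using DE by blast
      have c: "p \<in> carrier R" "q \<in> carrier R" "r \<in> carrier R" using pqr I.Icarr J.Icarr by auto
      \<comment> \<open>As \<open>i0\<close>, \<open>p\<close> and \<open>q\<close> lie in
        \<open>I\<close>, so does \<open>r\<close>; then \<open>q + r\<close> is in
        \<open>I \<inter> L\<close>, against the choice of \<open>i0\<close>.\<close>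
      have "r = i0 \<ominus> p \<ominus> q" unfolding pqr(4) using c by algebra
      moreover have "i0 \<ominus> p \<ominus> q \<in> I"
        unfolding a_minus_def using i0(1) pqr(1,2) I.a_closed I.a_inv_closed by blast
      ultimately have "r \<in> I" by simp
      then have "q \<oplus> r \<in> I \<inter> L" using pqr I.a_closed L.a_closed by blast
      moreover have "i0 = p \<oplus> (q \<oplus> r)" unfolding pqr(4) using c by algebra
      ultimately show False using i0(3) pqr(1) unfolding set_add_mem by blast
    qed
    show "B \<inter> C \<subseteq> D"
    proof
      fix u assume u: "u \<in> B \<inter> C"
      obtain i d where "i \<in> I" "d \<in> D" "u = i \<oplus> d"
        using u unfolding B_def Int_iff set_add_mem[of _ _ _ D] by blast
      moreover obtain j d' where "j \<in> J" "d' \<in> D" "u = j \<oplus> d'"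
        using u unfolding C_def Int_iff set_add_mem[of _ _ _ D] by blast
      ultimately have "i \<in> I" "d \<in> D" "u = i \<oplus> d" "j \<in> J" "d' \<in> D" "u = j \<oplus> d'" by auto
      then show "u \<in> D" using meet[of i j d d'] D.a_closed[of i d] by auto
    qed
    show "B \<inter> E \<subseteq> D"
    proof
      fix u assume u: "u \<in> B \<inter> E"
      obtain i d where "i \<in> I" "d \<in> D" "u = i \<oplus> d"
        using u unfolding B_def Int_iff set_add_mem[of _ _ _ D] by blast
      moreover obtain j d' where "j \<in> L" "d' \<in> D" "u = j \<oplus> d'"
        using u unfolding E_def Int_iff set_add_mem[of _ _ _ D] by blast
      ultimately have "i \<in> I" "d \<in> D" "u = i \<oplus> d" "j \<in> L" "d' \<in> D" "u = j \<oplus> d'" by auto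
      then show "u \<in> D" using meet[of i j d d'] D.a_closed[of i d] by auto
    qed
    show "B \<subseteq> C <+>\<^bsub>R\<^esub> E"
    proof
      fix u assume "u \<in> B"
      then obtain i d where u: "i \<in> I" "i \<in> J <+>\<^bsub>R\<^esub> L" "d \<in> D" "u = i \<oplus> d"
        unfolding B_def set_add_mem[of _ _ _ D] by blast
      then obtain j l where jl: "j \<in> J" "l \<in> L" "i = j \<oplus> l" unfolding set_add_mem by blast
      have car: "i \<in> carrier R" "j \<in> carrier R" "l \<in> carrier R" "d \<in> carrier R"
        using u jl I.Icarr J.Icarr L.Icarr D.Icarr by auto
      have "j = i \<oplus> (\<ominus> l)" "l = i \<oplus> (\<ominus> j)" unfolding jl(3) using car by algebra+
      then have "j \<in> I <+>\<^bsub>R\<^esub> L" "l \<in> I <+>\<^bsub>R\<^esub> J"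
        using u(1) jl L.a_inv_closed J.a_inv_closed unfolding set_add_mem by blast+
      then have "j \<oplus> \<zero> \<in> C" "l \<oplus> d \<in> E"
        unfolding C_def E_def set_add_mem[of _ _ _ D] using jl u D.zero_closed by blast+
      moreover have "u = (j \<oplus> \<zero>) \<oplus> (l \<oplus> d)" unfolding u(4) jl(3) using car by algebra
      ultimately show "u \<in> C <+>\<^bsub>R\<^esub> E" unfolding set_add_mem[of _ R C E] by blast
    qed
    show "C \<subseteq> B <+>\<^bsub>R\<^esub> E"
    proof
      fix u assume "u \<in> C"
      then obtain j d where u: "j \<in> J" "j \<in> I <+>\<^bsub>R\<^esub> L" "d \<in> D" "u = j \<oplus> d"
        unfolding C_def set_add_mem[of _ _ _ D] by blast
      then obtain i l where jl: "i \<in> I" "l \<in> L" "j = i \<oplus> l" unfolding set_add_mem by blast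
      have car: "i \<in> carrier R" "j \<in> carrier R" "l \<in> carrier R" "d \<in> carrier R"
        using u jl I.Icarr J.Icarr L.Icarr D.Icarr by auto
      have "i = j \<oplus> (\<ominus> l)" "l = (\<ominus> i) \<oplus> j" unfolding jl(3) using car by algebra+
      then have "i \<in> J <+>\<^bsub>R\<^esub> L" "l \<in> I <+>\<^bsub>R\<^esub> J"
        using u(1) jl L.a_inv_closed I.a_inv_closed unfolding set_add_mem by blast+
      then have "i \<oplus> \<zero> \<in> B" "l \<oplus> d \<in> E"
        unfolding B_def E_def set_add_mem[of _ _ _ D] using jl u D.zero_closed by blast+
      moreover have "u = (i \<oplus> \<zero>) \<oplus> (l \<oplus> d)" unfolding u(4) jl(3) using car by algebra
      ultimately show "u \<in> B <+>\<^bsub>R\<^esub> E" unfolding set_add_mem[of _ R B E] by blast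
    qed
  qed
qed

text \<open>Two extremal choices are made. Minimality of \<open>P\<close> yields
  \<open>P_local\<close>; maximality of \<open>Q\<close> among the left ideals between
  \<open>D\<close> and \<open>B\<close> that do not contain \<open>B e\<close> yields simplicity of
  \<open>L = (B e + Q) / Q\<close>.\<close>

lemma (in ring) kronecker_data_exists:
  assumes nd: "\<not> distributive_ideal_lattice R" and bl: "bounded_length R (regular_module R) (carrier R)"
  shows "\<exists>B C (L :: ('a, 'a) module) e vB vC. kronecker_data R B C L e vB vC"
proof -
  obtain B C D E where ids: "ideal B R" "ideal C R" "ideal D R" "ideal E R"
    and lat: "D \<subseteq> B" "D \<subseteq> E" "\<not> B \<subseteq> D" "B \<inter> C \<subseteq> D" "B \<inter> E \<subseteq> D" "B \<subseteq> C <+>\<^bsub>R\<^esub> E" "C \<subseteq> B <+>\<^bsub>R\<^esub> E"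
    using diamond_of_ideals[OF nd] by metis
  interpret B: ideal B R by fact
  interpret C: ideal C R by fact
  interpret D: ideal D R by fact
  interpret E: ideal E R by fact
  let ?M = "regular_module R"
  interpret M: left_module R ?M by (rule left_module_regular)
  have sI: "submodule N R ?M" if "N \<subseteq> carrier R" "\<zero> \<in> N" "\<And>x y. x \<in> N \<Longrightarrow> y \<in> N \<Longrightarrow> x \<oplus> y \<in> N"
    "\<And>a x. a \<in> carrier R \<Longrightarrow> x \<in> N \<Longrightarrow> a \<otimes> x \<in> N" for N
    by (rule M.submodI) (use that in auto)
  note sD = M.submodD[simplified]
  have sCyc: "submodule {a \<otimes> p | a. a \<in> T} R ?M"
    if "p \<in> carrier R" "T = carrier R \<or> T = B" for p T
  proof (rule sI)
    have T: "T \<subseteq> carrier R" "\<zero> \<in> T" "\<And>x y. x \<in> T \<Longrightarrow> y \<in> T \<Longrightarrow> x \<oplus> y \<in> T"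
      "\<And>a x. a \<in> carrier R \<Longrightarrow> x \<in> T \<Longrightarrow> a \<otimes> x \<in> T"
      using that(2) B.Icarr B.zero_closed B.a_closed B.I_l_closed by auto
    show "{a \<otimes> p | a. a \<in> T} \<subseteq> carrier R" using T that by auto
    show "\<zero> \<in> {a \<otimes> p | a. a \<in> T}" using T(2) that(1) by (auto intro!: exI[of _ \<zero>])
    fix x y assume "x \<in> {a \<otimes> p | a. a \<in> T}" "y \<in> {a \<otimes> p | a. a \<in> T}"
    then obtain a b where ab: "a \<in> T" "b \<in> T" "x = a \<otimes> p" "y = b \<otimes> p" by auto
    then have "x \<oplus> y = (a \<oplus> b) \<otimes> p" using T(1) that(1) by (simp add: l_distr subsetD)
    then show "x \<oplus> y \<in> {a \<otimes> p | a. a \<in> T}" using T(3) ab by auto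
  next
    have T: "T \<subseteq> carrier R" "\<And>a x. a \<in> carrier R \<Longrightarrow> x \<in> T \<Longrightarrow> a \<otimes> x \<in> T"
      using that(2) B.Icarr B.I_l_closed by auto
    fix c x assume c: "c \<in> carrier R" and "x \<in> {a \<otimes> p | a. a \<in> T}"
    then obtain a where a: "a \<in> T" "x = a \<otimes> p" by auto
    then have "c \<otimes> x = (c \<otimes> a) \<otimes> p" using T(1) that(1) c by (simp add: m_assoc subsetD)
    then show "c \<otimes> x \<in> {a \<otimes> p | a. a \<in> T}" using T(2) a c by auto
  qed
  define Q1 where "Q1 N \<longleftrightarrow> submodule N R ?M \<and> (\<exists>x\<in>B. \<exists>p\<in>N. x \<otimes> p \<notin> D)" for N
  have Q1_0: "Q1 (carrier R)"
  proof -
    obtain x where "x \<in> B" "x \<notin> D" using lat by blast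
    then have x1: "x \<in> B" "x \<otimes> \<one> \<notin> D" using B.Icarr by auto
    have "submodule (carrier R) R ?M" using M.submod_carrier by simp
    then show ?thesis unfolding Q1_def using x1 one_closed by blast
  qed
  have Q1_sub: "\<And>N. Q1 N \<Longrightarrow> submodule N R ?M \<and> N \<subseteq> carrier R"
    unfolding Q1_def using sD(1) by blast
  obtain P where P: "Q1 P" and minP: "\<And>N. Q1 N \<Longrightarrow> N \<subseteq> P \<Longrightarrow> N = P"
    using bounded_length_minimal[where Q = Q1, OF bl Q1_0 Q1_sub] by blast
  obtain x0 e where e: "x0 \<in> B" "e \<in> P" "x0 \<otimes> e \<notin> D" using P unfolding Q1_def by blast
  have Psub: "submodule P R ?M" using P by (simp add: Q1_def)
  have eR: "e \<in> carrier R" using sD(3)[OF Psub] e by blast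
  \<comment> \<open>Any \<open>p\<close> with \<open>B p\<close> outside \<open>D\<close> generates
    a competitor inside \<open>P\<close>, hence all of \<open>P\<close>.\<close>
  have PminD: "{a \<otimes> p | a. a \<in> carrier R} = P" if "p \<in> P" "x \<in> B" "x \<otimes> p \<notin> D" for p x
  proof (rule minP)
    have p: "p \<in> carrier R" using sD(3)[OF Psub] that by blast
    have "p \<in> {a \<otimes> p | a. a \<in> carrier R}" using p by (auto intro!: exI[of _ \<one>])
    then show "Q1 {a \<otimes> p | a. a \<in> carrier R}" unfolding Q1_def using sCyc[OF p] that by blast
    show "{a \<otimes> p | a. a \<in> carrier R} \<subseteq> P" using sD(7)[OF Psub] that by auto
  qed
  have PE: "P = {a \<otimes> e | a. a \<in> carrier R}" using PminD e by blast
  define Q2 where "Q2 N \<longleftrightarrow> submodule N R ?M \<and> D \<subseteq> N \<and> N \<subseteq> B \<and> (\<exists>x\<in>B. x \<otimes> e \<notin> N)" for N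
  have Dsub: "submodule D R ?M" by (rule sI) (auto simp: D.Icarr D.I_l_closed D.a_closed D.zero_closed)
  have Q2_0: "Q2 D" unfolding Q2_def using Dsub lat e by blast
  have Q2_sub: "\<And>N. Q2 N \<Longrightarrow> submodule N R ?M \<and> N \<subseteq> carrier R"
    unfolding Q2_def using sD(1) by blast
  obtain Q where Q: "Q2 Q" and maxQ: "\<And>N. Q2 N \<Longrightarrow> Q \<subseteq> N \<Longrightarrow> N = Q"
    using bounded_length_maximal[where Q = Q2, OF bl Q2_0 Q2_sub] by blast
  have Qsub: "submodule Q R ?M" and DQ: "D \<subseteq> Q" and QB: "Q \<subseteq> B" using Q by (auto simp: Q2_def)
  let ?Be = "{x \<otimes> e | x. x \<in> B}"
  have Besub: "submodule ?Be R ?M" by (rule sCyc[OF eR]) simp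
  have BeB: "?Be \<subseteq> B" using B.I_r_closed eR by auto
  define U where "U = ?Be <+>\<^bsub>?M\<^esub> Q"
  have Usub: "submodule U R ?M" unfolding U_def by (rule M.submod_add[OF Besub Qsub])
  have up: "?Be \<subseteq> U" "Q \<subseteq> U"
    unfolding U_def by (rule M.submod_add_upper1[OF Besub Qsub], rule M.submod_add_upper2[OF Besub Qsub])
  obtain L :: "('a, 'a) module" and h where "presentation R ?M U Q L h"
    using M.presentation_exists[OF Usub Qsub up(2), of "\<lambda>x. x"] by auto
  then interpret L: presentation R ?M U Q L h .
  have hadd: "h (x \<oplus> y) = h x \<oplus>\<^bsub>L\<^esub> h y" if "x \<in> U" "y \<in> U" for x y using L.h_add[OF that] by simp
  have hsm: "h (a \<otimes> x) = a \<odot>\<^bsub>L\<^esub> h x" if "a \<in> carrier R" "x \<in> U" for a x using L.h_smult[OF that] by simp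
  have hker: "h x = \<zero>\<^bsub>L\<^esub> \<longleftrightarrow> x \<in> Q" if "x \<in> U" for x using L.kernel[OF that] .
  have heq: "h x = h y" if "x \<in> U" "y \<in> U" "x \<ominus> y \<in> Q" for x y using L.h_eq_iff[of x y] that by simp
  have hsurj: "\<exists>x\<in>B. l = h (x \<otimes> e)" if l: "l \<in> carrier L" for l
  proof -
    obtain u where u: "u \<in> U" "l = h u" using L.h_surj l by blast
    then obtain x q where x: "x \<in> B" "q \<in> Q" "u = x \<otimes> e \<oplus> q" unfolding U_def M.mem_set_add by auto
    then have "h u = h (x \<otimes> e) \<oplus>\<^bsub>L\<^esub> h q" using hadd up by blast
    also have "h q = \<zero>\<^bsub>L\<^esub>" using hker x up by blast
    finally have "h u = h (x \<otimes> e)" using x up L.h_closed by auto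
    then show ?thesis using x u by blast
  qed
  let ?S = "{x \<otimes> e \<oplus> y \<otimes> e | x y. x \<in> B \<and> y \<in> C}"
  \<comment> \<open>The coordinates start as relations, since an expression \<open>x e + y e\<close>
    is not unique. For \<open>vB\<close> the class of \<open>x e\<close> is well defined because
    \<open>B \<inter> C \<subseteq> D \<subseteq> Q\<close>; for \<open>vC\<close> the element
    \<open>y\<close> is first replaced by a partner in \<open>B\<close> that is congruent to it
    modulo \<open>E\<close>.\<close>
  define gB where "gB s u \<longleftrightarrow> (\<exists>x\<in>B. \<exists>y\<in>C. s = x \<otimes> e \<oplus> y \<otimes> e \<and> u = x \<otimes> e)" for s u
  define gC where "gC s u \<longleftrightarrow> (\<exists>x\<in>B. \<exists>y\<in>C. \<exists>x'\<in>B. s = x \<otimes> e \<oplus> y \<otimes> e \<and> u = x' \<otimes> e \<and> x' \<ominus> y \<in> E)" for s u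
  have diff: "x \<otimes> e \<ominus> x' \<otimes> e \<in> D \<and> y \<otimes> e \<ominus> y' \<otimes> e \<in> D"
    if "x \<in> B" "x' \<in> B" "y \<in> C" "y' \<in> C" "x \<otimes> e \<oplus> y \<otimes> e = x' \<otimes> e \<oplus> y' \<otimes> e" for x x' y y'
  proof -
    have car: "x \<otimes> e \<in> B" "x' \<otimes> e \<in> B" "y \<otimes> e \<in> C" "y' \<otimes> e \<in> C"
      using that eR B.I_r_closed C.I_r_closed by auto
    then have car': "x \<otimes> e \<in> carrier R" "x' \<otimes> e \<in> carrier R" "y \<otimes> e \<in> carrier R" "y' \<otimes> e \<in> carrier R"
      using B.Icarr C.Icarr by auto
    have "x \<otimes> e \<ominus> x' \<otimes> e = (x \<otimes> e \<oplus> y \<otimes> e) \<ominus> (x' \<otimes> e \<oplus> y \<otimes> e)" using car' by algebra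
    also have "\<dots> = y' \<otimes> e \<ominus> y \<otimes> e" unfolding that(5) using car' by algebra
    finally have e1: "x \<otimes> e \<ominus> x' \<otimes> e = y' \<otimes> e \<ominus> y \<otimes> e" .
    have mB: "x \<otimes> e \<ominus> x' \<otimes> e \<in> B" and mC: "y' \<otimes> e \<ominus> y \<otimes> e \<in> C"
      unfolding a_minus_def using car B.a_closed B.a_inv_closed C.a_closed C.a_inv_closed by blast+
    then have d: "x \<otimes> e \<ominus> x' \<otimes> e \<in> D" "y' \<otimes> e \<ominus> y \<otimes> e \<in> D" using e1 lat by auto
    have "y \<otimes> e \<ominus> y' \<otimes> e = \<ominus> (y' \<otimes> e \<ominus> y \<otimes> e)" using car' by algebra
    then show ?thesis using d D.a_inv_closed by simp
  qed
  have gB_U: "u \<in> U" if "gB s u" for s u using that up by (auto simp: gB_def)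
  have gC_U: "u \<in> U" if "gC s u" for s u using that up by (auto simp: gC_def)
  have gB_unique: "h u = h u'" if g: "gB s u" "gB s u'" for s u u'
  proof -
    obtain x y where 1: "x \<in> B" "y \<in> C" "s = x \<otimes> e \<oplus> y \<otimes> e" "u = x \<otimes> e"
      using g(1) by (auto simp: gB_def)
    obtain x' y' where 2: "x' \<in> B" "y' \<in> C" "s = x' \<otimes> e \<oplus> y' \<otimes> e" "u' = x' \<otimes> e"
      using g(2) by (auto simp: gB_def)
    have "u \<ominus> u' \<in> Q" using diff[of x x' y y'] 1 2 DQ by auto
    then show ?thesis using heq[OF gB_U[OF g(1)] gB_U[OF g(2)]] by simp
  qed
  have gC_unique: "h u = h u'" if g: "gC s u" "gC s u'" for s u u'
  proof -
    obtain x y a where 1: "x \<in> B" "y \<in> C" "a \<in> B" "s = x \<otimes> e \<oplus> y \<otimes> e" "u = a \<otimes> e" "a \<ominus> y \<in> E"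
      using g(1) by (auto simp: gC_def)
    obtain x' y' a' where 2: "x' \<in> B" "y' \<in> C" "a' \<in> B" "s = x' \<otimes> e \<oplus> y' \<otimes> e" "u' = a' \<otimes> e" "a' \<ominus> y' \<in> E"
      using g(2) by (auto simp: gC_def)
    have dy: "y \<otimes> e \<ominus> y' \<otimes> e \<in> D" using diff[of x x' y y'] 1 2 by simp
    have car: "a \<in> carrier R" "a' \<in> carrier R" "y \<in> carrier R" "y' \<in> carrier R"
      using 1 2 B.Icarr C.Icarr by auto
    note DE = lat(2)
    \<comment> \<open>Partners are unique only modulo \<open>D\<close>: the difference lies in
      \<open>E\<close>, where \<open>D \<subseteq> E\<close> is used, and in \<open>B\<close>, and
      \<open>B \<inter> E \<subseteq> D \<subseteq> Q\<close>.\<close>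
    have "u \<ominus> u' = (a \<ominus> y) \<otimes> e \<ominus> (a' \<ominus> y') \<otimes> e \<oplus> (y \<otimes> e \<ominus> y' \<otimes> e)"
      unfolding 1 2 using car eR by algebra
    also have "\<dots> \<in> E"
    proof -
      have Em: "v \<ominus> w \<in> E" if "v \<in> E" "w \<in> E" for v w
        unfolding a_minus_def using that E.a_closed E.a_inv_closed by blast
      have "(a \<ominus> y) \<otimes> e \<in> E" "(a' \<ominus> y') \<otimes> e \<in> E" using E.I_r_closed 1(6) 2(6) eR by auto
      then show ?thesis using Em dy DE E.a_closed by blast
    qed
    finally have "u \<ominus> u' \<in> E" .
    moreover have "u \<ominus> u' \<in> B"
    proof -
      have "u \<in> B" "u' \<in> B" unfolding 1(5) 2(5) using 1(3) 2(3) eR B.I_r_closed by auto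
      then show ?thesis unfolding a_minus_def using B.a_closed B.a_inv_closed by blast
    qed
    ultimately have "u \<ominus> u' \<in> D" using lat(5) by blast
    then show ?thesis using heq[OF gC_U[OF g(1)] gC_U[OF g(2)]] DQ by blast
  qed
  have gC_exists: "\<exists>x\<in>B. x \<ominus> y \<in> E" if y: "y \<in> C" for y
  proof -
    have "y \<in> B <+>\<^bsub>R\<^esub> E" using lat(7) y by blast
    then obtain x z where xz: "x \<in> B" "z \<in> E" "y = x \<oplus> z" unfolding set_add_mem by blast
    have "x \<ominus> y = \<ominus> z" using B.Icarr[OF xz(1)] E.Icarr[OF xz(2)] unfolding xz(3) by algebra
    then have "x \<ominus> y \<in> E" using E.a_inv_closed[OF xz(2)] by simp
    then show ?thesis using xz(1) by blast
  qed
  define vB where "vB s = h (SOME u. gB s u)" for s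
  define vC where "vC s = h (SOME u. gC s u)" for s
  have vB: "vB s = h u" if "gB s u" for s u
    using gB_unique[OF someI[of "gB s", OF that] that] by (simp add: vB_def)
  have vC: "vC s = h u" if "gC s u" for s u
    using gC_unique[OF someI[of "gC s", OF that] that] by (simp add: vC_def)
  have S_gB: "\<exists>u. gB s u" if "s \<in> ?S" for s using that by (auto simp: gB_def)
  have S_gC: "\<exists>u. gC s u" if "s \<in> ?S" for s using that gC_exists by (fastforce simp: gC_def)
  have gB_add: "gB (s \<oplus> t) (u \<oplus> w)" if g: "gB s u" "gB t w" for s t u w
  proof -
    obtain x y where 1: "x \<in> B" "y \<in> C" "s = x \<otimes> e \<oplus> y \<otimes> e" "u = x \<otimes> e"
      using g(1) by (auto simp: gB_def)
    obtain x' y' where 2: "x' \<in> B" "y' \<in> C" "t = x' \<otimes> e \<oplus> y' \<otimes> e" "w = x' \<otimes> e"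
      using g(2) by (auto simp: gB_def)
    have car: "x \<in> carrier R" "x' \<in> carrier R" "y \<in> carrier R" "y' \<in> carrier R"
      using 1 2 B.Icarr C.Icarr by auto
    have "s \<oplus> t = (x \<oplus> x') \<otimes> e \<oplus> (y \<oplus> y') \<otimes> e" "u \<oplus> w = (x \<oplus> x') \<otimes> e"
      unfolding 1 2 using car eR by algebra+
    then show ?thesis unfolding gB_def using 1 2 B.a_closed C.a_closed by blast
  qed
  have gC_add: "gC (s \<oplus> t) (u \<oplus> w)" if g: "gC s u" "gC t w" for s t u w
  proof -
    obtain x y a where 1: "x \<in> B" "y \<in> C" "a \<in> B" "s = x \<otimes> e \<oplus> y \<otimes> e" "u = a \<otimes> e" "a \<ominus> y \<in> E"
      using g(1) by (auto simp: gC_def)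
    obtain x' y' a' where 2: "x' \<in> B" "y' \<in> C" "a' \<in> B" "t = x' \<otimes> e \<oplus> y' \<otimes> e" "w = a' \<otimes> e" "a' \<ominus> y' \<in> E"
      using g(2) by (auto simp: gC_def)
    have car: "x \<in> carrier R" "x' \<in> carrier R" "y \<in> carrier R" "y' \<in> carrier R"
      "a \<in> carrier R" "a' \<in> carrier R"
      using 1 2 B.Icarr C.Icarr by auto
    have "s \<oplus> t = (x \<oplus> x') \<otimes> e \<oplus> (y \<oplus> y') \<otimes> e" "u \<oplus> w = (a \<oplus> a') \<otimes> e"
      "(a \<oplus> a') \<ominus> (y \<oplus> y') = (a \<ominus> y) \<oplus> (a' \<ominus> y')"
      unfolding 1(4,5) 2(4,5) using car eR by algebra+
    moreover have "(a \<ominus> y) \<oplus> (a' \<ominus> y') \<in> E" using 1 2 E.a_closed by blast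
    ultimately show ?thesis unfolding gC_def using 1 2 B.a_closed C.a_closed by metis
  qed
  have gB_smult: "gB (c \<otimes> s) (c \<otimes> u)" if c: "c \<in> carrier R" and g: "gB s u" for c s u
  proof -
    obtain x y where 1: "x \<in> B" "y \<in> C" "s = x \<otimes> e \<oplus> y \<otimes> e" "u = x \<otimes> e"
      using g(1) by (auto simp: gB_def)
    have car: "x \<in> carrier R" "y \<in> carrier R" using 1 B.Icarr C.Icarr by auto
    have "c \<otimes> s = (c \<otimes> x) \<otimes> e \<oplus> (c \<otimes> y) \<otimes> e" "c \<otimes> u = (c \<otimes> x) \<otimes> e"
      unfolding 1 using car c eR by algebra+
    then show ?thesis unfolding gB_def using 1 c B.I_l_closed C.I_l_closed by blast
  qed
  have gC_smult: "gC (c \<otimes> s) (c \<otimes> u)" if c: "c \<in> carrier R" and g: "gC s u" for c s u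
  proof -
    obtain x y a where 1: "x \<in> B" "y \<in> C" "a \<in> B" "s = x \<otimes> e \<oplus> y \<otimes> e" "u = a \<otimes> e" "a \<ominus> y \<in> E"
      using g(1) by (auto simp: gC_def)
    have car: "x \<in> carrier R" "y \<in> carrier R" "a \<in> carrier R" using 1 B.Icarr C.Icarr by auto
    have "c \<otimes> s = (c \<otimes> x) \<otimes> e \<oplus> (c \<otimes> y) \<otimes> e" "c \<otimes> u = (c \<otimes> a) \<otimes> e"
      "c \<otimes> a \<ominus> c \<otimes> y = c \<otimes> (a \<ominus> y)"
      unfolding 1(4,5) using car c eR by algebra+
    moreover have "c \<otimes> (a \<ominus> y) \<in> E" using 1 c E.I_l_closed by blast
    ultimately show ?thesis unfolding gC_def using 1 c B.I_l_closed C.I_l_closed by metis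
  qed
  have gB_P: "gB (x \<otimes> p) (x \<otimes> p)" if x: "x \<in> B" and p: "p \<in> P" for x p
  proof -
    obtain a where a: "a \<in> carrier R" "p = a \<otimes> e" using p PE by auto
    have xa: "x \<otimes> a \<in> B" "x \<otimes> a \<in> carrier R" using B.I_r_closed x a B.Icarr by auto
    have e1: "x \<otimes> p = (x \<otimes> a) \<otimes> e" unfolding a(2) using a x eR B.Icarr by (simp add: m_assoc)
    moreover have "(x \<otimes> a) \<otimes> e = (x \<otimes> a) \<otimes> e \<oplus> \<zero> \<otimes> e" using xa eR by simp
    ultimately show ?thesis unfolding gB_def using xa C.zero_closed by metis
  qed
  have gC_P: "gC (y \<otimes> p) (x \<otimes> p)" if x: "x \<in> B" and y: "y \<in> C" and xy: "x \<ominus> y \<in> E" and p: "p \<in> P" for x y p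
  proof -
    obtain a where a: "a \<in> carrier R" "p = a \<otimes> e" using p PE by auto
    have car: "x \<in> carrier R" "y \<in> carrier R" using x y B.Icarr C.Icarr by auto
    have ya: "x \<otimes> a \<in> B" "y \<otimes> a \<in> C" using B.I_r_closed C.I_r_closed x y a by auto
    have "y \<otimes> p = \<zero> \<otimes> e \<oplus> (y \<otimes> a) \<otimes> e" "x \<otimes> p = (x \<otimes> a) \<otimes> e"
      unfolding a(2) using a car eR by algebra+
    moreover have "x \<otimes> a \<ominus> y \<otimes> a = (x \<ominus> y) \<otimes> a" using car a by algebra
    then have "x \<otimes> a \<ominus> y \<otimes> a \<in> E" using E.I_r_closed[OF xy a(1)] by simp
    ultimately show ?thesis unfolding gC_def using ya B.zero_closed by metis
  qed
  have eP: "e \<in> P" by (rule e(2))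
  have BeU: "x \<otimes> p \<in> U" if "x \<in> B" "p \<in> P" for x p using gB_U gB_P that by blast
  have vBP: "vB (x \<otimes> p) = h (x \<otimes> p)" if "x \<in> B" "p \<in> P" for x p by (rule vB[OF gB_P[OF that]])
  have vCP: "vC (y \<otimes> p) = vB (x \<otimes> p)" if "x \<in> B" "y \<in> C" "x \<ominus> y \<in> E" "p \<in> P" for x y p
    using vC[OF gC_P[OF that]] vBP that by simp
  have zU: "\<zero> \<in> U" and hz: "h \<zero> = \<zero>\<^bsub>L\<^esub>" using sD(2)[OF Usub] L.h_zero by auto
  have "kronecker_data R B C L e vB vC"
  proof (intro kronecker_data.intro kronecker_data_axioms.intro, unfold PE[symmetric])
    show "ring R" ..
    show "ideal B R" "ideal C R" by (rule ids)+
    show "left_module R L" by (rule L.left_module_N)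
    show "e \<in> carrier R" by (rule eR)
  next
    fix s assume s: "s \<in> ?S"
    show "vB s \<in> carrier L" using S_gB[OF s] vB gB_U L.h_closed by fastforce
    show "vC s \<in> carrier L" using S_gC[OF s] vC gC_U L.h_closed by fastforce
    fix t assume t: "t \<in> ?S"
    show "vB (s \<oplus> t) = vB s \<oplus>\<^bsub>L\<^esub> vB t"
    proof -
      obtain u w where uw: "gB s u" "gB t w" using S_gB[OF s] S_gB[OF t] by blast
      show ?thesis unfolding vB[OF uw(1)] vB[OF uw(2)] vB[OF gB_add[OF uw]]
        by (rule hadd[OF gB_U[OF uw(1)] gB_U[OF uw(2)]])
    qed
    show "vC (s \<oplus> t) = vC s \<oplus>\<^bsub>L\<^esub> vC t"
    proof -
      obtain u w where uw: "gC s u" "gC t w" using S_gC[OF s] S_gC[OF t] by blast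
      show ?thesis unfolding vC[OF uw(1)] vC[OF uw(2)] vC[OF gC_add[OF uw]]
        by (rule hadd[OF gC_U[OF uw(1)] gC_U[OF uw(2)]])
    qed
  next
    fix a s assume a: "a \<in> carrier R" and s: "s \<in> ?S"
    show "vB (a \<otimes> s) = a \<odot>\<^bsub>L\<^esub> vB s" 
    proof -
      obtain u where u: "gB s u" using S_gB[OF s] by blast
      show ?thesis unfolding vB[OF u] vB[OF gB_smult[OF a u]] by (rule hsm[OF a gB_U[OF u]])
    qed
    show "vC (a \<otimes> s) = a \<odot>\<^bsub>L\<^esub> vC s" 
    proof -
      obtain u where u: "gC s u" using S_gC[OF s] by blast
      show ?thesis unfolding vC[OF u] vC[OF gC_smult[OF a u]] by (rule hsm[OF a gC_U[OF u]])
    qed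
  next
    fix y assume y: "y \<in> C"
    have "gB (y \<otimes> e) \<zero>"
      unfolding gB_def using y eR C.Icarr[OF y] B.zero_closed by (intro bexI[of _ \<zero>] bexI[of _ y]) auto
    then show "vB (y \<otimes> e) = \<zero>\<^bsub>L\<^esub>" using vB hz by simp
  next
    fix x assume x: "x \<in> B"
    have "gC (x \<otimes> e) \<zero>"
      unfolding gC_def using x eR B.Icarr[OF x] B.zero_closed C.zero_closed E.zero_closed
      by (intro bexI[of _ x] bexI[of _ \<zero>]) (auto simp: a_minus_def)
    then show "vC (x \<otimes> e) = \<zero>\<^bsub>L\<^esub>" using vC hz by simp
  next
    fix x assume x: "x \<in> B"
    have "x \<in> C <+>\<^bsub>R\<^esub> E" using lat(6) x by blast
    then obtain y z where yz: "y \<in> C" "z \<in> E" "x = y \<oplus> z" unfolding set_add_mem by blast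
    have "x \<ominus> y = z" unfolding yz(3) using C.Icarr[OF yz(1)] E.Icarr[OF yz(2)] by algebra
    then show "\<exists>y\<in>C. \<forall>p\<in>P. vC (y \<otimes> p) = vB (x \<otimes> p)" using vCP[OF x yz(1)] yz by blast
  next
    fix y assume y: "y \<in> C"
    then obtain x where "x \<in> B" "x \<ominus> y \<in> E" using gC_exists by blast
    then show "\<exists>x\<in>B. \<forall>p\<in>P. vB (x \<otimes> p) = vC (y \<otimes> p)" using vCP y by metis
  next
    fix l assume "l \<in> carrier L"
    then show "\<exists>x\<in>B. vB (x \<otimes> e) = l" using hsurj vBP eP by metis
  next
    fix l l' assume l: "l \<in> carrier L" "l \<noteq> \<zero>\<^bsub>L\<^esub>" "l' \<in> carrier L"
    obtain x where x: "x \<in> B" "l = h (x \<otimes> e)" using hsurj l by blast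
    obtain x' where x': "x' \<in> B" "l' = h (x' \<otimes> e)" using hsurj l by blast
    let ?u = "x \<otimes> e"
    have uB: "?u \<in> B" "?u \<in> carrier R" using x eR B.I_r_closed B.Icarr by auto
    have uQ: "?u \<notin> Q" using l x hker BeU eP by blast
    \<comment> \<open>By maximality of \<open>Q\<close>, a submodule of \<open>B\<close> strictly
      above \<open>Q\<close> contains \<open>B e\<close>; hence every nonzero class generates
      \<open>L\<close>.\<close>
    let ?N = "{a \<otimes> ?u | a. a \<in> carrier R} <+>\<^bsub>?M\<^esub> Q"
    have cyc: "submodule {a \<otimes> ?u | a. a \<in> carrier R} R ?M" by (rule sCyc[OF uB(2)]) simp
    have N: "submodule ?N R ?M" by (rule M.submod_add[OF cyc Qsub])
    have upN: "{a \<otimes> ?u | a. a \<in> carrier R} \<subseteq> ?N" "Q \<subseteq> ?N"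
      by (rule M.submod_add_upper1[OF cyc Qsub], rule M.submod_add_upper2[OF cyc Qsub])
    have Bsub: "submodule B R ?M" by (rule sI) (auto simp: B.Icarr B.I_l_closed)
    have NB: "?N \<subseteq> B" by (rule M.submod_add_least[OF Bsub _ QB]) (use uB B.I_l_closed in auto)
    have "?u = \<one> \<otimes> ?u" using uB by simp
    then have "?u \<in> ?N" using upN by blast
    then have "?N \<noteq> Q" using uQ by blast
    then have "\<not> Q2 ?N" using maxQ upN by blast
    then have "x' \<otimes> e \<in> ?N" using N DQ upN NB x' unfolding Q2_def by blast
    then obtain a q where aq: "a \<in> carrier R" "q \<in> Q" "x' \<otimes> e = a \<otimes> ?u \<oplus> q" unfolding M.mem_set_add by auto
    have auU: "a \<otimes> ?u \<in> U" using sD(7)[OF Usub aq(1)] BeU x eP by blast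
    have "h (x' \<otimes> e) = h (a \<otimes> ?u) \<oplus>\<^bsub>L\<^esub> h q" unfolding aq(3) using hadd auU up aq by blast
    also have "h q = \<zero>\<^bsub>L\<^esub>" using hker aq up by blast
    also have "h (a \<otimes> ?u) \<oplus>\<^bsub>L\<^esub> \<zero>\<^bsub>L\<^esub> = h (a \<otimes> ?u)" using L.h_closed[OF auU] by simp
    finally have "l' = a \<odot>\<^bsub>L\<^esub> l" using hsm[OF aq(1) BeU[OF x(1) eP]] x(2) x'(2) by simp
    then show "\<exists>a\<in>carrier R. l' = a \<odot>\<^bsub>L\<^esub> l" using aq by blast
  next
    obtain x where x: "x \<in> B" "x \<otimes> e \<notin> Q" using Q unfolding Q2_def by blast
    then have "h (x \<otimes> e) \<noteq> \<zero>\<^bsub>L\<^esub>" "h (x \<otimes> e) \<in> carrier L" using hker BeU eP L.h_closed by auto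
    then show "carrier L \<noteq> {\<zero>\<^bsub>L\<^esub>}" by blast
  next
    fix p q assume p: "p \<in> P - {p \<in> P. \<forall>x\<in>B. vB (x \<otimes> p) = \<zero>\<^bsub>L\<^esub>}" and q: "q \<in> P"
    then obtain x where x: "x \<in> B" "vB (x \<otimes> p) \<noteq> \<zero>\<^bsub>L\<^esub>" "p \<in> P" by blast
    then have "x \<otimes> p \<notin> D" using vBP hker BeU DQ by (metis subsetD)
    then have "q \<in> {a \<otimes> p | a. a \<in> carrier R}" using PminD x q by blast
    then show "\<exists>a\<in>carrier R. q = a \<otimes> p" by blast
  qed
  then show ?thesis by blast
qed

section \<open>The accordion\<close>

lemma (in module_over_algebra) scalar_span_map:
  assumes U: "submodule U A M" and N: "left_module A N"
    and f0: "f \<zero>\<^bsub>M\<^esub> = \<zero>\<^bsub>N\<^esub>"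
    and add: "\<And>x y. x \<in> U \<Longrightarrow> y \<in> U \<Longrightarrow> f (x \<oplus>\<^bsub>M\<^esub> y) = f x \<oplus>\<^bsub>N\<^esub> f y"
    and smult: "\<And>a x. a \<in> carrier A \<Longrightarrow> x \<in> U \<Longrightarrow> f (a \<odot>\<^bsub>M\<^esub> x) = a \<odot>\<^bsub>N\<^esub> f x"
    and vs: "set vs \<subseteq> U" and x: "x \<in> scalar_span K A M vs"
  shows "x \<in> U \<and> f x \<in> scalar_span K A N (map f vs)"
  using vs x
proof (induction vs arbitrary: x)
  case Nil
  then show ?case using f0 submodD(2)[OF U] by simp
next
  case (Cons v vs)
  then obtain c s where c: "c \<in> carrier K" "s \<in> scalar_span K A M vs"
    and x: "x = scal c \<odot>\<^bsub>M\<^esub> v \<oplus>\<^bsub>M\<^esub> s" by auto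
  have s: "s \<in> U" "f s \<in> scalar_span K A N (map f vs)" using Cons.IH[OF _ c(2)] Cons.prems by auto
  have v: "v \<in> U" using Cons.prems by simp
  have cv: "scal c \<odot>\<^bsub>M\<^esub> v \<in> U" using submodD(7)[OF U scal_closed[OF c(1)] v] .
  have "f x = scal c \<odot>\<^bsub>N\<^esub> f v \<oplus>\<^bsub>N\<^esub> f s"
    unfolding x using add[OF cv s(1)] smult[OF scal_closed[OF c(1)] v] by simp
  moreover have "x \<in> U" unfolding x using submodD(4)[OF U cv s(1)] .
  ultimately show ?case using c(1) s(2) by auto
qed

text \<open>The arguments stand for W(2n-1), W(2n+1), R(2n), M(2n), R(2n+1) in this order.\<close>

definition accordion_link ::
    "'k ring \<Rightarrow> ('k, 'a) module \<Rightarrow> ('a, nat \<Rightarrow> 'k) module \<Rightarrow> ('a, nat \<Rightarrow> 'k) module \<Rightarrow>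
      ('a, nat \<Rightarrow> 'k) module \<Rightarrow> ('a, nat \<Rightarrow> 'k) module \<Rightarrow> ('a, nat \<Rightarrow> 'k) module \<Rightarrow> bool" where
  "accordion_link K A W W' R M R' \<longleftrightarrow>
    fd_left_module K A R \<and> fd_left_module K A M \<and> fd_left_module K A R' \<and>
    (\<exists>p. couniform_projection A R W p \<and> \<not> invertible_hom A R W p) \<and>
    (\<exists>q. couniform_projection A M R q \<and> \<not> invertible_hom A M R q) \<and>
    (\<exists>u. uniform_inclusion A M R' u \<and> \<not> invertible_hom A M R' u) \<and>
    (\<exists>v. uniform_inclusion A R' W' v \<and> \<not> invertible_hom A R' W' v)"

locale kronecker_algebra = alg: assoc_algebra K A + kronecker_data A B C L e vB vC S P P'
  for K :: "'k ring" and A :: "('k, 'a) module" (structure) and B C L e vB vC S P P' +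
  fixes bs
  assumes bs: "set bs \<subseteq> carrier A" "carrier A \<subseteq> scalar_span K A (regular_module A) bs"
begin

sublocale FK: module_over_algebra K A F
  by (intro module_over_algebra.intro F.left_module_axioms alg.assoc_algebra_axioms)

lemma PP_span_list: "\<exists>vs. set vs \<subseteq> PP (set is) \<and> PP (set is) \<subseteq> scalar_span K A F vs"
proof (induction "is")
  case Nil
  have "PP {} \<subseteq> {\<zero>\<^bsub>F\<^esub>}" by (auto simp: PP_def int_functions_simps)
  then show ?case by (intro exI[of _ "[]"]) simp
next
  case (Cons i "is")
  then obtain vs where vs: "set vs \<subseteq> PP (set is)" "PP (set is) \<subseteq> scalar_span K A F vs" by blast
  define f where "f a = single A i (a \<otimes> e)" for a
  interpret reg: module_over_algebra K A "regular_module A"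
    by (intro module_over_algebra.intro alg.A.left_module_regular alg.assoc_algebra_axioms)
  have f: "f a \<in> scalar_span K A F (map f bs)" if a: "a \<in> carrier A" for a
  proof (rule reg.scalar_span_map[THEN conjunct2])
    show "submodule (carrier A) A (regular_module A)" using reg.submod_carrier by simp
    show "left_module A F" by (rule F.left_module_axioms)
    show "a \<in> scalar_span K A (regular_module A) bs" using a bs by blast
  qed (use e bs in \<open>auto simp: f_def single_def int_functions_simps alg.A.l_distr alg.A.m_assoc\<close>)
  have sub: "PP (set is) \<subseteq> PP (set (i # is))" by (rule PP_mono) auto
  have fbs: "set (map f bs) \<subseteq> PP (set (i # is))"
    using bs P_smult[OF _ e_P] single_PP unfolding f_def by auto
  have "u \<in> scalar_span K A F (map f bs @ vs)" if u: "u \<in> PP (set (i # is))" for u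
  proof -
    let ?u = "u(i := \<zero>)"
    have u': "?u \<in> PP (set is)" using u P_zero by (auto simp: PP_def)
    obtain a where a: "a \<in> carrier A" "u i = a \<otimes> e" using PP_PD[OF u, of i] by (auto simp: P_def)
    have ui: "a \<otimes> e \<in> carrier A" using a e by simp
    have "u = f a \<oplus>\<^bsub>F\<^esub> ?u"
      using PP_carrier[OF u] a ui by (auto simp: f_def single_def int_functions_simps fun_eq_iff)
    moreover have "f a \<oplus>\<^bsub>F\<^esub> ?u \<in> scalar_span K A F (map f bs @ vs)"
      by (rule FK.scalar_span_append) (use f[OF a(1)] u' vs fbs sub PP_carrier in auto)
    ultimately show ?thesis by simp
  qed
  then show ?case using fbs vs(1) sub by (intro exI[of _ "map f bs @ vs"]) auto
qed

lemma PP_span: obtains vs where "set vs \<subseteq> PP {a..b}" "PP {a..b} \<subseteq> scalar_span K A F vs"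
  using PP_span_list[of "[a..b]"] that by auto

sublocale kronecker_finite
proof
  fix a b
  obtain vs where "set vs \<subseteq> PP {a..b}" "PP {a..b} \<subseteq> scalar_span K A F vs" using PP_span .
  then show "bounded_length A F (PP {a..b})"
    using bounded_length_mono[OF FK.scalar_span_bounded_length] PP_carrier by blast
qed

lemma presentation_in_functions:
  assumes "submodule U A F" "submodule Z A F" "Z \<subseteq> U" "U \<subseteq> PP {a..b}"
  shows "\<exists>(N :: ('a, nat \<Rightarrow> 'k) module) h. presentation A F U Z N h"
proof -
  obtain vs where vs: "set vs \<subseteq> PP {a..b}" "PP {a..b} \<subseteq> scalar_span K A F vs" using PP_span .
  have "set vs \<subseteq> carrier F" using vs PP_carrier by blast
  then obtain \<kappa> :: "(int \<Rightarrow> 'a) \<Rightarrow> nat \<Rightarrow> 'k" where "inj_on \<kappa> (scalar_span K A F vs)"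
    using FK.scalar_span_inj by blast
  then have "inj_on \<kappa> U" by (rule inj_on_subset) (use vs(2) assms(4) in order)
  from F.presentation_exists[OF assms(1-3) this] show ?thesis .
qed

text \<open>The part of \<open>U\<close> outside \<open>PP {a..b}\<close> comes from the kernel, so
  the images of a spanning list of \<open>PP {a..b}\<close> span \<open>N\<close>.\<close>

lemma fd_presentation:
  assumes pres: "presentation A F U Z N h" and U: "PP {a..b} \<subseteq> U" "U \<subseteq> PP {a..b} <+>\<^bsub>F\<^esub> Z"
  shows "fd_left_module K A N"
proof -
  interpret pr: presentation A F U Z N h by fact
  interpret NK: module_over_algebra K A N
    by (intro module_over_algebra.intro pr.left_module_N alg.assoc_algebra_axioms)
  obtain vs where vs: "set vs \<subseteq> PP {a..b}" "PP {a..b} \<subseteq> scalar_span K A F vs" using PP_span .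
  have "carrier N \<subseteq> scalar_span K A N (map h vs)"
  proof
    fix n assume "n \<in> carrier N"
    then obtain u where u: "u \<in> U" "n = h u" using pr.h_surj by blast
    then have "u \<in> PP {a..b} <+>\<^bsub>F\<^esub> Z" using U(2) by blast
    then obtain p z where pz: "p \<in> PP {a..b}" "z \<in> Z" "u = p \<oplus>\<^bsub>F\<^esub> z" unfolding F.mem_set_add by blast
    have pU: "p \<in> U" "z \<in> U" using pz U(1) pr.YU by auto
    have "h z = \<zero>\<^bsub>N\<^esub>" using pr.kernel pU pz by blast
    then have "n = h p" using u pz pr.h_add[OF pU] pr.h_closed[OF pU(1)] by simp
    moreover have "h p \<in> scalar_span K A N (map h vs)"
      by (rule FK.scalar_span_map[OF pr.U pr.left_module_N pr.h_zero pr.h_add pr.h_smult, THEN conjunct2])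
        (use vs pz U in auto)
    ultimately show "n \<in> scalar_span K A N (map h vs)" by simp
  qed
  moreover have "set (map h vs) \<subseteq> carrier N" using vs U pr.h_closed by auto
  ultimately show ?thesis
    unfolding fd_left_module_def using NK.finite_dim_of_scalar_span pr.left_module_N by blast
qed

text \<open>\<open>W\<close> and \<open>W'\<close> are universally quantified because neighbouring
  turns share them: they are fixed once, after all relation modules have been chosen.\<close>

lemma accordion_step:
  assumes st0: "stage 0 1 {1} Z0" and st: "stage a b {a+1..b} Z" and ab: "a < b"
  shows "\<exists>Z'. stage (a - 1) (b + 1) {a..b+1} Z' \<and>
    (\<forall>(W :: ('a, nat \<Rightarrow> 'k) module) h (W' :: ('a, nat \<Rightarrow> 'k) module) h'.
      presentation A F (PP {a..b}) Z W h \<longrightarrow> presentation A F (PP {a-1..b+1}) Z' W' h' \<longrightarrow>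
      (\<exists>R M R'. accordion_link K A W W' R M R'))"
proof -
  show ?thesis
  proof (rule stage_step[OF st0 st ab])
    fix ZR ZM Z' assume
      st': "stage (a - 1) (b + 1) {a..b+1} Z'" and
      Z: "submodule ZR A F" "submodule ZM A F" "ZM \<subset> ZR" "ZR \<subset> Z" "ZM = PP {a..b} \<inter> Z'" and
      ind: "\<And>V. \<lbrakk>submodule V A F; ZR \<subseteq> V; V \<subseteq> Z\<rbrakk> \<Longrightarrow> indecomposable_section A F (PP {a..b}) V"
      "\<And>V. \<lbrakk>submodule V A F; ZM \<subseteq> V; V \<subseteq> ZR\<rbrakk> \<Longrightarrow> indecomposable_section A F (PP {a..b}) V"
      "\<And>V. \<lbrakk>submodule V A F; PP {a..b} \<subseteq> V; Z' \<subseteq> V; V \<subseteq> PP {a-1..b} <+>\<^bsub>F\<^esub> Z'\<rbrakk> \<Longrightarrow> indecomposable_section A F V Z'"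
      "\<And>V. \<lbrakk>submodule V A F; PP {a-1..b} <+>\<^bsub>F\<^esub> Z' \<subseteq> V; V \<subseteq> PP {a-1..b+1}\<rbrakk> \<Longrightarrow> indecomposable_section A F V Z'" and
      ne: "\<not> PP {a-1..b} <+>\<^bsub>F\<^esub> Z' \<subseteq> PP {a..b} <+>\<^bsub>F\<^esub> Z'"
      "\<not> PP {a-1..b+1} \<subseteq> (PP {a-1..b} <+>\<^bsub>F\<^esub> Z') <+>\<^bsub>F\<^esub> Z'"
    let ?R = "PP {a-1..b} <+>\<^bsub>F\<^esub> Z'"
    have ZP: "Z \<subseteq> PP {a..b}" and Z': "submodule Z' A F" "Z' \<subseteq> PP {a-1..b+1}"
      using st st' by (auto simp: stage_def)
    have Rsub: "submodule ?R A F" by (rule F.submod_add[OF PP_submodule Z'(1)])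
    have Rup: "PP {a-1..b} \<subseteq> ?R" "Z' \<subseteq> ?R"
      by (rule F.submod_add_upper1[OF PP_submodule Z'(1)], rule F.submod_add_upper2[OF PP_submodule Z'(1)])
    have mono: "PP {a..b} \<subseteq> PP {a-1..b}" "PP {a-1..b} \<subseteq> PP {a-1..b+1}" by (rule PP_mono; auto)+
    have RI: "?R \<subseteq> PP {a-1..b+1}" by (rule F.submod_add_least[OF PP_submodule mono(2) Z'(2)])
    have self: "PP {a..b} \<subseteq> PP {a..b} <+>\<^bsub>F\<^esub> Y" if "submodule Y A F" for Y
      by (rule F.submod_add_upper1[OF PP_submodule that])
    obtain R :: "('a, nat \<Rightarrow> 'k) module" and hR where R: "presentation A F (PP {a..b}) ZR R hR"
      using presentation_in_functions[OF PP_submodule Z(1), of "{a..b}" a b] Z(4) ZP by blast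
    obtain M :: "('a, nat \<Rightarrow> 'k) module" and hM where M: "presentation A F (PP {a..b}) ZM M hM"
      using presentation_in_functions[OF PP_submodule Z(2), of "{a..b}" a b] Z(5) by blast
    obtain R' :: "('a, nat \<Rightarrow> 'k) module" and hR' where R': "presentation A F ?R Z' R' hR'"
      using presentation_in_functions[OF Rsub Z'(1) Rup(2) RI] by blast
    have fd: "fd_left_module K A R" "fd_left_module K A M" "fd_left_module K A R'"
      using fd_presentation[OF R order_refl self[OF Z(1)]] fd_presentation[OF M order_refl self[OF Z(2)]]
        fd_presentation[OF R' Rup(1) order_refl] by auto
    have "accordion_link K A W W' R M R'"
      if W: "presentation A F (PP {a..b}) Z W h" and W': "presentation A F (PP {a-1..b+1}) Z' W' h'"
      for W W' :: "('a, nat \<Rightarrow> 'k) module" and h h'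
      unfolding accordion_link_def
    proof (intro conjI fd)
      show "\<exists>p. couniform_projection A R W p \<and> \<not> invertible_hom A R W p"
        by (rule couniform_projection_of_sections[OF R W Z(4) ind(1)])
      show "\<exists>q. couniform_projection A M R q \<and> \<not> invertible_hom A M R q"
        by (rule couniform_projection_of_sections[OF M R Z(3) ind(2)])
      have "PP {a..b} \<subseteq> ?R" using mono Rup by blast
      then show "\<exists>u. uniform_inclusion A M R' u \<and> \<not> invertible_hom A M R' u"
        by (rule uniform_inclusion_of_sections[OF M R' _ Z(5) ne(1) ind(3)])
      have "Z' = ?R \<inter> Z'" using Rup by blast
      then show "\<exists>v. uniform_inclusion A R' W' v \<and> \<not> invertible_hom A R' W' v"
        using uniform_inclusion_of_sections[OF R' W' RI _ ne(2) ind(4)] Rup by blast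
    qed
    then show ?thesis using st' by blast
  qed
qed

lemma accordion:
  "\<exists>W :: nat \<Rightarrow> ('a, nat \<Rightarrow> 'k) module. uniform_module A (W 0) \<and>
    (\<forall>n. fd_left_module K A (W n) \<and> (\<exists>R M R'. accordion_link K A (W n) (W (Suc n)) R M R'))"
proof -
  obtain Z0 where st0: "stage 0 1 {1} Z0" using initial_stage by blast
  \<comment> \<open>The initial window is \<open>{0..1}\<close>, and each turn adds one index on
    either side.\<close>
  define a b :: "nat \<Rightarrow> int" where "a n = - int n" and "b n = int n + 1" for n
  have ab: "a n < b n" "a (Suc n) = a n - 1" "b (Suc n) = b n + 1" for n by (auto simp: a_def b_def)
  define T where "T n Z Z' \<longleftrightarrow> (\<forall>(W :: ('a, nat \<Rightarrow> 'k) module) h (W' :: ('a, nat \<Rightarrow> 'k) module) h'.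
      presentation A F (PP {a n..b n}) Z W h \<longrightarrow> presentation A F (PP {a n-1..b n+1}) Z' W' h' \<longrightarrow>
      (\<exists>R M R'. accordion_link K A W W' R M R'))" for n Z Z'
  have "\<exists>Z. \<forall>n. stage (a n) (b n) {a n+1..b n} (Z n) \<and> T n (Z n) (Z (Suc n))"
  proof (rule dependent_nat_choice)
    show "\<exists>Z. stage (a 0) (b 0) {a 0+1..b 0} Z" using st0 by (auto simp: a_def b_def)
    fix Z n assume st: "stage (a n) (b n) {a n+1..b n} Z"
    have "\<exists>Z'. stage (a n - 1) (b n + 1) {a n..b n+1} Z' \<and> T n Z Z'"
      unfolding T_def by (rule accordion_step[OF st0 st ab(1)])
    then show "\<exists>Z'. stage (a (Suc n)) (b (Suc n)) {a (Suc n)+1..b (Suc n)} Z' \<and> T n Z Z'"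
      by (simp add: ab)
  qed
  then obtain Z where st: "\<And>n. stage (a n) (b n) {a n+1..b n} (Z n)" and T: "\<And>n. T n (Z n) (Z (Suc n))" by blast
  have Z: "submodule (Z n) A F" "Z n \<subseteq> PP {a n..b n}" for n using st by (auto simp: stage_def)
  have "\<forall>n. \<exists>Wh. presentation A F (PP {a n..b n}) (Z n) (fst Wh :: ('a, nat \<Rightarrow> 'k) module) (snd Wh)"
    using presentation_in_functions[OF PP_submodule Z order_refl] by (metis fst_conv snd_conv)
  then obtain Wh where Wh: "\<And>n. presentation A F (PP {a n..b n}) (Z n)
      (fst (Wh n) :: ('a, nat \<Rightarrow> 'k) module) (snd (Wh n))" by metis
  define W where "W n = fst (Wh n)" for n
  have W: "presentation A F (PP {a n..b n}) (Z n) (W n) (snd (Wh n))" for n unfolding W_def by (rule Wh)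
  have W': "presentation A F (PP {a n-1..b n+1}) (Z (Suc n)) (W (Suc n)) (snd (Wh (Suc n)))" for n
    using W[of "Suc n"] by (simp add: ab)
  have link: "\<exists>R M R'. accordion_link K A (W n) (W (Suc n)) R M R'" for n
    using T[of n] W W' unfolding T_def by blast
  have fdW: "fd_left_module K A (W n)" for n
    by (rule fd_presentation[OF W order_refl F.submod_add_upper1[OF PP_submodule Z(1)]])
  have st1: "stage 0 1 {1} (Z 0)" using st[of 0] by (simp add: a_def b_def)
  have W0: "presentation A F (PP {0..1}) (Z 0) (W 0) (snd (Wh 0))" using W[of 0] by (simp add: a_def b_def)
  have "PP {0..1} \<noteq> Z 0"
  proof
    assume "PP {0..1} = Z 0"
    then have "HH {0..1} \<subseteq> KK {0..1} {1}" using st1 HH_PP by (auto simp: stage_def)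
    moreover obtain h where "h \<in> HH {0..1}" "val 1 h \<noteq> \<zero>\<^bsub>L\<^esub>" using val_nonzero[of 1 0 1] by auto
    ultimately show False by (auto simp: KK_def)
  qed
  then have "uniform_module A (W 0)"
    by (rule presentation.uniform_module_of_section[OF W0]) (rule initial_stage_uniform[OF st1])
  with link fdW show ?thesis by blast
qed

end

theorem mainTheorem1:
  fixes K :: "'k ring" and A :: "('k, 'a) module"
  assumes "algebraically_closed K"
    and "assoc_algebra K A"
    and "finite_dim K A"
    and "\<not> distributive_ideal_lattice A"
  shows "\<exists>(M :: nat \<Rightarrow> ('a, nat \<Rightarrow> 'k) module) (R :: nat \<Rightarrow> ('a, nat \<Rightarrow> 'k) module)
           (W :: nat \<Rightarrow> ('a, nat \<Rightarrow> 'k) module) p q u v.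
    uniform_module A (W 1) \<and>
    (\<forall>n \<ge> 1.
      fd_left_module K A (W (2 * n - 1)) \<and> fd_left_module K A (R (2 * n)) \<and>
      fd_left_module K A (M (2 * n)) \<and> fd_left_module K A (R (2 * n + 1)) \<and>
      fd_left_module K A (W (2 * n + 1)) \<and>
      couniform_projection A (R (2 * n)) (W (2 * n - 1)) (p n) \<and>
      \<not> invertible_hom A (R (2 * n)) (W (2 * n - 1)) (p n) \<and>
      couniform_projection A (M (2 * n)) (R (2 * n)) (q n) \<and>
      \<not> invertible_hom A (M (2 * n)) (R (2 * n)) (q n) \<and>
      uniform_inclusion A (M (2 * n)) (R (2 * n + 1)) (u n) \<and>
      \<not> invertible_hom A (M (2 * n)) (R (2 * n + 1)) (u n) \<and>
      uniform_inclusion A (R (2 * n + 1)) (W (2 * n + 1)) (v n) \<and>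
      \<not> invertible_hom A (R (2 * n + 1)) (W (2 * n + 1)) (v n))"
proof -
  interpret assoc_algebra K A by fact
  obtain bs where bs: "set bs \<subseteq> carrier A" "carrier A \<subseteq> scalar_span K A (regular_module A) bs"
    using regular_scalar_span[OF assms(3)] .
  interpret reg: module_over_algebra K A "regular_module A"
    by (intro module_over_algebra.intro A.left_module_regular assoc_algebra_axioms)
  have "bounded_length A (regular_module A) (carrier A)"
    using bounded_length_mono[OF reg.scalar_span_bounded_length bs(2)] bs(1) by simp
  then obtain B C e vB vC and L :: "('a, 'a) module" where "kronecker_data A B C L e vB vC"
    using A.kronecker_data_exists[OF assms(4)] by blast
  then have "kronecker_algebra K A B C L e vB vC bs"
    by (intro kronecker_algebra.intro kronecker_algebra_axioms.intro assoc_algebra_axioms bs)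
  from kronecker_algebra.accordion[OF this] obtain W :: "nat \<Rightarrow> ('a, nat \<Rightarrow> 'k) module"
    where W0: "uniform_module A (W 0)" and W: "\<And>n. fd_left_module K A (W n)"
      and link: "\<forall>n. \<exists>R M R'. accordion_link K A (W n) (W (Suc n)) R M R'" by blast
  from link obtain R M R' :: "nat \<Rightarrow> ('a, nat \<Rightarrow> 'k) module" where
    "\<forall>n. accordion_link K A (W n) (W (Suc n)) (R n) (M n) (R' n)"
    unfolding choice_iff by blast
  then obtain p q u v where all: "\<And>n. fd_left_module K A (R n) \<and> fd_left_module K A (M n) \<and> fd_left_module K A (R' n) \<and>
      couniform_projection A (R n) (W n) (p n) \<and> \<not> invertible_hom A (R n) (W n) (p n) \<and>
      couniform_projection A (M n) (R n) (q n) \<and> \<not> invertible_hom A (M n) (R n) (q n) \<and>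
      uniform_inclusion A (M n) (R' n) (u n) \<and> \<not> invertible_hom A (M n) (R' n) (u n) \<and>
      uniform_inclusion A (R' n) (W (Suc n)) (v n) \<and> \<not> invertible_hom A (R' n) (W (Suc n)) (v n)"
    unfolding accordion_link_def all_conj_distrib choice_iff by (elim conjE exE) (rule that, blast)
  \<comment> \<open>Turn \<open>n - 1\<close> supplies the modules with indices
    \<open>2 n - 1\<close> to \<open>2 n + 1\<close>. The values of \<open>M'\<close> at odd indices
    and of \<open>W'\<close> at even ones are fillers.\<close>
  define M' W' R'' where "M' n = M (n div 2 - 1)" and "W' n = W (n div 2)"
    and "R'' n = (if even n then R (n div 2 - 1) else R' (n div 2 - 1))" for n
  have idx: "M' (2 * n) = M (n - 1)" "W' (2 * n - 1) = W (n - 1)" "W' (2 * n + 1) = W (Suc (n - 1))"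
    "R'' (2 * n) = R (n - 1)" "R'' (2 * n + 1) = R' (n - 1)" if "n \<ge> 1" for n
  proof -
    have "(2 * n - 1) div 2 = n - 1" using that by arith
    then show "M' (2 * n) = M (n - 1)" "W' (2 * n - 1) = W (n - 1)" "W' (2 * n + 1) = W (Suc (n - 1))"
      "R'' (2 * n) = R (n - 1)" "R'' (2 * n + 1) = R' (n - 1)"
      using that by (auto simp: M'_def W'_def R''_def)
  qed
  show ?thesis
  proof (rule exI[of _ M'], rule exI[of _ R''], rule exI[of _ W'], rule exI[of _ "\<lambda>n. p (n - 1)"],
      rule exI[of _ "\<lambda>n. q (n - 1)"], rule exI[of _ "\<lambda>n. u (n - 1)"], rule exI[of _ "\<lambda>n. v (n - 1)"],
      rule conjI)
    show "uniform_module A (W' 1)" using W0 by (simp add: W'_def)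
  qed (intro allI impI, simp only: idx, use all W in blast)
qed

end
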